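(* Let $q\ge 2$ be an integer. For every $\beta>\beta_1(q)$ there exists $k_1\equiv k_1(\beta,q)>0$ such that, for all $k\in(0,k_1)$, there exists $N_0\in\mathbb N$ with the property that for every $N>N_0$ the Markov chain $(\widetilde\Sigma^N(t))_{t\ge 0}$ of the Curie--Weiss--Potts (CWP) model is $e^{-kN}$-metastable with respect to the metastable sets $\{\mathcal M_{i,N}: i\in\mathcal I_\beta\}$.
   Context: **Model.** $\mathcal S_N=\{1,\dots,q\}^N$. The CWP Hamiltonian is $\widetilde H_N(\sigma)=-\frac1N\sum_{1\le i<j\le N}\mathbf 1_{\{\sigma_i=\sigma_j\}}$, with Gibbs measure $\tilde\mu_N(\sigma)=e^{-\beta\widetilde H_N(\sigma)}/\widetilde Z_N$, $\widetilde Z_N=\sum_{\sigma}e^{-\beta\widetilde H_N(\sigma)}$. $(\widetilde\Sigma^N(t))_{t\ge0}$ is the discrete-time Markov chain on $\mathcal S_N$ with transition probabilities $\tilde\pi_N(\sigma,\eta)=\frac1{Nq}e^{-\beta[\widetilde H_N(\eta)-\widetilde H_N(\sigma)]_+}$ if $\sigma,\eta$ differ in exactly one coordinate, $\tilde\pi_N(\sigma,\sigma)=1-\sum_{\eta\ne\sigma}\tilde\pi_N(\sigma,\eta)$, and $0$ otherwise, where $[a]_+=\max\{0,a\}$. $\widetilde{\mathrm P}^N_\nu$ is its law with initial distribution $\nu$, and $\tilde\tau^N_{\mathcal A}=\inf\{t>0:\widetilde\Sigma^N(t)\in\mathcal A\}$. **$\rho_N$-metastability.** Let $\mathcal M_{1},\dots,\mathcal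 M_{K}$ be disjoint subsets of $\mathcal S_N$ with union $\mathcal M$, and $\rho_N>0$. A chain $(\Sigma^N(t))$ on $\mathcal S_N$ with invariant measure $\mu_N$, law $\mathrm P^N$ and return times $\tau^N$ is $\rho_N$-metastable with respect to $\{\mathcal M_1,\dots,\mathcal M_K\}$ when $$K\,\frac{\max_{j}\mathrm P^N_{\mu_N|\mathcal M_j}[\tau^N_{\mathcal M\setminus\mathcal M_j}<\tau^N_{\mathcal M_j}]}{\min_{\emptyset\ne\mathcal X\subset\mathcal S_N\setminus\mathcal M}\mathrm P^N_{\mu_N|\mathcal X}[\tau^N_{\mathcal M}<\tau^N_{\mathcal X}]}\le\rho_N\ll1,$$ where $\mu_N|\mathcal X$ is $\mu_N$ conditioned on $\mathcal X$ and $\rho_N\ll 1$ means $\rho_N\to0$ as $N\to\infty$. **Free energy and metastable sets.** $\mathcal P=\{x\in[0,1]^q:\sum_k x_k=1\}$, $\mathcal P_N=\mathcal P\cap\frac1N\mathbb N_0^q$, and $L_N:\mathcal S_N\to\mathcal P_N$ has components $L_N(\sigma)_k=\frac1N\sum_{i=1}^N\mathbf 1_{\{\sigma_i=k\}}$. The limiting free energy is $\widetilde F_{\beta,q}(x)=-\frac12\|x\|_2^2+\frac1\beta\sum_{i=1}^q x_i\ln x_i$ on $\mathcal P$ (with $0\ln0=0$). $\boldsymbol m_0=(1/q,\dots,1/q)$; for $i\in\{1,\dots,q\}$, $\boldsymbol m_i\in\mathcal P$ has $k$-th coordinate $(1-s)/q$ for $k\ne i$ and $(1+(q-1)s)/q$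 for $k=i$, where $s\in[0,1)$ is the largest solution of $\ln(1+(q-1)s)-\ln(1-s)=\beta s$. The critical temperature $\beta_1(q)$ is the infimum of all $\beta>0$ for which $\widetilde F_{\beta,q}$ has a local minimizer in $\mathcal P$ other than $\boldsymbol m_0$. $\mathcal I_\beta=\{0,\dots,q\}$ if $\beta_1(q)<\beta<q$ and $\mathcal I_\beta=\{1,\dots,q\}$ if $\beta\ge q$. For $i\in\mathcal I_\beta$, $\boldsymbol m_{i,N}\in\mathcal P_N$ is a closest lattice point to $\boldsymbol m_i$, and $\mathcal M_{i,N}=L_N^{-1}(\boldsymbol m_{i,N})$. *)

theory Defs
  imports "HOL-Probability.Probability"
begin

section \<open>Discrete-time Markov chains\<close>

text \<open>The law on path space of the chain with initial distribution \<open>\<nu>\<close> and transition kernel \<open>K\<close>,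
  given by the Ionescu-Tulcea theorem; \<open>chain_law_cylinder\<close> below gives its finite-dimensional
  distributions.\<close>

definition chain_step :: "'s pmf \<Rightarrow> ('s \<Rightarrow> 's pmf) \<Rightarrow> nat \<Rightarrow> (nat \<Rightarrow> 's) \<Rightarrow> 's measure" where
  "chain_step \<nu> K n \<omega> = measure_pmf (if n = 0 then \<nu> else K (\<omega> (n - 1)))"

definition chain_law :: "'s pmf \<Rightarrow> ('s \<Rightarrow> 's pmf) \<Rightarrow> (nat \<Rightarrow> 's) measure" where
  "chain_law \<nu> K =
     projective_family.lim UNIV (Ionescu_Tulcea.CI (chain_step \<nu> K) (\<lambda>_. count_space UNIV))
       (\<lambda>_. count_space UNIV)"

definition return_time :: "'s set \<Rightarrow> (nat \<Rightarrow> 's) \<Rightarrow> enat" where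
  "return_time A \<omega> = (INF t\<in>{t. 0 < t \<and> \<omega> t \<in> A}. enat t)"

definition prob_before :: "'s pmf \<Rightarrow> ('s \<Rightarrow> 's pmf) \<Rightarrow> 's set \<Rightarrow> 's set \<Rightarrow> real" where
  "prob_before \<nu> K A B = \<P>(\<omega> in chain_law \<nu> K. return_time A \<omega> < return_time B \<omega>)"

lemma Ionescu_Tulcea_chain_step: "Ionescu_Tulcea (chain_step \<nu> K) (\<lambda>_. count_space UNIV)"
proof -
  have meas: "chain_step \<nu> K i \<in> measurable (PiM {0..<i} (\<lambda>_. count_space UNIV)) (subprob_algebra (count_space UNIV))" for i
  proof (cases "i = 0")
    case True
    have "(\<lambda>_. measure_pmf \<nu>) \<in> measurable (PiM {0..<i} (\<lambda>_. count_space UNIV)) (subprob_algebra (count_space UNIV))"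
      by (rule measurable_const) (simp add: measure_pmf_in_subprob_algebra)
    with True show ?thesis
      by (auto simp add: chain_step_def[abs_def])
  next
    case False
    have "(\<lambda>\<omega>. \<omega> (i - 1)) \<in> measurable (PiM {0..<i} (\<lambda>_. count_space UNIV)) (count_space UNIV)"
      using False by (intro measurable_component_singleton) auto
    moreover have "(\<lambda>x. measure_pmf (K x)) \<in> measurable (count_space UNIV) (subprob_algebra (count_space UNIV))"
      by (auto simp: measure_pmf_in_subprob_algebra)
    ultimately show ?thesis
      using False unfolding chain_step_def[abs_def] by simp
  qed
  have prob: "prob_space (chain_step \<nu> K i x)" for i x
    unfolding chain_step_def by (rule measure_pmf.prob_space_axioms)
  show ?thesis
    using meas prob by (simp add: Ionescu_Tulcea_def)
qed

lemma sets_chain_law: "sets (chain_law \<nu> K) = sets (PiM UNIV (\<lambda>_. count_space UNIV))"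
proof -
  interpret Ionescu_Tulcea "chain_step \<nu> K" "\<lambda>_. count_space UNIV"
    by (rule Ionescu_Tulcea_chain_step)
  show ?thesis unfolding chain_law_def by (rule PF.sets_lim)
qed

lemma space_chain_law: "space (chain_law \<nu> K) = UNIV"
  using sets_eq_imp_space_eq[OF sets_chain_law] by (simp add: space_PiM)

lemma chain_law_cylinder:
  "emeasure (chain_law \<nu> K) {\<omega>. \<forall>t\<le>n. \<omega> t = x t}
     = ennreal (pmf \<nu> (x 0) * (\<Prod>t<n. pmf (K (x t)) (x (Suc t))))"
proof -
  interpret Ionescu_Tulcea "chain_step \<nu> K" "\<lambda>_. count_space UNIV"
    by (rule Ionescu_Tulcea_chain_step)
  let ?M = "\<lambda>_::nat. count_space (UNIV :: 'a set)"
  let ?X = "\<lambda>n. {restrict x {0..<n}}"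
  have X: "?X n \<in> sets (PiM {0..<n} ?M)" for n
  proof -
    have "?X n = PiE {0..<n} (\<lambda>t. {x t})"
      by (auto simp: PiE_iff extensional_def fun_eq_iff)
    then show ?thesis by (simp only:) (rule sets_PiM_I_finite; simp)
  qed
  have u: "(\<lambda>_. undefined) \<in> space (PiM {0..<0} ?M)"
    by (simp add: space_PiM)
  have eP: "emeasure (eP m \<omega>) (?X (Suc m))
      = indicator (?X m) \<omega> * emeasure (chain_step \<nu> K m x) {x m}"
    if "\<omega> \<in> space (PiM {0..<m} ?M)" for m \<omega>
  proof -
    have ext: "\<omega> t = undefined" if "t \<ge> m" for t
      using that \<open>\<omega> \<in> _\<close> by (auto simp: space_PiM PiE_iff extensional_def)
    have iff: "fun_upd \<omega> m y = restrict x {0..<Suc m} \<longleftrightarrow> \<omega> = restrict x {0..<m} \<and> y = x m" for y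
    proof
      assume *: "fun_upd \<omega> m y = restrict x {0..<Suc m}"
      have "\<omega> t = restrict x {0..<m} t" for t
        using fun_cong[OF *, of t] ext[of t] by (cases "t < m") auto
      moreover have "y = x m" using fun_cong[OF *, of m] by simp
      ultimately show "\<omega> = restrict x {0..<m} \<and> y = x m" by auto
    qed (auto simp: fun_eq_iff)
    have "fun_upd \<omega> m -` ?X (Suc m) \<inter> space (count_space UNIV)
        = (if \<omega> = restrict x {0..<m} then {x m} else {})"
      using iff by auto
    moreover have "chain_step \<nu> K m \<omega> = chain_step \<nu> K m x" if "\<omega> = restrict x {0..<m}"
      using that by (simp add: chain_step_def)
    ultimately show ?thesis
      using emeasure_eP[OF that X] by (simp add: indicator_def)
  qed
  have C: "emeasure (C 0 m (\<lambda>_. undefined)) (?X m)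
      = (\<Prod>t<m. emeasure (chain_step \<nu> K t x) {x t})" for m
  proof (induction m)
    case 0
    show ?case using X[of 0] by (simp add: restrict_def)
  next
    case (Suc m)
    have ne: "space (C 0 m (\<lambda>_. undefined)) \<noteq> {}"
      using prob_space.not_empty[OF prob_space_C[OF u]] .
    have meas: "eP m \<in> measurable (C 0 m (\<lambda>_. undefined)) (subprob_algebra (PiM {0..<Suc m} ?M))"
    proof -
      have "sets (C 0 m (\<lambda>_. undefined)) = sets (PiM {0..<m} ?M)"
        using sets_C[OF u, of m] by simp
      from measurable_cong_sets[OF this refl] measurable_eP[of m] show ?thesis by blast
    qed
    have sp: "space (C 0 m (\<lambda>_. undefined)) = space (PiM {0..<m} ?M)"
      using space_C[OF u, of m] by simp
    have "emeasure (C 0 (Suc m) (\<lambda>_. undefined)) (?X (Suc m))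
        = (\<integral>\<^sup>+\<omega>. emeasure (eP m \<omega>) (?X (Suc m)) \<partial>C 0 m (\<lambda>_. undefined))"
      using emeasure_bind[OF ne meas X] by simp
    also have "\<dots> = (\<integral>\<^sup>+\<omega>. emeasure (chain_step \<nu> K m x) {x m} * indicator (?X m) \<omega> \<partial>C 0 m (\<lambda>_. undefined))"
      using sp by (intro nn_integral_cong) (simp add: eP mult.commute)
    also have "\<dots> = emeasure (chain_step \<nu> K m x) {x m} * emeasure (C 0 m (\<lambda>_. undefined)) (?X m)"
      using X[of m] sets_C[OF u, of m] by (intro nn_integral_cmult_indicator) simp
    finally show ?case by (simp only: Suc.IH prod.lessThan_Suc mult.commute)
  qed
  have "{\<omega>. \<forall>t\<le>n. \<omega> t = x t} = PF.emb UNIV {0..<Suc n} (?X (Suc n))"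
    by (auto simp: prod_emb_def space_PiM fun_eq_iff restrict_def less_Suc_eq_le) metis
  then have "emeasure (chain_law \<nu> K) {\<omega>. \<forall>t\<le>n. \<omega> t = x t} = emeasure (CI {0..<Suc n}) (?X (Suc n))"
    using lim[OF _ X, of "Suc n"] by (simp add: chain_law_def)
  also have "\<dots> = emeasure (C 0 (Suc n) (\<lambda>_. undefined)) (?X (Suc n))"
    using emeasure_CI[OF order_refl X, of "Suc n"]
      prod_emb_id[of "?X (Suc n)" "{0..<Suc n}" ?M] by simp
  also have "\<dots> = (\<Prod>t<Suc n. emeasure (chain_step \<nu> K t x) {x t})"
    by (rule C)
  also have "\<dots> = ennreal (pmf \<nu> (x 0)) * (\<Prod>t<n. ennreal (pmf (K (x t)) (x (Suc t))))"
    by (subst prod.lessThan_Suc_shift) (simp add: chain_step_def emeasure_pmf_single)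
  also have "\<dots> = ennreal (pmf \<nu> (x 0) * (\<Prod>t<n. pmf (K (x t)) (x (Suc t))))"
    by (simp add: prod_ennreal ennreal_mult prod_nonneg)
  finally show ?thesis .
qed


section \<open>Metastability\<close>

text \<open>\<open>metastable \<rho> N S \<mu> K J M\<close>: the chain with kernel \<open>K\<close> on the finite state space \<open>S\<close> and
  invariant distribution \<open>\<mu>\<close> is \<open>\<rho> N\<close>-metastable with respect to the family \<open>M\<close> indexed by \<open>J\<close>.
  The requirement \<open>\<rho> N \<ll> 1\<close> concerns the whole sequence \<open>\<rho>\<close>, which is why the sequence is an
  argument. Division by \<open>0\<close> and \<open>Min {}\<close> are total in HOL, so the state space is required to
  be the support of \<open>\<mu>\<close>, the sets that are conditioned on or minimised over to be
  nonempty, and the denominator to be positive.\<close>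

definition metastable ::
  "(nat \<Rightarrow> real) \<Rightarrow> nat \<Rightarrow> 's set \<Rightarrow> 's pmf \<Rightarrow> ('s \<Rightarrow> 's pmf) \<Rightarrow> 'i set \<Rightarrow> ('i \<Rightarrow> 's set) \<Rightarrow> bool" where
  "metastable \<rho> N S \<mu> K J M \<longleftrightarrow>
     (let U = (\<Union>j\<in>J. M j);
          num = (MAX j\<in>J. prob_before (cond_pmf \<mu> (M j)) K (U - M j) (M j));
          den = (MIN X\<in>{X. X \<noteq> {} \<and> X \<subseteq> S - U}. prob_before (cond_pmf \<mu> X) K U X)
      in finite S \<and> set_pmf \<mu> = S \<and> (\<forall>x\<in>S. set_pmf (K x) \<subseteq> S) \<and> bind_pmf \<mu> K = \<mu> \<and>
         finite J \<and> J \<noteq> {} \<and> (\<forall>j\<in>J. M j \<noteq> {} \<and> M j \<subseteq> S) \<and> disjoint_family_on M J \<and> U \<noteq> S \<and>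
         0 < \<rho> N \<and> \<rho> \<longlonglongrightarrow> 0 \<and>
         0 < den \<and> real (card J) * (num / den) \<le> \<rho> N)"


section \<open>The Curie-Weiss-Potts model\<close>

definition configs :: "nat \<Rightarrow> nat \<Rightarrow> (nat \<Rightarrow> nat) set" where
  "configs q N = {1..N} \<rightarrow>\<^sub>E {1..q}"

definition hamiltonian :: "nat \<Rightarrow> (nat \<Rightarrow> nat) \<Rightarrow> real" where
  "hamiltonian N \<sigma> = - (1 / real N) * (\<Sum>i\<in>{1..N}. \<Sum>j\<in>{i<..N}. of_bool (\<sigma> i = \<sigma> j))"

definition partition_fun :: "nat \<Rightarrow> real \<Rightarrow> nat \<Rightarrow> real" where
  "partition_fun q \<beta> N = (\<Sum>\<sigma>\<in>configs q N. exp (- \<beta> * hamiltonian N \<sigma>))"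

definition gibbs :: "nat \<Rightarrow> real \<Rightarrow> nat \<Rightarrow> (nat \<Rightarrow> nat) pmf" where
  "gibbs q \<beta> N = embed_pmf (\<lambda>\<sigma>. if \<sigma> \<in> configs q N
      then exp (- \<beta> * hamiltonian N \<sigma>) / partition_fun q \<beta> N else 0)"

definition jump_prob :: "nat \<Rightarrow> real \<Rightarrow> nat \<Rightarrow> (nat \<Rightarrow> nat) \<Rightarrow> (nat \<Rightarrow> nat) \<Rightarrow> real" where
  "jump_prob q \<beta> N \<sigma> \<eta> =
     (if \<sigma> \<in> configs q N \<and> \<eta> \<in> configs q N \<and> card {i\<in>{1..N}. \<sigma> i \<noteq> \<eta> i} = 1
      then 1 / (real N * real q) * exp (- \<beta> * max 0 (hamiltonian N \<eta> - hamiltonian N \<sigma>))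
      else 0)"

definition transition_prob :: "nat \<Rightarrow> real \<Rightarrow> nat \<Rightarrow> (nat \<Rightarrow> nat) \<Rightarrow> (nat \<Rightarrow> nat) \<Rightarrow> real" where
  "transition_prob q \<beta> N \<sigma> \<eta> =
     (if \<eta> = \<sigma> then 1 - (\<Sum>\<xi>\<in>configs q N - {\<sigma>}. jump_prob q \<beta> N \<sigma> \<xi>)
      else jump_prob q \<beta> N \<sigma> \<eta>)"

text \<open>Outside \<open>configs q N\<close> the kernel stays put. The embedding into \<open>pmf\<close> is faithful for
  \<open>\<beta> \<ge> 0\<close>, see \<open>pmf_cwp_kernel\<close>.\<close>

definition cwp_kernel :: "nat \<Rightarrow> real \<Rightarrow> nat \<Rightarrow> (nat \<Rightarrow> nat) \<Rightarrow> (nat \<Rightarrow> nat) pmf" where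
  "cwp_kernel q \<beta> N \<sigma> = embed_pmf (transition_prob q \<beta> N \<sigma>)"

lemma finite_configs: "finite (configs q N)"
  unfolding configs_def by (intro finite_PiE) auto

lemma nn_integral_finite_supp:
  assumes "finite A" "\<And>x. x \<notin> A \<Longrightarrow> f x = 0" "\<And>x. 0 \<le> f x"
  shows "(\<integral>\<^sup>+x. ennreal (f x) \<partial>count_space UNIV) = ennreal (\<Sum>x\<in>A. f x)"
  using assms by (subst nn_integral_count_space'[of A]) (auto simp: sum_ennreal)

lemma pmf_gibbs:
  assumes "q \<ge> 1"
  shows "pmf (gibbs q \<beta> N) \<sigma> =
    (if \<sigma> \<in> configs q N then exp (- \<beta> * hamiltonian N \<sigma>) / partition_fun q \<beta> N else 0)"
proof -
  have "configs q N \<noteq> {}"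
    using assms by (auto simp: configs_def PiE_eq_empty_iff)
  then have pos: "partition_fun q \<beta> N > 0"
    unfolding partition_fun_def by (intro sum_pos finite_configs) auto
  let ?f = "\<lambda>\<sigma>. if \<sigma> \<in> configs q N then exp (- \<beta> * hamiltonian N \<sigma>) / partition_fun q \<beta> N else 0"
  have "(\<Sum>\<sigma>\<in>configs q N. ?f \<sigma>) = 1"
    using pos by (simp add: sum_divide_distrib[symmetric] partition_fun_def)
  then have "(\<integral>\<^sup>+\<sigma>. ennreal (?f \<sigma>) \<partial>count_space UNIV) = 1"
    using pos by (subst nn_integral_finite_supp[OF finite_configs[of q N]]) auto
  then show ?thesis
    unfolding gibbs_def using pos by (subst pmf_embed_pmf) auto
qed

lemma jump_prob_nonneg: "0 \<le> jump_prob q \<beta> N \<sigma> \<eta>"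
  by (auto simp: jump_prob_def)

lemma sum_jump_prob_le_1:
  assumes "\<beta> \<ge> 0"
  shows "(\<Sum>\<xi>\<in>configs q N - {\<sigma>}. jump_prob q \<beta> N \<sigma> \<xi>) \<le> 1"
proof (cases "\<sigma> \<in> configs q N \<and> N > 0 \<and> q > 0")
  case True
  let ?B = "(\<lambda>(i, c). \<sigma>(i := c)) ` ({1..N} \<times> {1..q})"
  have sub: "\<xi> \<in> ?B"
    if mem: "\<xi> \<in> configs q N" and one: "card {i\<in>{1..N}. \<sigma> i \<noteq> \<xi> i} = 1" for \<xi>
  proof -
    obtain i where i: "{i\<in>{1..N}. \<sigma> i \<noteq> \<xi> i} = {i}"
      using one by (rule card_1_singletonE)
    have iN: "i \<in> {1..N}" using i by blast
    have only_i: "\<sigma> j = \<xi> j" if "j \<in> {1..N}" "j \<noteq> i" for j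
      using i that by blast
    have "\<xi> j = (\<sigma>(i := \<xi> i)) j" for j
    proof (cases "j \<in> {1..N}")
      case True then show ?thesis using only_i[of j] by (cases "j = i") simp_all
    next
      case False
      then have "j \<noteq> i" using iN by blast
      moreover have "\<sigma> j = undefined" "\<xi> j = undefined"
        using True mem False unfolding configs_def by (blast intro: PiE_arb)+
      ultimately show ?thesis by simp
    qed
    then have eq: "\<xi> = \<sigma>(i := \<xi> i)" ..
    have "\<xi> i \<in> {1..q}" using mem iN unfolding configs_def by (rule PiE_mem)
    then have "(i, \<xi> i) \<in> {1..N} \<times> {1..q}" using iN by blast
    then have "\<sigma>(i := \<xi> i) \<in> ?B" by (rule image_eqI[rotated]) simp
    then show ?thesis by (subst eq)
  qed
  have "card ?B \<le> N * q"
    using card_image_le[of "{1..N} \<times> {1..q}" "\<lambda>(i, c). \<sigma>(i := c)"]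
    by (simp add: card_cartesian_product)
  then have cB: "real (card ?B) \<le> real N * real q"
    by (metis of_nat_le_iff of_nat_mult)
  have "(\<Sum>\<xi>\<in>configs q N - {\<sigma>}. jump_prob q \<beta> N \<sigma> \<xi>) \<le> (\<Sum>\<xi>\<in>?B. 1 / (real N * real q))"
  proof -
    have le: "jump_prob q \<beta> N \<sigma> \<xi> \<le> 1 / (real N * real q)" for \<xi>
      using assms by (auto simp: jump_prob_def intro!: divide_right_mono)
    have "(\<Sum>\<xi>\<in>configs q N - {\<sigma>}. jump_prob q \<beta> N \<sigma> \<xi>)
        = (\<Sum>\<xi>\<in>(configs q N - {\<sigma>}) \<inter> ?B. jump_prob q \<beta> N \<sigma> \<xi>)"
      using sub by (intro sum.mono_neutral_right) (auto simp: finite_configs jump_prob_def)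
    also have "\<dots> \<le> (\<Sum>\<xi>\<in>?B. jump_prob q \<beta> N \<sigma> \<xi>)"
      by (intro sum_mono2) (auto simp: jump_prob_nonneg)
    also have "\<dots> \<le> (\<Sum>\<xi>\<in>?B. 1 / (real N * real q))"
      by (intro sum_mono le)
    finally show ?thesis .
  qed
  also have "\<dots> \<le> 1"
    using cB True by (simp add: divide_simps)
  finally show ?thesis .
next
  case False
  then have "jump_prob q \<beta> N \<sigma> \<xi> = 0" for \<xi>
    by (auto simp: jump_prob_def)
  then show ?thesis by simp
qed

lemma pmf_cwp_kernel:
  assumes "\<beta> \<ge> 0"
  shows "pmf (cwp_kernel q \<beta> N \<sigma>) \<eta> = transition_prob q \<beta> N \<sigma> \<eta>"
proof -
  have nn: "0 \<le> transition_prob q \<beta> N \<sigma> \<xi>" for \<xi>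
    using sum_jump_prob_le_1[OF assms] by (auto simp: transition_prob_def jump_prob_nonneg)
  let ?A = "insert \<sigma> (configs q N)"
  have "(\<Sum>\<xi>\<in>?A. transition_prob q \<beta> N \<sigma> \<xi>)
      = transition_prob q \<beta> N \<sigma> \<sigma> + (\<Sum>\<xi>\<in>configs q N - {\<sigma>}. transition_prob q \<beta> N \<sigma> \<xi>)"
    using finite_configs[of q N] by (subst sum.insert_remove) auto
  also have "(\<Sum>\<xi>\<in>configs q N - {\<sigma>}. transition_prob q \<beta> N \<sigma> \<xi>)
      = (\<Sum>\<xi>\<in>configs q N - {\<sigma>}. jump_prob q \<beta> N \<sigma> \<xi>)"
    by (intro sum.cong) (auto simp: transition_prob_def)
  finally have "(\<Sum>\<xi>\<in>?A. transition_prob q \<beta> N \<sigma> \<xi>) = 1"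
    by (simp add: transition_prob_def)
  moreover have "transition_prob q \<beta> N \<sigma> \<xi> = 0" if "\<xi> \<notin> ?A" for \<xi>
    using that by (auto simp: transition_prob_def jump_prob_def)
  ultimately have "(\<integral>\<^sup>+\<xi>. ennreal (transition_prob q \<beta> N \<sigma> \<xi>) \<partial>count_space UNIV) = 1"
    using nn finite_configs[of q N] by (subst nn_integral_finite_supp[of ?A]) auto
  then show ?thesis
    unfolding cwp_kernel_def using nn by (intro pmf_embed_pmf) auto
qed


section \<open>Free energy and metastable sets\<close>

text \<open>Vectors in \<open>\<real>\<^sup>q\<close> are functions restricted to \<open>{1..q}\<close>.\<close>

definition prob_simplex :: "nat \<Rightarrow> (nat \<Rightarrow> real) set" where
  "prob_simplex q = {x \<in> ({1..q} \<rightarrow>\<^sub>E {0..1}). (\<Sum>k\<in>{1..q}. x k) = 1}"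

definition lattice_simplex :: "nat \<Rightarrow> nat \<Rightarrow> (nat \<Rightarrow> real) set" where
  "lattice_simplex q N = {x \<in> prob_simplex q. \<forall>k\<in>{1..q}. \<exists>n::nat. x k = real n / real N}"

definition empirical :: "nat \<Rightarrow> nat \<Rightarrow> (nat \<Rightarrow> nat) \<Rightarrow> nat \<Rightarrow> real" where
  "empirical q N \<sigma> = (\<lambda>k\<in>{1..q}. 1 / real N * (\<Sum>i\<in>{1..N}. of_bool (\<sigma> i = k)))"

definition free_energy :: "nat \<Rightarrow> real \<Rightarrow> (nat \<Rightarrow> real) \<Rightarrow> real" where
  "free_energy q \<beta> x = - (1/2) * (L2_set x {1..q})\<^sup>2 + 1 / \<beta> * (\<Sum>i\<in>{1..q}. x i * ln (x i))"

definition euclid_dist :: "nat \<Rightarrow> (nat \<Rightarrow> real) \<Rightarrow> (nat \<Rightarrow> real) \<Rightarrow> real" where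
  "euclid_dist q x y = L2_set (\<lambda>k. x k - y k) {1..q}"

definition local_minimizer :: "nat \<Rightarrow> ((nat \<Rightarrow> real) \<Rightarrow> real) \<Rightarrow> (nat \<Rightarrow> real) \<Rightarrow> bool" where
  "local_minimizer q f x \<longleftrightarrow>
     x \<in> prob_simplex q \<and> (\<exists>\<epsilon>>0. \<forall>y\<in>prob_simplex q. euclid_dist q x y < \<epsilon> \<longrightarrow> f x \<le> f y)"

definition s_max :: "nat \<Rightarrow> real \<Rightarrow> real" where
  "s_max q \<beta> = (GREATEST s. 0 \<le> s \<and> s < 1 \<and> ln (1 + (real q - 1) * s) - ln (1 - s) = \<beta> * s)"

definition m_point :: "nat \<Rightarrow> real \<Rightarrow> nat \<Rightarrow> nat \<Rightarrow> real" where
  "m_point q \<beta> i = (\<lambda>k\<in>{1..q}.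
     if i = 0 then 1 / real q
     else if k = i then (1 + (real q - 1) * s_max q \<beta>) / real q
     else (1 - s_max q \<beta>) / real q)"

definition beta1 :: "nat \<Rightarrow> real" where
  "beta1 q = Inf {\<beta>. 0 < \<beta> \<and>
     (\<exists>x. local_minimizer q (free_energy q \<beta>) x \<and> x \<noteq> (\<lambda>k\<in>{1..q}. 1 / real q))}"

text \<open>The case distinction presupposes \<open>\<beta> > beta1 q\<close>.\<close>

definition index_set :: "nat \<Rightarrow> real \<Rightarrow> nat set" where
  "index_set q \<beta> = (if \<beta> < real q then {0..q} else {1..q})"

definition closest_lattice_point :: "nat \<Rightarrow> nat \<Rightarrow> (nat \<Rightarrow> real) \<Rightarrow> (nat \<Rightarrow> real) \<Rightarrow> bool" where
  "closest_lattice_point q N x y \<longleftrightarrow>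
     is_arg_min (euclid_dist q x) (\<lambda>z. z \<in> lattice_simplex q N) y"

definition fibre :: "nat \<Rightarrow> nat \<Rightarrow> (nat \<Rightarrow> real) \<Rightarrow> (nat \<Rightarrow> nat) set" where
  "fibre q N x = {\<sigma> \<in> configs q N. empirical q N \<sigma> = x}"

end

theory Submission
  imports Defs
begin

text \<open>The single-spin dynamics moves between cells, the sets of configurations with the same vector of
spin counts.  There are only polynomially many cells, and the Gibbs weight of the cell at the lattice
point \<open>x\<close> is \<open>exp (- \<beta> N F x)\<close> up to a factor that does not depend on \<open>x\<close> and a factor that is
polynomial in \<open>N\<close>, where \<open>F\<close> is the free energy (\<open>mass_ratio_le\<close>).  So everything on the exponential
scale should be determined by the landscape of \<open>F\<close> on the simplex.

For a reversible chain, the probability of reaching \<open>A\<close> before returning to \<open>B\<close>, started from \<open>\<mu>\<close>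
conditioned on \<open>B\<close>, is the capacity between \<open>A\<close> and \<open>B\<close> divided by \<open>\<mu> B\<close>, and the capacity is the
energy of the equilibrium potential, which is the least energy of a function that is \<open>1\<close> on \<open>A\<close> and
\<open>0\<close> on \<open>B\<close> (\<open>prob_before_cond\<close>, \<open>capac_eq_dirichlet\<close>, \<open>capac_le_dirichlet\<close>).

For the numerator, the test function is the indicator of the complement of a small neighbourhood of
\<open>m\<^sub>j\<close>.  Its energy is at most the weight of a shell around \<open>m\<^sub>j\<close> where \<open>F\<close> exceeds \<open>F m\<^sub>j\<close> by some
\<open>\<delta> > 0\<close>, which is smaller than the weight of the metastable set by \<open>exp (- \<beta> \<delta> N / 2)\<close>, up to a
polynomial factor; half of \<open>\<delta>\<close> is given away because \<open>m\<^sub>j\<close> need not be a lattice point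
(\<open>minimizer_barrier\<close>, \<open>escape_exponential\<close>).

For the denominator, every lattice point is joined to a metastable one by a lattice path along which
\<open>F\<close> stays below its initial value plus \<open>\<epsilon>\<close>, where \<open>\<epsilon>\<close> is at our disposal (\<open>lattice_descent\<close>).  The
set \<open>X\<close> is arbitrary, not a union of cells, so the estimate must be made for configurations: the part
of \<open>X\<close> in its heaviest cell is transported along the path by flipping a uniformly chosen spin of the
right colour at each step.  The transported density never exceeds the uniform one, and the
Cauchy-Schwarz inequality, applied at each step of the path to the equilibrium potential, bounds the
capacity from below by \<open>exp (- \<beta> \<epsilon> N)\<close> times the weight of \<open>X\<close>, up to a polynomial factor
(\<open>flow_step_le\<close>, \<open>cell_flow_step\<close>, \<open>capac_ge\<close>, \<open>return_ge\<close>).  With \<open>\<epsilon> = \<delta> / 4\<close> the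
quotient is at most a polynomial times \<open>exp (- \<beta> \<delta> N / 4)\<close>, which gives \<open>k1 = \<beta> \<delta> / 4\<close>.

Both estimates rest on the fact that the local minimizers of \<open>F\<close> are exactly the points \<open>m\<^sub>i\<close> with
\<open>i\<close> in the index set (\<open>local_minimizers_eq\<close>).  As these are finitely many, each is strict and is
surrounded by a shell of higher free energy.  And a lattice point at which \<open>F\<close> is least among all
points that can be reached at the cost \<open>\<epsilon>\<close> is almost a local minimizer, hence close to some \<open>m\<^sub>i\<close>.
To find the local minimizers, note that \<open>F\<close> is a sum of one function \<open>psi\<close> over the coordinates,
with infinite slope at \<open>0\<close>, convex on \<open>(0, 1 / \<beta>)\<close> and concave beyond.  So at a local minimizer all
coordinates are positive, at most one exceeds \<open>1 / \<beta>\<close> and the others are equal.  This leaves the centre and the rays from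
the centre to the vertices, a problem in one variable.\<close>

section \<open>Local minimizers of the free energy\<close>

definition psi :: "real \<Rightarrow> real \<Rightarrow> real" where
  "psi \<beta> u = - (1/2) * u\<^sup>2 + 1 / \<beta> * (u * ln u)"

definition psi' :: "real \<Rightarrow> real \<Rightarrow> real" where
  "psi' \<beta> u = - u + 1 / \<beta> * (ln u + 1)"

text \<open>Neighbourhoods in the maximum norm: in the counting arguments below coordinates are compared one by
one, and the norm only has to generate the same local minimizers as the Euclidean one.\<close>

definition near :: "nat \<Rightarrow> real \<Rightarrow> (nat \<Rightarrow> real) \<Rightarrow> (nat \<Rightarrow> real) \<Rightarrow> bool" where
  "near q \<epsilon> x y \<longleftrightarrow> (\<forall>k\<in>{1..q}. \<bar>x k - y k\<bar> < \<epsilon>)"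

lemma free_energy_psi: "free_energy q \<beta> x = (\<Sum>k\<in>{1..q}. psi \<beta> (x k))"
proof -
  have "(L2_set x {1..q})\<^sup>2 = (\<Sum>k\<in>{1..q}. (x k)\<^sup>2)"
    unfolding L2_set_def by (simp add: sum_nonneg)
  then show ?thesis
    by (simp only: free_energy_def psi_def sum.distrib sum_distrib_left)
qed

lemma euclid_dist_less_of_near:
  assumes "q \<ge> 1" "near q (\<epsilon> / real q) x y" shows "euclid_dist q x y < \<epsilon>"
proof -
  have "euclid_dist q x y \<le> (\<Sum>k\<in>{1..q}. \<bar>x k - y k\<bar>)"
    unfolding euclid_dist_def by (rule L2_set_le_sum_abs)
  also have "\<dots> < (\<Sum>k\<in>{1..q}. \<epsilon> / real q)"
    using assms by (intro sum_strict_mono) (auto simp: near_def)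
  also have "\<dots> = \<epsilon>" using assms by simp
  finally show ?thesis .
qed

lemma near_of_euclid_dist_less: "euclid_dist q x y < \<epsilon> \<Longrightarrow> near q \<epsilon> x y"
proof -
  assume a: "euclid_dist q x y < \<epsilon>"
  have "\<bar>x k - y k\<bar> \<le> euclid_dist q x y" if "k \<in> {1..q}" for k
    using member_le_L2_set[of "{1..q}" k "\<lambda>k. \<bar>x k - y k\<bar>"] that
    by (simp add: euclid_dist_def L2_set_def)
  with a show ?thesis by (fastforce simp: near_def)
qed

lemma local_minimizer_iff_near:
  assumes "q \<ge> 1"
  shows "local_minimizer q f x \<longleftrightarrow>
    x \<in> prob_simplex q \<and> (\<exists>\<epsilon>>0. \<forall>y\<in>prob_simplex q. near q \<epsilon> x y \<longrightarrow> f x \<le> f y)"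
proof -
  have "\<exists>\<delta>>0. \<forall>y\<in>prob_simplex q. near q \<delta> x y \<longrightarrow> f x \<le> f y"
    if "\<epsilon> > 0" "\<forall>y\<in>prob_simplex q. euclid_dist q x y < \<epsilon> \<longrightarrow> f x \<le> f y" for \<epsilon>
    using that assms euclid_dist_less_of_near[OF assms]
    by (intro exI[of _ "\<epsilon> / real q"]) auto
  then show ?thesis
    unfolding local_minimizer_def using near_of_euclid_dist_less by blast
qed

lemma simplexD:
  assumes "x \<in> prob_simplex q"
  shows "k \<in> {1..q} \<Longrightarrow> 0 \<le> x k" "k \<in> {1..q} \<Longrightarrow> x k \<le> 1" "(\<Sum>k\<in>{1..q}. x k) = 1"
    "k \<notin> {1..q} \<Longrightarrow> x k = undefined"
  using assms by (auto simp: prob_simplex_def PiE_iff extensional_def)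

lemma simplexI:
  assumes "x \<in> extensional {1..q}" "\<And>k. k \<in> {1..q} \<Longrightarrow> 0 \<le> x k" "(\<Sum>k\<in>{1..q}. x k) = 1"
  shows "x \<in> prob_simplex q"
proof -
  have "x k \<le> 1" if "k \<in> {1..q}" for k
    using member_le_sum[of k "{1..q}" x] assms that by auto
  with assms show ?thesis by (auto simp: prob_simplex_def PiE_iff)
qed

lemma sum_split_two:
  fixes h :: "'a \<Rightarrow> 'b :: comm_monoid_add"
  assumes "finite A" "a \<in> A" "b \<in> A" "a \<noteq> b"
  shows "sum h A = h a + h b + sum h (A - {a} - {b})"
  using assms by (simp add: sum.remove[of A a] sum.remove[of "A - {a}" b] add.assoc)

lemma prod_split_two:
  fixes h :: "'a \<Rightarrow> 'b :: comm_monoid_mult"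
  assumes "finite A" "a \<in> A" "b \<in> A" "a \<noteq> b"
  shows "prod h A = h a * h b * prod h (A - {a} - {b})"
  using assms by (simp add: prod.remove[of A a] prod.remove[of "A - {a}" b] mult.assoc)

lemma sum_fun_upd2:
  fixes g :: "real \<Rightarrow> real"
  assumes "finite A" "a \<in> A" "b \<in> A" "a \<noteq> b"
  shows "(\<Sum>k\<in>A. g ((x(a := u, b := v)) k)) = (\<Sum>k\<in>A. g (x k)) - g (x a) - g (x b) + g u + g v"
proof -
  note split = sum_split_two[OF assms]
  have "(\<Sum>k\<in>A - {a} - {b}. g ((x(a := u, b := v)) k)) = (\<Sum>k\<in>A - {a} - {b}. g (x k))"
    by (intro sum.cong) auto
  with assms(4) show ?thesis
    unfolding split[of "\<lambda>k. g ((x(a := u, b := v)) k)"] split[of "\<lambda>k. g (x k)"] by simp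
qed

lemma transfer_in_simplex:
  assumes "x \<in> prob_simplex q" "a \<in> {1..q}" "b \<in> {1..q}" "a \<noteq> b" "- x b \<le> t" "t \<le> x a"
  shows "x(a := x a - t, b := x b + t) \<in> prob_simplex q"
proof (rule simplexI)
  show "x(a := x a - t, b := x b + t) \<in> extensional {1..q}"
    using assms simplexD(4)[OF assms(1)] by (auto simp: extensional_def)
  show "(\<Sum>k\<in>{1..q}. (x(a := x a - t, b := x b + t)) k) = 1"
    using sum_fun_upd2[of "{1..q}" a b "\<lambda>u. u" x] assms simplexD(3)[OF assms(1)] by simp
qed (use assms simplexD(1)[OF assms(1)] in auto)

text \<open>The variations used in the necessary conditions: moving mass \<open>t\<close> from one coordinate to another only
involves two summands of the free energy.\<close>

lemma local_minimizer_transfer: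
  assumes q: "q \<ge> 1" and loc: "local_minimizer q (free_energy q \<beta>) x"
    and ab: "a \<in> {1..q}" "b \<in> {1..q}" "a \<noteq> b"
  obtains \<epsilon> where "\<epsilon> > 0"
    "\<And>t. \<bar>t\<bar> < \<epsilon> \<Longrightarrow> - x b \<le> t \<Longrightarrow> t \<le> x a \<Longrightarrow>
       psi \<beta> (x a) + psi \<beta> (x b) \<le> psi \<beta> (x a - t) + psi \<beta> (x b + t)"
proof -
  obtain \<epsilon> where x: "x \<in> prob_simplex q" and e: "\<epsilon> > 0"
    and min: "\<And>y. y \<in> prob_simplex q \<Longrightarrow> near q \<epsilon> x y \<Longrightarrow> free_energy q \<beta> x \<le> free_energy q \<beta> y"
    using loc unfolding local_minimizer_iff_near[OF q] by blast
  show thesis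
  proof
    fix t assume t: "\<bar>t\<bar> < \<epsilon>" "- x b \<le> t" "t \<le> x a"
    let ?y = "x(a := x a - t, b := x b + t)"
    have "?y \<in> prob_simplex q" using x ab t by (intro transfer_in_simplex) auto
    moreover have "near q \<epsilon> x ?y" using t e by (auto simp: near_def)
    ultimately have "free_energy q \<beta> x \<le> free_energy q \<beta> ?y" by (rule min)
    then show "psi \<beta> (x a) + psi \<beta> (x b) \<le> psi \<beta> (x a - t) + psi \<beta> (x b + t)"
      using sum_fun_upd2[of "{1..q}" a b "psi \<beta>" x] ab by (simp add: free_energy_psi)
  qed (fact e)
qed

lemma psi_deriv: "u > 0 \<Longrightarrow> (psi \<beta> has_real_derivative psi' \<beta> u) (at u)"
  unfolding psi_def[abs_def] psi'_def
  by (cases "\<beta> = 0") (auto intro!: derivative_eq_intros simp: field_simps)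

text \<open>The entropy term has slope \<open>-\<infinity>\<close> at \<open>0\<close>, so moving a little mass to an empty coordinate pays off.\<close>

lemma local_minimizer_pos:
  assumes q: "q \<ge> 1" and \<beta>: "\<beta> > 0" and loc: "local_minimizer q (free_energy q \<beta>) x"
    and b: "b \<in> {1..q}"
  shows "x b > 0"
proof (rule ccontr)
  have x: "x \<in> prob_simplex q" using loc by (simp add: local_minimizer_def)
  assume "\<not> x b > 0"
  then have xb: "x b = 0" using simplexD(1)[OF x b] by simp
  have "\<exists>a\<in>{1..q}. x a > 0"
  proof (rule ccontr)
    assume "\<not> ?thesis"
    then have "(\<Sum>k\<in>{1..q}. x k) \<le> 0" by (intro sum_nonpos) force
    then show False using simplexD(3)[OF x] by simp
  qed
  then obtain a where a: "a \<in> {1..q}" "x a > 0" by blast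
  define v where "v = x a"
  have v: "v > 0" using a v_def by simp
  have "a \<noteq> b" using a xb by auto
  then obtain \<epsilon> where e: "\<epsilon> > 0" and min: "\<And>t. \<bar>t\<bar> < \<epsilon> \<Longrightarrow> - x b \<le> t \<Longrightarrow> t \<le> x a \<Longrightarrow>
       psi \<beta> (x a) + psi \<beta> (x b) \<le> psi \<beta> (x a - t) + psi \<beta> (x b + t)"
    using local_minimizer_transfer[OF q loc a(1) b] by metis
  \<comment> \<open>Moving \<open>t\<close> gains entropy \<open>t (ln v - ln t) / \<beta>\<close> at least and costs energy \<open>t v\<close> at most.\<close>
  define t where "t = min (\<epsilon>/2) (v * exp (- (\<beta> * v)) / 2)"
  have t: "0 < t" "t < \<epsilon>" "t < v * exp (- (\<beta> * v))"
    using e v by (auto simp: t_def min_def field_simps)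
  have "v * exp (- (\<beta> * v)) \<le> v" using v \<beta> by simp
  then have tv: "t < v" using t by linarith
  have lt: "ln t < ln v - \<beta> * v"
    using t v ln_less_cancel_iff[of t "v * exp (- (\<beta> * v))"] by (simp add: ln_mult)
  have "psi \<beta> v \<le> psi \<beta> (v - t) + psi \<beta> t"
    using min[of t] xb t tv by (simp add: v_def psi_def)
  moreover have "(v - t) * ln (v - t) \<le> (v - t) * ln v"
    using t tv v by (intro mult_left_mono) auto
  then have "1/\<beta> * ((v - t) * ln (v - t)) \<le> 1/\<beta> * ((v - t) * ln v)"
    using \<beta> by (intro mult_left_mono[of "(v - t) * ln (v - t)"]) auto
  ultimately have "- (1/2) * v\<^sup>2 + 1/\<beta> * (v * ln v)
      \<le> - (1/2) * (v - t)\<^sup>2 + 1/\<beta> * ((v - t) * ln v) - (1/2) * t\<^sup>2 + 1/\<beta> * (t * ln t)"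
    unfolding psi_def by linarith
  then have "1/\<beta> * (t * (ln v - ln t)) \<le> t * v - t\<^sup>2"
    by (simp add: power2_eq_square algebra_simps diff_divide_distrib add_divide_distrib)
  also have "\<dots> \<le> t * v" by simp
  finally have "t * (ln v - ln t) \<le> t * (\<beta> * v)" using \<beta> by (simp add: field_simps)
  then have "ln v - ln t \<le> \<beta> * v" using t by simp
  with lt show False by simp
qed

text \<open>The Lagrange condition, with the multiplier eliminated.\<close>

lemma local_minimizer_critical:
  assumes q: "q \<ge> 1" and \<beta>: "\<beta> > 0" and loc: "local_minimizer q (free_energy q \<beta>) x"
    and ab: "a \<in> {1..q}" "b \<in> {1..q}"
  shows "ln (x a) - \<beta> * x a = ln (x b) - \<beta> * x b"
proof (cases "a = b")
  case False
  have pos: "x a > 0" "x b > 0" using local_minimizer_pos[OF q \<beta> loc] ab by auto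
  obtain \<epsilon> where e: "\<epsilon> > 0" and min: "\<And>t. \<bar>t\<bar> < \<epsilon> \<Longrightarrow> - x b \<le> t \<Longrightarrow> t \<le> x a \<Longrightarrow>
       psi \<beta> (x a) + psi \<beta> (x b) \<le> psi \<beta> (x a - t) + psi \<beta> (x b + t)"
    using local_minimizer_transfer[OF q loc ab False] by metis
  let ?g = "\<lambda>t. psi \<beta> (x a - t) + psi \<beta> (x b + t)"
  have "(?g has_real_derivative - psi' \<beta> (x a) + psi' \<beta> (x b)) (at 0)"
    using pos by (auto intro!: derivative_eq_intros DERIV_chain2[OF psi_deriv])
  moreover have "0 < min \<epsilon> (min (x a) (x b))" using e pos by simp
  moreover have "\<forall>y. \<bar>0 - y\<bar> < min \<epsilon> (min (x a) (x b)) \<longrightarrow> ?g 0 \<le> ?g y"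
    using min by auto
  ultimately have "- psi' \<beta> (x a) + psi' \<beta> (x b) = 0" by (rule DERIV_local_min)
  then have "1 / \<beta> * (ln (x a) - ln (x b)) = x a - x b"
    by (simp add: psi'_def algebra_simps)
  then have "ln (x a) - ln (x b) = \<beta> * (x a - x b)" using \<beta> by (simp add: field_simps)
  then show ?thesis by (simp add: algebra_simps)
qed simp

lemma ln_diff_less:
  fixes v w :: real
  assumes "0 < v" "0 < w" "v \<noteq> w" shows "ln w - ln v < (w - v) / v"
proof -
  have "ln (w / v) \<le> w / v - 1" using assms by (intro ln_le_minus_one) simp
  moreover have "ln (w / v) \<noteq> w / v - 1" using ln_eq_minus_one[of "w / v"] assms by auto
  ultimately show ?thesis using assms by (simp add: ln_div diff_divide_distrib)
qed

lemma psi'_decreasing: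
  assumes "\<beta> > 0" "1 / \<beta> < v" "v < w" shows "psi' \<beta> w < psi' \<beta> v"
proof -
  have v: "v > 0" using assms by (smt (verit) divide_pos_pos)
  have "ln w - ln v < (w - v) / v" using ln_diff_less[of v w] v assms by simp
  also have "(w - v) / v \<le> (w - v) * \<beta>"
    using assms v mult_left_mono[of "1 / v" \<beta> "w - v"] by (simp add: field_simps)
  finally have "1 / \<beta> * (ln w - ln v) < w - v" using assms by (simp add: field_simps)
  then show ?thesis by (simp add: psi'_def algebra_simps)
qed

text \<open>Two equal coordinates beyond \<open>1 / \<beta>\<close> lie where \<open>psi\<close> is strictly concave, so pulling them apart
decreases the free energy.\<close>

lemma local_minimizer_equal_coords:
  assumes q: "q \<ge> 1" and \<beta>: "\<beta> > 0" and loc: "local_minimizer q (free_energy q \<beta>) x"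
    and ab: "a \<in> {1..q}" "b \<in> {1..q}" "a \<noteq> b" and eq: "x a = x b"
  shows "x a \<le> 1 / \<beta>"
proof (rule ccontr)
  assume neg: "\<not> ?thesis"
  define u where "u = x a"
  define w where "w = 1 / \<beta>"
  have u: "u > w" and u': "x b = u" using neg eq u_def w_def by auto
  have u0: "u > 0" using u \<beta> by (smt (verit) divide_pos_pos w_def)
  obtain \<epsilon> where e: "\<epsilon> > 0" and min: "\<And>t. \<bar>t\<bar> < \<epsilon> \<Longrightarrow> - x b \<le> t \<Longrightarrow> t \<le> x a \<Longrightarrow>
       psi \<beta> (x a) + psi \<beta> (x b) \<le> psi \<beta> (x a - t) + psi \<beta> (x b + t)"
    using local_minimizer_transfer[OF q loc ab] by metis
  define h where "h = min (\<epsilon>/2) ((u - w) / 2)"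
  have hm: "h \<le> \<epsilon>/2" "h \<le> (u - w) / 2" "h = \<epsilon>/2 \<or> h = (u - w) / 2"
    unfolding h_def by (rule min.cobounded1, rule min.cobounded2, simp add: min_def)
  have "0 < h" using hm(3) e u by auto
  moreover have "h < \<epsilon>" using hm(1) e by linarith
  moreover have "w < u - h" using hm(2) u by (simp add: field_simps)
  ultimately have h: "0 < h" "h < \<epsilon>" "w < u - h" by this+
  have hu: "h < u" using h \<beta> by (smt (verit) divide_pos_pos w_def)
  let ?g = "\<lambda>t. psi \<beta> (u - t) + psi \<beta> (u + t)"
  have d: "(?g has_real_derivative - psi' \<beta> (u - t) + psi' \<beta> (u + t)) (at t)"
    if "0 \<le> t" "t \<le> h" for t
    using that hu by (auto intro!: derivative_eq_intros DERIV_chain2[OF psi_deriv])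
  obtain z where z: "z > 0" "z < h" "?g h - ?g 0 = (h - 0) * (- psi' \<beta> (u - z) + psi' \<beta> (u + z))"
    using MVT2[OF h(1) d] by auto
  have "- psi' \<beta> (u - z) + psi' \<beta> (u + z) < 0"
    using psi'_decreasing[OF \<beta>, of "u - z" "u + z"] h z by (simp add: w_def)
  then have "?g h < ?g 0" using z h by (smt (verit) mult_pos_neg)
  moreover have "?g 0 \<le> ?g h" using min[of h] h hu u0 by (simp add: u' u_def[symmetric])
  ultimately show False by simp
qed

text \<open>The function \<open>ln u - \<beta> u\<close> increases up to \<open>1 / \<beta>\<close> and decreases afterwards, so two points with the
same value lie on different sides of \<open>1 / \<beta>\<close>.  The proof compares the chord slope of \<open>ln\<close> with
its slopes at the end points.\<close>

lemma ln_eq_linear_imp: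
  fixes v w \<beta> :: real
  assumes "0 < v" "v < w" "ln v - \<beta> * v = ln w - \<beta> * w"
  shows "v < 1 / \<beta>" "1 / \<beta> < w" "\<beta> > 0"
proof -
  have e: "ln w - ln v = \<beta> * (w - v)" using assms by (simp add: algebra_simps)
  have "ln v < ln w" using assms by simp
  with e have "0 < \<beta> * (w - v)" by simp
  then show b: "\<beta> > 0" using assms by (simp add: zero_less_mult_iff)
  have "ln w - ln v < (w - v) / v"
    using ln_diff_less[of v w] assms by simp
  then have "\<beta> * (w - v) < (1 / v) * (w - v)" by (simp add: e)
  then have "\<beta> < 1 / v" using assms by (simp only: mult_less_cancel_right_pos)
  then show "v < 1 / \<beta>" using assms b by (simp add: field_simps)
  have "ln v - ln w < (v - w) / w"
    using ln_diff_less[of w v] assms by simp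
  moreover have "(v - w) / w = - ((1 / w) * (w - v))" by (simp add: minus_divide_left)
  ultimately have "(1 / w) * (w - v) < \<beta> * (w - v)" using e by linarith
  then have "1 / w < \<beta>" using assms by (simp only: mult_less_cancel_right_pos)
  then show "1 / \<beta> < w" using assms b by (simp add: field_simps)
qed

text \<open>The segment from the centre (\<open>s = 0\<close>) to the \<open>i\<close>-th vertex (\<open>s = 1\<close>).  The points \<open>m\<^sub>i\<close> lie on it.\<close>

definition ray :: "nat \<Rightarrow> nat \<Rightarrow> real \<Rightarrow> nat \<Rightarrow> real" where
  "ray q i s = (\<lambda>k\<in>{1..q}. if k = i then (1 + (real q - 1) * s) / real q else (1 - s) / real q)"

text \<open>The mean-field equation is \<open>phi q \<beta> s = 0\<close>; along a ray, \<open>phi\<close> is the derivative of the free energy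
up to a positive factor (\<open>energy_deriv\<close>).\<close>

definition phi :: "nat \<Rightarrow> real \<Rightarrow> real \<Rightarrow> real" where
  "phi q \<beta> s = ln (1 + (real q - 1) * s) - ln (1 - s) - \<beta> * s"

lemma sum_one_special:
  assumes "i \<in> {1..q}"
  shows "(\<Sum>k\<in>{1..q}. if k = i then u else v) = u + (real q - 1) * (v::real)"
proof -
  have "(\<Sum>k\<in>{1..q}. if k = i then u else v) = u + (\<Sum>k\<in>{1..q} - {i}. v)"
    using assms by (subst sum.remove[of _ i]) (auto intro!: sum.cong)
  also have "(\<Sum>k\<in>{1..q} - {i}. v) = real (q - 1) * v" using assms by simp
  also have "real (q - 1) = real q - 1" using assms by (subst of_nat_diff) auto
  finally show ?thesis .
qed

lemma ray_in_simplex: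
  assumes "i \<in> {1..q}" "0 \<le> s" "s \<le> 1" shows "ray q i s \<in> prob_simplex q"
proof (rule simplexI)
  have q: "q \<ge> 1" using assms by simp
  have "(\<Sum>k\<in>{1..q}. ray q i s k) = (\<Sum>k\<in>{1..q}. if k = i then (1 + (real q - 1) * s) / real q else (1 - s) / real q)"
    by (intro sum.cong) (auto simp: ray_def)
  also have "\<dots> = 1" using q by (simp only: sum_one_special[OF assms(1)]) (simp add: field_simps)
  finally show "(\<Sum>k\<in>{1..q}. ray q i s k) = 1" .
qed (use assms in \<open>auto simp: ray_def\<close>)

lemma free_energy_ray:
  assumes "i \<in> {1..q}"
  shows "free_energy q \<beta> (ray q i s) = psi \<beta> ((1 + (real q - 1) * s) / real q) + (real q - 1) * psi \<beta> ((1 - s) / real q)"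
proof -
  have "free_energy q \<beta> (ray q i s) = (\<Sum>k\<in>{1..q}. if k = i then psi \<beta> ((1 + (real q - 1) * s) / real q) else psi \<beta> ((1 - s) / real q))"
    unfolding free_energy_psi by (intro sum.cong) (auto simp: ray_def)
  then show ?thesis by (simp only: sum_one_special[OF assms])
qed

text \<open>By the Lagrange condition the coordinates take at most two values, one on each side of \<open>1 / \<beta>\<close>, and
the larger one is taken only once.\<close>

lemma local_minimizer_cases:
  assumes q: "q \<ge> 2" and \<beta>: "\<beta> > 0" and loc: "local_minimizer q (free_energy q \<beta>) x"
  shows "(x = (\<lambda>k\<in>{1..q}. 1 / real q) \<and> \<beta> \<le> real q) \<or>
    (\<exists>i\<in>{1..q}. \<exists>s. 0 < s \<and> s < 1 \<and> x = ray q i s \<and> phi q \<beta> s = 0)"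
proof -
  have q1: "q \<ge> 1" using q by simp
  have x: "x \<in> prob_simplex q" using loc by (simp add: local_minimizer_def)
  note pos = local_minimizer_pos[OF q1 \<beta> loc]
  note crit = local_minimizer_critical[OF q1 \<beta> loc]
  note eqc = local_minimizer_equal_coords[OF q1 \<beta> loc]
  show ?thesis
  proof (cases "\<exists>a\<in>{1..q}. \<exists>b\<in>{1..q}. x a < x b")
    case False
    then have c: "x k = x 1" if "k \<in> {1..q}" for k
      using that q by (metis atLeastAtMost_iff le_refl linorder_neqE_linordered_idom q1)
    have "(\<Sum>k\<in>{1..q}. x k) = (\<Sum>k\<in>{1..q}. x 1)" by (intro sum.cong refl c)
    then have x1: "x 1 = 1 / real q" using simplexD(3)[OF x] q by (simp add: field_simps)
    have "x = (\<lambda>k\<in>{1..q}. 1 / real q)"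
      using c x1 simplexD(4)[OF x] by fastforce
    moreover have "x 1 \<le> 1 / \<beta>" using eqc[of 1 2] c[of 2] q by simp
    ultimately show ?thesis using x1 q \<beta> by (simp add: field_simps)
  next
    case True
    then obtain a b where ab: "a \<in> {1..q}" "b \<in> {1..q}" "x a < x b" by blast
    \<comment> \<open>Any two different coordinates are separated by \<open>1 / \<beta>\<close>.\<close>
    have two: "x c < 1 / \<beta> \<and> 1 / \<beta> < x d" if "c \<in> {1..q}" "d \<in> {1..q}" "x c < x d" for c d
      using ln_eq_linear_imp[OF pos[OF that(1)] that(3) crit[OF that(1,2)]] by blast
    have b1: "1 / \<beta> < x b" using two[OF ab] by blast
    have c: "x c = x a" if "c \<in> {1..q}" "c \<noteq> b" for c
    proof (rule ccontr)
      assume "x c \<noteq> x a"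
      moreover have "x c < 1 / \<beta>"
        using two[OF that(1) ab(2)] two[OF ab(2) that(1)] eqc[OF that(1) ab(2) that(2)] b1 by linarith
      moreover have "x a < 1 / \<beta>" using two[OF ab] by blast
      ultimately show False using two[OF that(1) ab(1)] two[OF ab(1) that(1)] by linarith
    qed
    define s where "s = 1 - real q * x a"
    have sum: "1 = x b + (real q - 1) * x a"
    proof -
      have "(\<Sum>k\<in>{1..q}. x k) = (\<Sum>k\<in>{1..q}. if k = b then x b else x a)"
        using c by (intro sum.cong) auto
      then show ?thesis using sum_one_special[OF ab(2)] simplexD(3)[OF x] by simp
    qed
    have xa: "x a = (1 - s) / real q" using q by (simp add: s_def)
    have xb: "x b = (1 + (real q - 1) * s) / real q"
      using sum xa q by (simp add: field_simps)
    have "x = ray q b s"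
      using c xa xb simplexD(4)[OF x] by (fastforce simp: ray_def)
    moreover have s1: "s < 1" using pos[OF ab(1)] q by (simp add: s_def)
    moreover have s0: "s > 0"
      using ab(3) unfolding xa xb using q by (simp add: field_simps zero_less_mult_iff)
    moreover have "phi q \<beta> s = 0"
    proof -
      have p: "1 + (real q - 1) * s > 0" using s0 q by (intro add_pos_nonneg) auto
      have e: "\<beta> * x b - \<beta> * x a = \<beta> * s"
      proof -
        have "x b - x a = s" unfolding xa xb using q by (simp add: field_simps)
        then show ?thesis by (simp add: right_diff_distrib[symmetric])
      qed
      have "ln (x b) - ln (x a) = \<beta> * s" using crit[OF ab(1,2)] e by simp
      then show ?thesis using p s1 q unfolding xa xb phi_def by (simp add: ln_div)
    qed
    ultimately show ?thesis using ab by blast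
  qed
qed

section \<open>The free energy along a ray\<close>

text \<open>As \<open>phi\<close> has derivative \<open>q / quad q s - \<beta>\<close> and \<open>quad\<close> is a concave parabola, the sign of this derivative
changes at most twice.  This controls the zeros of \<open>phi\<close>.\<close>

definition quad :: "nat \<Rightarrow> real \<Rightarrow> real" where
  "quad q s = (1 + (real q - 1) * s) * (1 - s)"

lemma phi_deriv:
  assumes "q \<ge> 1" "0 \<le> s" "s < 1"
  shows "(phi q \<beta> has_real_derivative real q / quad q s - \<beta>) (at s)"
proof -
  have p: "1 + (real q - 1) * s > 0" using assms by (intro add_pos_nonneg) auto
  have "(real q - 1) / (1 + (real q - 1) * s) + 1 / (1 - s) = real q / ((1 + (real q - 1) * s) * (1 - s))"
    using p assms by (simp add: divide_simps) (simp add: algebra_simps)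
  then show ?thesis
    unfolding phi_def[abs_def] quad_def using p assms
    by (auto intro!: derivative_eq_intros simp: divide_simps split: if_splits)
qed

lemma energy_deriv:
  assumes "q \<ge> 1" "\<beta> > 0" "0 \<le> s" "s < 1" "i \<in> {1..q}"
  shows "((\<lambda>s. free_energy q \<beta> (ray q i s)) has_real_derivative
     (real q - 1) / (real q * \<beta>) * phi q \<beta> s) (at s)"
proof -
  have p: "1 + (real q - 1) * s > 0" using assms by (intro add_pos_nonneg) auto
  let ?b = "(1 + (real q - 1) * s) / real q" and ?a = "(1 - s) / real q"
  have pos: "?a > 0" "?b > 0" using p assms by auto
  have *: "((\<lambda>s. psi \<beta> ((1 + (real q - 1) * s) / real q) + (real q - 1) * psi \<beta> ((1 - s) / real q)) has_real_derivative
     psi' \<beta> ?b * ((real q - 1) / real q) + (real q - 1) * (psi' \<beta> ?a * (- 1 / real q))) (at s)"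
    using pos by (auto intro!: derivative_eq_intros DERIV_chain2[OF psi_deriv])
  have "psi' \<beta> ?b - psi' \<beta> ?a = 1 / \<beta> * phi q \<beta> s"
  proof -
    have "?a - ?b = - s" using assms by (simp add: field_simps)
    moreover have "ln ?b - ln ?a = phi q \<beta> s + \<beta> * s"
      using assms p by (simp add: ln_div phi_def)
    moreover have "psi' \<beta> ?b - psi' \<beta> ?a = (?a - ?b) + 1 / \<beta> * (ln ?b - ln ?a)"
      unfolding psi'_def by (simp only: distrib_left right_diff_distrib)
    ultimately have "psi' \<beta> ?b - psi' \<beta> ?a = - s + 1 / \<beta> * (phi q \<beta> s + \<beta> * s)" by simp
    then show ?thesis using assms(2) by (simp add: distrib_left)
  qed
  moreover have "psi' \<beta> ?b * ((real q - 1) / real q) + (real q - 1) * (psi' \<beta> ?a * (- 1 / real q))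
      = (real q - 1) / real q * (psi' \<beta> ?b - psi' \<beta> ?a)"
    by (simp add: algebra_simps diff_divide_distrib)
  ultimately have "psi' \<beta> ?b * ((real q - 1) / real q) + (real q - 1) * (psi' \<beta> ?a * (- 1 / real q))
      = (real q - 1) / (real q * \<beta>) * phi q \<beta> s"
    by simp
  with * show ?thesis unfolding free_energy_ray[OF assms(5)] by simp
qed

lemma quad_pos: "q \<ge> 1 \<Longrightarrow> 0 \<le> s \<Longrightarrow> s < 1 \<Longrightarrow> quad q s > 0"
  unfolding quad_def by (intro mult_pos_pos add_pos_nonneg) auto

lemma quad_diff: "quad q t - quad q s = (t - s) * ((real q - 2) - (real q - 1) * (s + t))"
  by (simp add: quad_def algebra_simps)

lemma quad_decreasing:
  assumes q: "q \<ge> 1" and "r < s" "s < t" "quad q s \<le> quad q r" shows "quad q t \<le> quad q s"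
proof -
  have "(s - r) * ((real q - 2) - (real q - 1) * (r + s)) \<le> 0"
    using assms(4) by (simp flip: quad_diff)
  then have "(real q - 2) - (real q - 1) * (r + s) \<le> 0"
    using assms(2) by (simp add: mult_le_0_iff)
  moreover have "(real q - 1) * (r + s) \<le> (real q - 1) * (s + t)"
    using assms by (intro mult_left_mono) auto
  ultimately have "(t - s) * ((real q - 2) - (real q - 1) * (s + t)) \<le> 0"
    using assms(3) by (simp add: mult_le_0_iff)
  then show ?thesis by (simp flip: quad_diff)
qed

lemma quad_between:
  assumes q: "q \<ge> 2" and "r < s" "s < t" "quad q r = quad q t" shows "quad q r < quad q s"
proof -
  have "(t - r) * ((real q - 2) - (real q - 1) * (r + t)) = 0"
    using assms(4) by (simp flip: quad_diff)
  then have e: "real q - 2 = (real q - 1) * (r + t)" using assms by simp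
  have "quad q s - quad q r = (s - r) * ((real q - 1) * (t - s))"
    unfolding quad_diff e by (simp add: algebra_simps)
  moreover have "\<dots> > 0" using assms by (intro mult_pos_pos) auto
  ultimately show ?thesis by simp
qed

lemma energy_ray_mvt:
  assumes "q \<ge> 1" "\<beta> > 0" "i \<in> {1..q}" "0 \<le> a" "a < b" "b < 1"
  obtains z where "a < z" "z < b"
    "free_energy q \<beta> (ray q i b) - free_energy q \<beta> (ray q i a)
      = (b - a) * ((real q - 1) / (real q * \<beta>) * phi q \<beta> z)"
  using MVT2[OF assms(5), of "\<lambda>s. free_energy q \<beta> (ray q i s)"
      "\<lambda>s. (real q - 1) / (real q * \<beta>) * phi q \<beta> s"]
    energy_deriv[OF assms(1,2) _ _ assms(3)] assms(4,6) by auto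

lemma near_ray:
  assumes "q \<ge> 1" "\<bar>s - t\<bar> < \<epsilon>" shows "near q \<epsilon> (ray q i s) (ray q i t)"
  unfolding near_def
proof
  fix k assume k: "k \<in> {1..q}"
  have "ray q i s k - ray q i t k = (if k = i then (real q - 1) / real q else - (1 / real q)) * (s - t)"
    using k by (auto simp: ray_def field_simps)
  also have "\<bar>\<dots>\<bar> \<le> 1 * \<bar>s - t\<bar>"
    unfolding abs_mult using assms(1) by (intro mult_right_mono) auto
  finally show "\<bar>ray q i s k - ray q i t k\<bar> < \<epsilon>" using assms(2) by simp
qed

lemma phi_0 [simp]: "phi q \<beta> 0 = 0" by (simp add: phi_def)

lemma phi_continuous: "q \<ge> 1 \<Longrightarrow> 0 \<le> a \<Longrightarrow> b < 1 \<Longrightarrow> continuous_on {a..b} (phi q \<beta>)"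
  by (rule DERIV_continuous_on, rule has_field_derivative_at_within, rule phi_deriv) auto

lemma phi_mvt:
  assumes "q \<ge> 1" "0 \<le> a" "a < b" "b < 1"
  obtains z where "a < z" "z < b" "phi q \<beta> b - phi q \<beta> a = (b - a) * (real q / quad q z - \<beta>)"
  using MVT2[OF assms(3), of "phi q \<beta>" "\<lambda>z. real q / quad q z - \<beta>"] phi_deriv[of q] assms
  by (smt (verit))

lemma phi_ivt:
  assumes "q \<ge> 1" "0 \<le> a" "a \<le> b" "b < 1" "phi q \<beta> a * phi q \<beta> b \<le> 0"
  shows "\<exists>z. a \<le> z \<and> z \<le> b \<and> phi q \<beta> z = 0"
proof (cases "phi q \<beta> a \<le> 0 \<and> 0 \<le> phi q \<beta> b")
  case True then show ?thesis using IVT'[of "phi q \<beta>" a 0 b] phi_continuous[of q a b] assms by auto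
next
  case False
  then have "0 \<le> phi q \<beta> a \<and> phi q \<beta> b \<le> 0"
    using assms(5) by (auto simp: mult_le_0_iff)
  then show ?thesis using IVT2'[of "phi q \<beta>" b 0 a] phi_continuous[of q a b] assms by auto
qed

text \<open>\<open>phi\<close> tends to infinity at \<open>1\<close>; the witness makes \<open>- ln (1 - u)\<close> at least \<open>\<beta> + 1\<close>.\<close>

lemma phi_eventually_pos:
  assumes "q \<ge> 1" "0 \<le> s" "s < 1" "\<beta> \<ge> 0"
  obtains u where "s < u" "u < 1" "phi q \<beta> u > 0"
proof -
  define u where "u = max ((1 + s) / 2) (1 - exp (- (\<beta> + 1)))"
  have u: "s < u" "u < 1" "0 \<le> u" using assms by (auto simp: u_def max_def field_simps)
  have "1 - u \<le> exp (- (\<beta> + 1))" by (simp add: u_def)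
  then have "ln (1 - u) \<le> - (\<beta> + 1)" using u by (metis diff_gt_0_iff_gt ln_exp ln_le_cancel_iff exp_gt_zero)
  moreover have "ln (1 + (real q - 1) * u) \<ge> 0" using assms u by (intro ln_ge_zero) auto
  moreover have "\<beta> * u \<le> \<beta> * 1" using u assms by (intro mult_left_mono) auto
  ultimately have "phi q \<beta> u > 0" by (simp add: phi_def)
  with u that show ?thesis by blast
qed

text \<open>With a zero on each side (\<open>0\<close> and \<open>t\<close>), Rolle's theorem gives two critical points of \<open>phi\<close> around \<open>s\<close>.
Between them the parabola \<open>quad\<close> is larger, so \<open>phi\<close> decreases at \<open>s\<close>: the free energy has a local
maximum at \<open>s\<close> along the ray.\<close>

lemma local_minimizer_ray_greatest:
  assumes q: "q \<ge> 2" and \<beta>: "\<beta> > 0" and i: "i \<in> {1..q}" and s: "0 < s" "s < 1"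
    and zero: "phi q \<beta> s = 0" and loc: "local_minimizer q (free_energy q \<beta>) (ray q i s)"
    and t: "s < t" "t < 1"
  shows "phi q \<beta> t \<noteq> 0"
proof
  assume zt: "phi q \<beta> t = 0"
  have q1: "q \<ge> 1" using q by simp
  obtain r where r: "0 < r" "r < s" "real q / quad q r = \<beta>"
    using phi_mvt[OF q1, of 0 s \<beta>] s zero by auto
  obtain u where u: "s < u" "u < t" "real q / quad q u = \<beta>"
    using phi_mvt[OF q1, of s t \<beta>] s t zero zt by auto
  have p: "quad q r > 0" "quad q s > 0" "quad q u > 0" using quad_pos[OF q1] r s u t by auto
  have "real q = \<beta> * quad q r" "real q = \<beta> * quad q u"
    using r(3) u(3) p by (auto simp: field_simps)
  then have bq: "real q = \<beta> * quad q r" "quad q r = quad q u" using \<beta> by auto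
  then have "\<beta> * quad q r < \<beta> * quad q s" using quad_between[OF q r(2) u(1)] \<beta> by simp
  then have neg: "real q / quad q s - \<beta> < 0" using bq(1) p by (simp add: field_simps)
  obtain d where d: "d > 0" "\<And>h. 0 < h \<Longrightarrow> h < d \<Longrightarrow> phi q \<beta> s < phi q \<beta> (s - h)"
    using DERIV_neg_dec_left[OF phi_deriv[OF q1 less_imp_le[OF s(1)] s(2)] neg] by blast
  obtain \<epsilon> where e: "\<epsilon> > 0" and min: "\<And>y. y \<in> prob_simplex q \<Longrightarrow> near q \<epsilon> (ray q i s) y \<Longrightarrow> free_energy q \<beta> (ray q i s) \<le> free_energy q \<beta> y"
    using loc unfolding local_minimizer_iff_near[OF q1] by blast
  define h where "h = min (min d s) \<epsilon> / 2"
  have h: "0 < h" "h < d" "h < s" "h < \<epsilon>" using d(1) s e by (auto simp: h_def min_def)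
  obtain z where z: "s - h < z" "z < s" "free_energy q \<beta> (ray q i s) - free_energy q \<beta> (ray q i (s - h))
      = (s - (s - h)) * ((real q - 1) / (real q * \<beta>) * phi q \<beta> z)"
    using energy_ray_mvt[OF q1 \<beta> i, of "s - h" s] h s by auto
  have "phi q \<beta> z > 0" using d(2)[of "s - z"] z h zero by simp
  have "free_energy q \<beta> (ray q i s) > free_energy q \<beta> (ray q i (s - h))"
  proof -
    have c: "(real q - 1) / (real q * \<beta>) > 0" using q \<beta> by simp
    have "0 < (s - (s - h)) * ((real q - 1) / (real q * \<beta>) * phi q \<beta> z)"
      using \<open>phi q \<beta> z > 0\<close> h c by (intro mult_pos_pos) auto
    then show ?thesis unfolding z(3)[symmetric] by simp
  qed
  moreover have "near q \<epsilon> (ray q i s) (ray q i (s - h))" using h by (intro near_ray[OF q1]) simp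
  ultimately show False using min[OF ray_in_simplex[OF i], of "s - h"] h s by simp
qed

lemma s_max_eqI:
  assumes "0 \<le> s" "s < 1" "phi q \<beta> s = 0" "\<And>t. s < t \<Longrightarrow> t < 1 \<Longrightarrow> phi q \<beta> t \<noteq> 0"
  shows "s_max q \<beta> = s"
  unfolding s_max_def
proof (rule Greatest_equality)
  show "0 \<le> s \<and> s < 1 \<and> ln (1 + (real q - 1) * s) - ln (1 - s) = \<beta> * s"
    using assms by (simp add: phi_def)
  show "t \<le> s" if "0 \<le> t \<and> t < 1 \<and> ln (1 + (real q - 1) * t) - ln (1 - t) = \<beta> * t" for t
    using that assms(4)[of t] by (force simp: phi_def)
qed

lemma m_point_ray: "i \<noteq> 0 \<Longrightarrow> m_point q \<beta> i = ray q i (s_max q \<beta>)"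
  by (simp add: m_point_def ray_def)

lemma m_point_0: "m_point q \<beta> 0 = (\<lambda>k\<in>{1..q}. 1 / real q)"
  by (simp add: m_point_def)

lemma ray_0: "ray q i 0 = (\<lambda>k\<in>{1..q}. 1 / real q)"
  by (auto simp: ray_def)

text \<open>If \<open>phi\<close> is negative somewhere, it must rise to become positive near \<open>1\<close>.  Its derivative is then
negative, positive, and would have to vanish once more between two zeros, but a concave parabola
that has decreased continues to decrease.  So there is exactly one zero to the right of \<open>s1\<close>.\<close>

lemma s_max_crossing:
  assumes q: "q \<ge> 2" and \<beta>: "\<beta> > 0" and s1: "0 < s1" "s1 < 1" "phi q \<beta> s1 < 0"
  shows "s1 < s_max q \<beta>" "s_max q \<beta> < 1" "phi q \<beta> (s_max q \<beta>) = 0"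
    "\<And>t. s1 < t \<Longrightarrow> t < s_max q \<beta> \<Longrightarrow> phi q \<beta> t < 0"
    "\<And>t. s_max q \<beta> < t \<Longrightarrow> t < 1 \<Longrightarrow> phi q \<beta> t > 0"
proof -
  have q1: "q \<ge> 1" using q by simp
  have unique: False if st: "s1 < s" "s < t" "t < 1" "phi q \<beta> s = 0" "phi q \<beta> t = 0" for s t
  proof -
    have s_lt: "s < 1" "0 < s" using st s1 by auto
    obtain a where a: "0 < a" "a < s1" "phi q \<beta> s1 - phi q \<beta> 0 = (s1 - 0) * (real q / quad q a - \<beta>)"
      using phi_mvt[OF q1, of 0 s1 \<beta>] s1 by auto
    obtain b where b: "s1 < b" "b < s" "phi q \<beta> s - phi q \<beta> s1 = (s - s1) * (real q / quad q b - \<beta>)"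
      using phi_mvt[OF q1, of s1 s \<beta>] s1 s_lt st by auto
    obtain c where c: "s < c" "c < t" "phi q \<beta> t - phi q \<beta> s = (t - s) * (real q / quad q c - \<beta>)"
      using phi_mvt[OF q1, of s t \<beta>] s1 s_lt st by auto
    have p: "quad q a > 0" "quad q b > 0" "quad q c > 0" using quad_pos[OF q1] a b c s1 st by auto
    have "(s1 - 0) * (real q / quad q a - \<beta>) < 0" using a(3) s1(3) by simp
    then have A: "real q / quad q a < \<beta>" using s1 by (simp add: mult_less_0_iff)
    have "(s - s1) * (real q / quad q b - \<beta>) > 0" using b(3) s1(3) st(4) by simp
    then have B: "real q / quad q b > \<beta>" using st by (simp add: zero_less_mult_iff)
    have C: "real q / quad q c = \<beta>" using c(3) st by simp
    have "real q / quad q a < real q / quad q b" using A B by simp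
    then have "quad q b < quad q a" using p q1 by (simp add: field_simps)
    then have "quad q c \<le> quad q b" using quad_decreasing[OF q1, of a b c] a b c by simp
    then have "real q / quad q b \<le> real q / quad q c" using p by (intro divide_left_mono) auto
    with B C show False by simp
  qed
  obtain u where u: "s1 < u" "u < 1" "phi q \<beta> u > 0"
    using phi_eventually_pos[OF q1, of s1 \<beta>] s1 \<beta> by auto
  obtain s where s: "s1 \<le> s" "s \<le> u" "phi q \<beta> s = 0"
    using phi_ivt[OF q1, of s1 u \<beta>] s1 u by (auto simp: mult_le_0_iff)
  have s': "s1 < s" "s < 1" using s s1 u by (auto simp: order_less_le)
  have smax: "s_max q \<beta> = s"
    using unique[OF s'(1)] s s' s1 by (intro s_max_eqI) auto
  show "s1 < s_max q \<beta>" "s_max q \<beta> < 1" "phi q \<beta> (s_max q \<beta>) = 0"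
    unfolding smax using s s' by auto
  show "phi q \<beta> t < 0" if "s1 < t" "t < s_max q \<beta>" for t
  proof (rule ccontr)
    assume n: "\<not> ?thesis"
    have t: "s1 \<le> t" "t < 1" using that s' by (auto simp: smax)
    obtain z where z: "s1 \<le> z" "z \<le> t" "phi q \<beta> z = 0"
      using phi_ivt[OF q1, of s1 t \<beta>] s1 t n by (auto simp: mult_le_0_iff)
    moreover have "z \<noteq> s1" using z(3) s1(3) by auto
    ultimately show False using unique[of z s] s s' that by (auto simp: smax)
  qed
  show "phi q \<beta> t > 0" if t: "s_max q \<beta> < t" "t < 1" for t
  proof (rule ccontr)
    assume n: "\<not> ?thesis"
    obtain v where v: "t < v" "v < 1" "phi q \<beta> v > 0"
      using phi_eventually_pos[OF q1, of t \<beta>] s1 s' t \<beta> by (auto simp: smax)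
    obtain z where z: "t \<le> z" "z \<le> v" "phi q \<beta> z = 0"
      using phi_ivt[OF q1, of t v \<beta>] s1 s' t v n by (auto simp: mult_le_0_iff smax)
    then show False using unique[of s z] s s' t v by (auto simp: smax)
  qed
qed

lemma psi_above_tangent:
  assumes "\<beta> > 0" "0 < u" "u \<le> 1 / \<beta>" "0 < v" "v \<le> 1 / \<beta>"
  shows "psi \<beta> v + psi' \<beta> v * (u - v) \<le> psi \<beta> u"
proof -
  have "psi' \<beta> v * (u - v) \<le> psi \<beta> u - psi \<beta> v"
  proof (rule f''_imp_f'[where C = "{0<..1/\<beta>}" and f'' = "\<lambda>u. - 1 + 1 / (\<beta> * u)"])
    show "(psi \<beta> has_real_derivative psi' \<beta> x) (at x)" if "x \<in> {0<..1/\<beta>}" for x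
      using that by (intro psi_deriv) auto
    show "(psi' \<beta> has_real_derivative - 1 + 1 / (\<beta> * x)) (at x)" if "x \<in> {0<..1/\<beta>}" for x
      using that assms(1) unfolding psi'_def[abs_def] by (auto intro!: derivative_eq_intros simp: field_simps)
    show "0 \<le> - 1 + 1 / (\<beta> * x)" if "x \<in> {0<..1/\<beta>}" for x
      using that assms(1) by (auto simp: field_simps)
  qed (use assms in auto)
  then show ?thesis by simp
qed

text \<open>Jensen's inequality on the convex part of \<open>psi\<close>.  It replaces the second-order condition in several variables, as
it reduces the comparison of points near \<open>m\<^sub>i\<close> to points on the ray.\<close>

lemma psi_jensen:
  assumes \<beta>: "\<beta> > 0" and A: "finite A" "A \<noteq> {}" and y: "\<And>k. k \<in> A \<Longrightarrow> 0 < y k \<and> y k \<le> 1 / \<beta>"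
  shows "real (card A) * psi \<beta> ((\<Sum>k\<in>A. y k) / real (card A)) \<le> (\<Sum>k\<in>A. psi \<beta> (y k))"
proof -
  let ?v = "(\<Sum>k\<in>A. y k) / real (card A)"
  have c: "real (card A) > 0" using A by (simp add: card_gt_0_iff)
  have "(\<Sum>k\<in>A. y k) > 0" using A y by (intro sum_pos) auto
  then have v0: "?v > 0" using c by simp
  have "(\<Sum>k\<in>A. y k) \<le> (\<Sum>k\<in>A. 1 / \<beta>)" using y by (intro sum_mono) auto
  then have v1: "?v \<le> 1 / \<beta>" using c by (simp add: field_simps)
  have "(\<Sum>k\<in>A. psi \<beta> ?v + psi' \<beta> ?v * (y k - ?v)) \<le> (\<Sum>k\<in>A. psi \<beta> (y k))"
    using psi_above_tangent[OF \<beta> _ _ v0 v1] y by (intro sum_mono) auto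
  moreover have "(\<Sum>k\<in>A. psi \<beta> ?v + psi' \<beta> ?v * (y k - ?v)) = real (card A) * psi \<beta> ?v"
    using c by (simp add: sum.distrib sum_subtractf flip: sum_distrib_left)
  ultimately show ?thesis by simp
qed

lemma local_minimizer_center:
  assumes q: "q \<ge> 1" and \<beta>: "\<beta> > 0" "\<beta> < real q"
  shows "local_minimizer q (free_energy q \<beta>) (\<lambda>k\<in>{1..q}. 1 / real q)"
  unfolding local_minimizer_iff_near[OF q]
proof (intro conjI exI ballI impI)
  let ?m = "\<lambda>k\<in>{1..q}. 1 / real q"
  show "?m \<in> prob_simplex q" using q by (intro simplexI) auto
  let ?e = "min (1 / real q) (1 / \<beta> - 1 / real q)"
  show "?e > 0" using q \<beta> by (simp add: field_simps)
  fix y assume y: "y \<in> prob_simplex q" and n: "near q ?e ?m y"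
  have yk: "0 < y k \<and> y k \<le> 1 / \<beta>" if "k \<in> {1..q}" for k
  proof -
    have "\<bar>1 / real q - y k\<bar> < ?e" using n that by (auto simp: near_def)
    then show ?thesis unfolding min_less_iff_conj abs_less_iff by linarith
  qed
  have "real (card {1..q}) * psi \<beta> ((\<Sum>k\<in>{1..q}. y k) / real (card {1..q})) \<le> (\<Sum>k\<in>{1..q}. psi \<beta> (y k))"
    using q by (intro psi_jensen[OF \<beta>(1)] yk) auto
  then show "free_energy q \<beta> ?m \<le> free_energy q \<beta> y"
    using simplexD(3)[OF y] by (simp add: free_energy_psi)
qed

text \<open>Averaging the coordinates other than the \<open>i\<close>-th leads to the point of the \<open>i\<close>-th ray that has the
same \<open>i\<close>-th coordinate.\<close>

lemma free_energy_ge_ray: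
  assumes q: "q \<ge> 2" and \<beta>: "\<beta> > 0" and y: "y \<in> prob_simplex q" and i: "i \<in> {1..q}"
    and small: "\<And>k. k \<in> {1..q} \<Longrightarrow> k \<noteq> i \<Longrightarrow> 0 < y k \<and> y k \<le> 1 / \<beta>"
  shows "free_energy q \<beta> (ray q i ((real q * y i - 1) / (real q - 1))) \<le> free_energy q \<beta> y"
proof -
  let ?s = "(real q * y i - 1) / (real q - 1)"
  have q1: "real q - 1 > 0" using q by simp
  have "(1 - ?s) * (real q - 1) = real q * (1 - y i)" using q1 by (simp add: field_simps)
  then have e: "(1 - ?s) / real q = (1 - y i) / (real q - 1)" using q1 by (simp add: field_simps)
  have card: "real (card ({1..q} - {i})) = real q - 1" using i by (simp add: of_nat_diff)
  have "card ({1..q} - {i}) > 0" using i q by simp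
  then have ne: "{1..q} - {i} \<noteq> {}" by (metis card.empty less_irrefl)
  have "(\<Sum>k\<in>{1..q}. y k) = y i + (\<Sum>k\<in>{1..q} - {i}. y k)" using i by (intro sum.remove) auto
  then have "(\<Sum>k\<in>{1..q} - {i}. y k) = 1 - y i" using simplexD(3)[OF y] by simp
  then have "(real q - 1) * psi \<beta> ((1 - y i) / (real q - 1)) \<le> (\<Sum>k\<in>{1..q} - {i}. psi \<beta> (y k))"
    using psi_jensen[OF \<beta> _ ne, of y] small card by simp
  moreover have "free_energy q \<beta> y = psi \<beta> (y i) + (\<Sum>k\<in>{1..q} - {i}. psi \<beta> (y k))"
    unfolding free_energy_psi using i by (intro sum.remove) auto
  moreover have "(1 + (real q - 1) * ?s) / real q = y i" using q1 by simp
  ultimately show ?thesis unfolding free_energy_ray[OF i] e by simp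
qed

text \<open>After averaging, only the behaviour along the ray matters, and there \<open>phi\<close> changes sign from negative to
positive at \<open>s_max\<close>.\<close>

lemma local_minimizer_m_point:
  assumes q: "q \<ge> 2" and \<beta>: "\<beta> > 0" and s1: "0 < s1" "s1 < 1" "phi q \<beta> s1 < 0" and i: "i \<in> {1..q}"
  shows "local_minimizer q (free_energy q \<beta>) (ray q i (s_max q \<beta>))"
proof -
  define s where "s = s_max q \<beta>"
  note cr = s_max_crossing[OF q \<beta> s1, folded s_def]
  have q1: "q \<ge> 1" "real q - 1 > 0" using q by auto
  have s: "0 < s" "s < 1" using cr(1,2) s1 by auto
  define a where "a = (1 - s) / real q"
  define b where "b = (1 + (real q - 1) * s) / real q"
  have a0: "a > 0" using s q by (simp add: a_def)
  have ba: "b - a = s" using q by (simp add: a_def b_def field_simps)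
  have "ln b - ln a = \<beta> * s"
  proof -
    have "1 + (real q - 1) * s > 0" using s q by (intro add_pos_nonneg) auto
    then show ?thesis using cr(3) s q unfolding a_def b_def phi_def by (simp add: ln_div)
  qed
  then have "ln a - \<beta> * a = ln b - \<beta> * b" using ba unfolding ba[symmetric] by (simp add: algebra_simps)
  then have a1: "a < 1 / \<beta>" using ln_eq_linear_imp(1)[of a b \<beta>] a0 ba s by simp
  define \<delta> where "\<delta> = min (s - s1) (1 - s)"
  have d: "\<delta> > 0" using cr(1) s by (simp add: \<delta>_def)
  have ray_min: "free_energy q \<beta> (ray q i s) \<le> free_energy q \<beta> (ray q i t)" if t: "\<bar>t - s\<bar> < \<delta>" for t
  proof -
    have t01: "s1 < t" "t < 1" using t unfolding \<delta>_def min_def abs_less_iff by (auto split: if_splits)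
    have c: "(real q - 1) / (real q * \<beta>) > 0" using q1 q \<beta> by simp
    consider "t < s" | "t = s" | "s < t" by linarith
    then show ?thesis
    proof cases
      case 1
      obtain z where z: "t < z" "z < s" "free_energy q \<beta> (ray q i s) - free_energy q \<beta> (ray q i t)
          = (s - t) * ((real q - 1) / (real q * \<beta>) * phi q \<beta> z)"
        using energy_ray_mvt[OF q1(1) \<beta> i _ 1] s1 s t01 by auto
      have "(s - t) * ((real q - 1) / (real q * \<beta>) * phi q \<beta> z) \<le> 0"
        using cr(4)[of z] z t01 c 1 by (intro mult_nonneg_nonpos) (auto intro: less_imp_le)
      then show ?thesis using z by simp
    next
      case 3
      obtain z where z: "s < z" "z < t" "free_energy q \<beta> (ray q i t) - free_energy q \<beta> (ray q i s)
          = (t - s) * ((real q - 1) / (real q * \<beta>) * phi q \<beta> z)"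
        using energy_ray_mvt[OF q1(1) \<beta> i _ 3] s1 s t01 by auto
      have "(t - s) * ((real q - 1) / (real q * \<beta>) * phi q \<beta> z) \<ge> 0"
        using cr(5)[of z] z t01 c 3 by (intro mult_nonneg_nonneg) (auto intro: less_imp_le)
      then show ?thesis using z by simp
    qed simp
  qed
  define \<epsilon> where "\<epsilon> = min (min a (1 / \<beta> - a)) (\<delta> * (real q - 1) / real q)"
  have "\<epsilon> > 0" using a0 a1 d q1 q by (simp add: \<epsilon>_def)
  moreover have "free_energy q \<beta> (ray q i s) \<le> free_energy q \<beta> y"
    if y: "y \<in> prob_simplex q" and n: "near q \<epsilon> (ray q i s) y" for y
  proof -
    have nk: "\<bar>ray q i s k - y k\<bar> < \<epsilon>" if "k \<in> {1..q}" for k using n that by (simp add: near_def)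
    have small: "0 < y k \<and> y k \<le> 1 / \<beta>" if "k \<in> {1..q}" "k \<noteq> i" for k
    proof -
      have "\<bar>a - y k\<bar> < \<epsilon>" using nk[of k] that by (simp add: ray_def a_def)
      moreover have "\<epsilon> \<le> a" "\<epsilon> \<le> 1 / \<beta> - a" by (auto simp: \<epsilon>_def)
      ultimately show ?thesis by linarith
    qed
    have "\<bar>b - y i\<bar> < \<epsilon>" using nk[of i] i by (simp add: ray_def b_def)
    moreover have "\<epsilon> \<le> \<delta> * (real q - 1) / real q" by (simp add: \<epsilon>_def)
    ultimately have "\<bar>b - y i\<bar> < \<delta> * (real q - 1) / real q" by linarith
    then have l: "real q * \<bar>b - y i\<bar> < \<delta> * (real q - 1)" using q by (simp add: field_simps)
    have "(real q * y i - 1) / (real q - 1) - s = (real q * (y i - b)) / (real q - 1)"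
      using q1 q by (simp add: b_def field_simps)
    then have "\<bar>(real q * y i - 1) / (real q - 1) - s\<bar> = real q * \<bar>b - y i\<bar> / (real q - 1)"
      using q1 by (simp add: abs_mult abs_minus_commute)
    also have "\<dots> < \<delta>" using l q1 by (simp add: field_simps)
    finally have "free_energy q \<beta> (ray q i s) \<le> free_energy q \<beta> (ray q i ((real q * y i - 1) / (real q - 1)))"
      by (rule ray_min)
    also have "\<dots> \<le> free_energy q \<beta> y" using free_energy_ge_ray[OF q \<beta> y i small] by blast
    finally show ?thesis .
  qed
  ultimately show ?thesis
    unfolding local_minimizer_iff_near[OF q1(1)] s_def[symmetric]
    using ray_in_simplex[OF i, of s] s by auto
qed

text \<open>Below \<open>\<beta>\<close> there is a \<open>b\<close> for which the free energy has a local minimizer on a ray.  Its zero \<open>s\<close> of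
\<open>phi q b\<close> is a point where \<open>phi q \<beta>\<close> is negative, since \<open>phi q \<beta> s\<close> decreases in \<open>\<beta>\<close>.
For two colours the transition is continuous at \<open>\<beta> = 2\<close>.\<close>

lemma beta1_gtD:
  assumes q: "q \<ge> 2" and \<beta>: "\<beta> > beta1 q"
  shows "\<beta> > 0" "\<exists>s. 0 < s \<and> s < 1 \<and> phi q \<beta> s < 0" "q = 2 \<Longrightarrow> \<beta> > 2"
proof -
  have q1: "q \<ge> 1" using q by simp
  let ?B = "{\<beta>. 0 < \<beta> \<and> (\<exists>x. local_minimizer q (free_energy q \<beta>) x \<and> x \<noteq> (\<lambda>k\<in>{1..q}. 1 / real q))}"
  \<comment> \<open>The infimum is only meaningful if the set is nonempty; a large parameter makes \<open>phi\<close> negative at \<open>1/2\<close>.\<close>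
  have "?B \<noteq> {}"
  proof -
    define b where "b = 2 * (ln (1 + (real q - 1) * (1/2)) - ln (1 - 1/2)) + 1"
    have "ln (1 + (real q - 1) * (1/2)) \<ge> 0" using q by (intro ln_ge_zero) auto
    moreover have "ln (1 - 1/2 :: real) \<le> 0" by simp
    ultimately have "ln (1 - 1/2) \<le> ln (1 + (real q - 1) * (1/2))" by (rule order_trans[rotated])
    then have "0 \<le> 2 * (ln (1 + (real q - 1) * (1/2)) - ln (1 - 1/2))"
      by (simp only: mult_nonneg_nonneg diff_ge_0_iff_ge zero_le_numeral)
    then have b0: "b > 0" unfolding b_def by (rule add_nonneg_pos) simp
    have "b * (1/2) = (ln (1 + (real q - 1) * (1/2)) - ln (1 - 1/2)) + 1/2"
      unfolding b_def by (simp only: distrib_right) simp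
    then have neg: "phi q b (1/2) < 0" unfolding phi_def by simp
    have "local_minimizer q (free_energy q b) (ray q 1 (s_max q b))"
      using local_minimizer_m_point[OF q b0 _ _ neg, of 1] q by simp
    moreover have "ray q 1 (s_max q b) \<noteq> (\<lambda>k\<in>{1..q}. 1 / real q)"
    proof
      assume "ray q 1 (s_max q b) = (\<lambda>k\<in>{1..q}. 1 / real q)"
      from fun_cong[OF this, of 2] have "s_max q b = 0" using q by (simp add: ray_def field_simps)
      then show False using s_max_crossing(1)[OF q b0 _ _ neg] by simp
    qed
    ultimately show ?thesis using b0 by blast
  qed
  moreover have "bdd_below ?B" by (intro bdd_belowI[of _ 0]) auto
  ultimately obtain b x where b: "b < \<beta>" "0 < b" "local_minimizer q (free_energy q b) x"
    "x \<noteq> (\<lambda>k\<in>{1..q}. 1 / real q)"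
    using \<beta> unfolding beta1_def by (subst (asm) cInf_less_iff) auto
  show "\<beta> > 0" using b by simp
  obtain i s where s: "0 < s" "s < 1" "phi q b s = 0"
    using local_minimizer_cases[OF q b(2,3)] b(4) by blast
  have "phi q \<beta> s = phi q b s - (\<beta> - b) * s" by (simp add: phi_def algebra_simps)
  then have "phi q \<beta> s < 0" using s b(1) by simp
  then show "\<exists>s. 0 < s \<and> s < 1 \<and> phi q \<beta> s < 0" using s by blast
  show "\<beta> > 2" if "q = 2"
  proof -
    obtain z where z: "0 < z" "z < s" "real q / quad q z = b"
      using phi_mvt[OF q1, of 0 s b] s by auto
    have "quad q z = 1 - z\<^sup>2" using that by (simp add: quad_def power2_eq_square algebra_simps)
    moreover have "quad q z > 0" using quad_pos[OF q1, of z] z s by simp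
    moreover have "z\<^sup>2 \<ge> 0" by simp
    ultimately have "0 < quad q z" "quad q z \<le> 1" by linarith+
    then have "2 / quad q z \<ge> 2" by (simp add: field_simps)
    then show ?thesis using z that b by simp
  qed
qed

text \<open>Above \<open>q\<close> this is the second-order condition.  At \<open>\<beta> = q\<close> the second derivative vanishes, and for at
least three colours the cubic term makes the free energy decrease towards each vertex.\<close>

lemma center_not_local_minimizer:
  assumes q: "q \<ge> 2" and \<beta>: "\<beta> > beta1 q" "\<beta> \<ge> real q"
  shows "\<not> local_minimizer q (free_energy q \<beta>) (\<lambda>k\<in>{1..q}. 1 / real q)"
proof
  assume loc: "local_minimizer q (free_energy q \<beta>) (\<lambda>k\<in>{1..q}. 1 / real q)"
  have q1: "q \<ge> 1" using q by simp
  have b0: "\<beta> > 0" using beta1_gtD(1)[OF q \<beta>(1)] .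
  have eq: "\<beta> = real q"
    using local_minimizer_equal_coords[OF q1 b0 loc, of 1 2] q \<beta>(2) b0 by (simp add: field_simps)
  then have q3: "q \<ge> 3" using beta1_gtD(3)[OF q \<beta>(1)] q by (cases "q = 2") auto
  obtain \<epsilon> where e: "\<epsilon> > 0" and min: "\<And>y. y \<in> prob_simplex q \<Longrightarrow> near q \<epsilon> (ray q 1 0) y \<Longrightarrow> free_energy q \<beta> (ray q 1 0) \<le> free_energy q \<beta> y"
    using loc unfolding local_minimizer_iff_near[OF q1] ray_0[of q 1, symmetric] by blast
  define h where "h = min \<epsilon> (1/2) / 2"
  have h: "0 < h" "h < \<epsilon>" "h < 1/2" using e by (auto simp: h_def min_def)
  have neg: "phi q \<beta> t < 0" if t: "0 < t" "t < 1/2" for t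
  proof -
    obtain z where z: "0 < z" "z < t" "phi q \<beta> t - phi q \<beta> 0 = (t - 0) * (real q / quad q z - \<beta>)"
      using phi_mvt[OF q1, of 0 t \<beta>] t by auto
    have "(real q - 1) * z < (real q - 1) * (1/2)" using z t q by (intro mult_strict_left_mono) auto
    moreover have "(real q - 1) * (1/2) \<le> real q - 2" using q3 by (simp add: field_simps)
    ultimately have "(real q - 1) * z < real q - 2" by (rule less_le_trans)
    then have "(real q - 2) - (real q - 1) * z > 0" by (simp only: diff_gt_0_iff_gt)
    then have "quad q z - quad q 0 > 0" unfolding quad_diff using z by simp
    then have "quad q z > 1" by (simp add: quad_def)
    then have "real q / quad q z < real q" using q by (simp add: field_simps)
    then have "t * (real q / quad q z - \<beta>) < 0" using t eq by (simp add: mult_less_0_iff)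
    then show ?thesis using z by simp
  qed
  obtain z where z: "0 < z" "z < h" "free_energy q \<beta> (ray q 1 h) - free_energy q \<beta> (ray q 1 0)
      = (h - 0) * ((real q - 1) / (real q * \<beta>) * phi q \<beta> z)"
    using energy_ray_mvt[OF q1 b0, of 1 0 h] h q1 by auto
  have "(real q - 1) / (real q * \<beta>) > 0" using q b0 by simp
  then have "(h - 0) * ((real q - 1) / (real q * \<beta>) * phi q \<beta> z) < 0"
    using neg[of z] z(1,2) h by (intro mult_pos_neg) auto
  moreover have "near q \<epsilon> (ray q 1 0) (ray q 1 h)" using h by (intro near_ray[OF q1]) simp
  ultimately show False using min[OF ray_in_simplex[of 1 q h]] h z q1 by simp
qed

theorem local_minimizers_eq:
  assumes q: "q \<ge> 2" and \<beta>: "\<beta> > beta1 q"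
  shows "{x. local_minimizer q (free_energy q \<beta>) x} = m_point q \<beta> ` index_set q \<beta>"
proof (intro equalityI subsetI)
  have q1: "q \<ge> 1" using q by simp
  have b0: "\<beta> > 0" using beta1_gtD(1)[OF q \<beta>] .
  obtain s1 where s1: "0 < s1" "s1 < 1" "phi q \<beta> s1 < 0" using beta1_gtD(2)[OF q \<beta>] by blast
  fix x
  {
    assume "x \<in> {x. local_minimizer q (free_energy q \<beta>) x}"
    then have loc: "local_minimizer q (free_energy q \<beta>) x" by simp
    from local_minimizer_cases[OF q b0 loc] show "x \<in> m_point q \<beta> ` index_set q \<beta>"
    proof (elim disjE conjE bexE exE)
      assume x: "x = (\<lambda>k\<in>{1..q}. 1 / real q)" "\<beta> \<le> real q"
      then have "\<beta> < real q" using center_not_local_minimizer[OF q \<beta>] loc by (cases "\<beta> < real q") auto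
      then have "0 \<in> index_set q \<beta>" by (simp add: index_set_def)
      then show ?thesis using x(1) m_point_0[of q \<beta>] by (metis image_eqI)
    next
      fix i s assume s: "i \<in> {1..q}" "0 < s" "s < 1" "x = ray q i s" "phi q \<beta> s = 0"
      have "s_max q \<beta> = s"
        using s local_minimizer_ray_greatest[OF q b0 s(1-3) s(5)] loc by (intro s_max_eqI) auto
      then have "x = m_point q \<beta> i" using s m_point_ray[of i q \<beta>] by simp
      moreover have "i \<in> index_set q \<beta>" using s(1) by (auto simp: index_set_def)
      ultimately show ?thesis by blast
    qed
  }
  assume "x \<in> m_point q \<beta> ` index_set q \<beta>"
  then obtain i where i: "i \<in> index_set q \<beta>" "x = m_point q \<beta> i" by blast
  show "x \<in> {x. local_minimizer q (free_energy q \<beta>) x}"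
  proof (cases "i = 0")
    case True
    then have "\<beta> < real q" using i by (auto simp: index_set_def split: if_splits)
    then show ?thesis using local_minimizer_center[OF q1 b0] i True by (simp add: m_point_0)
  next
    case False
    then have "i \<in> {1..q}" using i by (auto simp: index_set_def split: if_splits)
    then show ?thesis using local_minimizer_m_point[OF q b0 s1] i False by (simp add: m_point_ray)
  qed
qed

lemma s_max_bounds:
  assumes "q \<ge> 2" "\<beta> > beta1 q" shows "0 < s_max q \<beta>" "s_max q \<beta> < 1"
  using s_max_crossing(1,2)[OF assms(1) beta1_gtD(1)[OF assms]] beta1_gtD(2)[OF assms]
  by (auto intro: less_trans)

lemma m_point_props:
  assumes q: "q \<ge> 2" and \<beta>: "\<beta> > beta1 q"
  shows "inj_on (m_point q \<beta>) (index_set q \<beta>)"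
    and "i \<in> index_set q \<beta> \<Longrightarrow> m_point q \<beta> i \<in> prob_simplex q"
    and "i \<in> index_set q \<beta> \<Longrightarrow> k \<in> {1..q} \<Longrightarrow> m_point q \<beta> i k > 0"
proof -
  note s = s_max_bounds[OF q \<beta>]
  have lt: "(1 - s_max q \<beta>) / real q < 1 / real q" "1 / real q < (1 + (real q - 1) * s_max q \<beta>) / real q"
    using s q by (auto simp: field_simps)
  show "inj_on (m_point q \<beta>) (index_set q \<beta>)"
  proof (rule inj_onI)
    fix i j assume i: "i \<in> index_set q \<beta>" and j: "j \<in> index_set q \<beta>" and e: "m_point q \<beta> i = m_point q \<beta> j"
    have ij: "i \<le> q" "j \<le> q" using i j by (auto simp: index_set_def split: if_splits)
    show "i = j"
      using fun_cong[OF e, of i] fun_cong[OF e, of j] lt ij unfolding m_point_def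
      by (cases "i = 0"; cases "j = 0") (auto split: if_splits)
  qed
  have loc: "local_minimizer q (free_energy q \<beta>) (m_point q \<beta> i)" if "i \<in> index_set q \<beta>"
    using local_minimizers_eq[OF q \<beta>] that by blast
  show "i \<in> index_set q \<beta> \<Longrightarrow> m_point q \<beta> i \<in> prob_simplex q"
    using loc by (simp add: local_minimizer_def)
  show "i \<in> index_set q \<beta> \<Longrightarrow> k \<in> {1..q} \<Longrightarrow> m_point q \<beta> i k > 0"
    using local_minimizer_pos[OF _ beta1_gtD(1)[OF q \<beta>] loc] q by simp
qed

section \<open>First visits of a finite Markov chain\<close>

text \<open>The first visit to \<open>A \<union> B\<close> after time \<open>0\<close> happens at time \<open>n + 1\<close> and is a visit to \<open>A\<close>.  These events
depend on finitely many coordinates and partition the event that \<open>A\<close> comes first.\<close>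

definition before_event :: "'s set \<Rightarrow> 's set \<Rightarrow> nat \<Rightarrow> (nat \<Rightarrow> 's) set" where
  "before_event A B n = {\<omega>. (\<forall>t\<in>{1..n}. \<omega> t \<notin> A \<union> B) \<and> \<omega> (Suc n) \<in> A}"

lemma return_time_less_iff:
  assumes "A \<inter> B = {}"
  shows "return_time A \<omega> < return_time B \<omega> \<longleftrightarrow> (\<exists>n. \<omega> \<in> before_event A B n)"
proof
  assume less: "return_time A \<omega> < return_time B \<omega>"
  let ?H = "{t. 0 < t \<and> \<omega> t \<in> A}"
  have "?H \<noteq> {}"
  proof
    assume "?H = {}"
    then have "return_time A \<omega> = \<infinity>"
      unfolding return_time_def by (simp only: image_empty Inf_empty top_enat_def)
    then show False using less by simp
  qed
  then obtain t where t: "t \<in> ?H" "\<And>s. s \<in> ?H \<Longrightarrow> t \<le> s"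
    using LeastI_ex[of "\<lambda>t. t \<in> ?H"] Least_le[of "\<lambda>t. t \<in> ?H"] by blast
  have rt: "return_time A \<omega> = enat t"
    unfolding return_time_def using t by (intro antisym INF_lower INF_greatest) auto
  have B: "\<omega> s \<notin> B" if "0 < s" "s \<le> t" for s
  proof
    assume "\<omega> s \<in> B"
    then have "return_time B \<omega> \<le> enat s"
      unfolding return_time_def using that by (intro INF_lower) auto
    also have "\<dots> \<le> enat t" using that by simp
    finally show False using less rt by simp
  qed
  have "\<omega> s \<notin> A \<union> B" if "s \<in> {1..t - 1}" for s
  proof -
    have "0 < s" "s < t" using that t(1) by auto
    then show ?thesis using t(2)[of s] B[of s] by auto
  qed
  moreover have "\<omega> (Suc (t - 1)) \<in> A" using t(1) by simp
  ultimately have "\<omega> \<in> before_event A B (t - 1)" unfolding before_event_def by blast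
  then show "\<exists>n. \<omega> \<in> before_event A B n" ..
next
  assume "\<exists>n. \<omega> \<in> before_event A B n"
  then obtain n where n: "\<omega> \<in> before_event A B n" ..
  have "return_time A \<omega> \<le> enat (Suc n)"
    unfolding return_time_def using n by (intro INF_lower) (auto simp: before_event_def)
  also have "\<dots> < enat (Suc (Suc n))" by simp
  also have "\<dots> \<le> return_time B \<omega>"
    unfolding return_time_def
  proof (rule INF_greatest)
    fix t assume t: "t \<in> {t. 0 < t \<and> \<omega> t \<in> B}"
    have "\<not> t \<le> n" using t n by (auto simp: before_event_def)
    moreover have "t \<noteq> Suc n" using t n assms by (auto simp: before_event_def)
    ultimately show "enat (Suc (Suc n)) \<le> enat t" by simp
  qed
  finally show "return_time A \<omega> < return_time B \<omega>" .
qed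

lemma before_event_disjoint: "disjoint_family (before_event A B)"
proof -
  have "before_event A B m \<inter> before_event A B n = {}" if "m < n" for m n
    using that unfolding before_event_def by (auto dest!: bspec[of _ _ "Suc m"])
  then show ?thesis
    unfolding disjoint_family_on_def by (metis Int_commute linorder_neqE_nat)
qed

text \<open>Sums over all paths of length \<open>n\<close>, where \<open>u\<close> is a weight for every state visited after time \<open>0\<close>.  The
last step can be summed out, which turns such a sum into the iterate of an operator on functions.\<close>

definition path_sum :: "'s set \<Rightarrow> 's pmf \<Rightarrow> ('s \<Rightarrow> 's pmf) \<Rightarrow> ('s \<Rightarrow> real) \<Rightarrow> nat \<Rightarrow> ('s \<Rightarrow> real) \<Rightarrow> real" where
  "path_sum S \<nu> K u n g = (\<Sum>x\<in>PiE {..n} (\<lambda>_. S).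
     pmf \<nu> (x 0) * (\<Prod>t<n. pmf (K (x t)) (x (Suc t)) * u (x (Suc t))) * g (x n))"

definition weighted_step :: "'s set \<Rightarrow> ('s \<Rightarrow> 's pmf) \<Rightarrow> ('s \<Rightarrow> real) \<Rightarrow> ('s \<Rightarrow> real) \<Rightarrow> 's \<Rightarrow> real" where
  "weighted_step S K u g x = (\<Sum>y\<in>S. pmf (K x) y * u y * g y)"

lemma sum_PiE_atMost_Suc:
  fixes F :: "(nat \<Rightarrow> 's) \<Rightarrow> real"
  assumes "finite S"
  shows "(\<Sum>x\<in>PiE {..Suc n} (\<lambda>_. S). F x) = (\<Sum>x\<in>PiE {..n} (\<lambda>_. S). \<Sum>y\<in>S. F (x(Suc n := y)))"
proof -
  have eq: "PiE {..Suc n} (\<lambda>_. S) = (\<lambda>(y, x). x(Suc n := y)) ` (S \<times> PiE {..n} (\<lambda>_. S))"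
    unfolding atMost_Suc by (rule PiE_insert_eq)
  have inj: "inj_on (\<lambda>(y, x). x(Suc n := y)) (S \<times> PiE {..n} (\<lambda>_. S))"
    by (rule inj_combinator) simp
  have "(\<Sum>x\<in>PiE {..Suc n} (\<lambda>_. S). F x) = (\<Sum>(y, x)\<in>S \<times> PiE {..n} (\<lambda>_. S). F (x(Suc n := y)))"
    unfolding eq by (subst sum.reindex[OF inj]) (simp add: case_prod_unfold o_def)
  also have "\<dots> = (\<Sum>y\<in>S. \<Sum>x\<in>PiE {..n} (\<lambda>_. S). F (x(Suc n := y)))"
    by (simp add: sum.cartesian_product)
  also have "\<dots> = (\<Sum>x\<in>PiE {..n} (\<lambda>_. S). \<Sum>y\<in>S. F (x(Suc n := y)))"
    by (rule sum.swap)
  finally show ?thesis .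
qed

lemma path_sum_Suc:
  assumes "finite S"
  shows "path_sum S \<nu> K u (Suc n) g = path_sum S \<nu> K u n (weighted_step S K u g)"
proof -
  have "(\<Prod>t<n. pmf (K ((x(Suc n := y)) t)) ((x(Suc n := y)) (Suc t)) * u ((x(Suc n := y)) (Suc t)))
      = (\<Prod>t<n. pmf (K (x t)) (x (Suc t)) * u (x (Suc t)))" for x and y :: 'a
    by (intro prod.cong) auto
  then show ?thesis
    unfolding path_sum_def weighted_step_def
    by (simp add: sum_PiE_atMost_Suc[OF assms] sum_distrib_left mult.assoc)
qed

lemma path_sum_0: 
  assumes "finite S"
  shows "path_sum S \<nu> K u 0 g = (\<Sum>x\<in>S. pmf \<nu> x * g x)"
proof -
  have eq: "PiE {..0::nat} (\<lambda>_. S) = (\<lambda>a. (\<lambda>i\<in>{0}. a)) ` S"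
  proof (intro equalityI subsetI)
    fix x assume "x \<in> PiE {..0::nat} (\<lambda>_. S)"
    then have "x 0 \<in> S" "x = (\<lambda>i\<in>{0}. x 0)" by (auto simp: PiE_iff extensional_def fun_eq_iff)
    then show "x \<in> (\<lambda>a. (\<lambda>i\<in>{0}. a)) ` S" by blast
  next
    fix x assume "x \<in> (\<lambda>a. (\<lambda>i\<in>{0::nat}. a)) ` S"
    then show "x \<in> PiE {..0::nat} (\<lambda>_. S)" by (auto simp: PiE_iff extensional_def)
  qed
  have inj: "inj_on (\<lambda>a. (\<lambda>i\<in>{0::nat}. a)) S"
    by (auto simp: inj_on_def fun_eq_iff split: if_splits)
  have "path_sum S \<nu> K u 0 g = (\<Sum>x\<in>(\<lambda>a. (\<lambda>i\<in>{0::nat}. a)) ` S. pmf \<nu> (x 0) * g (x 0))"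
    unfolding path_sum_def eq by simp
  also have "\<dots> = (\<Sum>a\<in>S. pmf \<nu> a * g a)"
    by (subst sum.reindex[OF inj]) simp
  finally show ?thesis .
qed

lemma path_sum_eq:
  assumes "finite S"
  shows "path_sum S \<nu> K u n g = (\<Sum>x\<in>S. pmf \<nu> x * ((weighted_step S K u ^^ n) g) x)"
  by (induction n arbitrary: g) (simp_all add: path_sum_0 path_sum_Suc assms funpow_swap1)

lemma weighted_step_1:
  assumes "finite S" "x \<in> S" "set_pmf (K x) \<subseteq> S"
  shows "weighted_step S K (\<lambda>_. 1) (\<lambda>_. 1) x = 1"
  using assms sum_pmf_eq_1[of S "K x"] by (simp add: weighted_step_def)

locale finite_chain =
  fixes S :: "'s set" and K :: "'s \<Rightarrow> 's pmf"
  assumes fin: "finite S" and closed: "\<And>x. x \<in> S \<Longrightarrow> set_pmf (K x) \<subseteq> S"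
begin

lemma path_sum_total:
  assumes "set_pmf \<nu> \<subseteq> S" shows "path_sum S \<nu> K (\<lambda>_. 1) n (\<lambda>_. 1) = 1"
proof (induction n)
  case 0
  then show ?case using assms fin by (simp add: path_sum_0 sum_pmf_eq_1)
next
  case (Suc n)
  have "path_sum S \<nu> K (\<lambda>_. 1) n (weighted_step S K (\<lambda>_. 1) (\<lambda>_. 1)) = path_sum S \<nu> K (\<lambda>_. 1) n (\<lambda>_. 1)"
    unfolding path_sum_def
    by (intro sum.cong refl arg_cong2[where f = "(*)"] weighted_step_1 fin closed) (auto simp: PiE_iff)
  with Suc show ?case by (simp add: path_sum_Suc fin)
qed

lemma prob_space_chain_law: "prob_space (chain_law \<nu> K)"
proof -
  interpret Ionescu_Tulcea "chain_step \<nu> K" "\<lambda>_. count_space UNIV"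
    by (rule Ionescu_Tulcea_chain_step)
  let ?M = "\<lambda>_::nat. count_space (UNIV :: 's set)"
  have "(\<lambda>x. restrict x {}) \<in> measurable PF.lim (PiM {} ?M)"
    by (simp add: measurable_cong_sets[OF PF.sets_lim refl])
  moreover have "prob_space (distr PF.lim (PiM {} ?M) (\<lambda>x. restrict x {}))"
    unfolding distr_lim[OF finite.emptyI] by (rule PF.prob_space_P) auto
  ultimately show ?thesis
    unfolding chain_law_def by (rule prob_space_distrD)
qed

lemma coordinate_set_measurable [measurable]:
  "{\<omega>. \<omega> t \<in> A} \<in> sets (chain_law \<nu> K)"
proof -
  have "(\<lambda>\<omega>. \<omega> t) -` A \<inter> space (PiM UNIV (\<lambda>_. count_space UNIV)) \<in> sets (PiM UNIV (\<lambda>_::nat. count_space (UNIV :: 's set)))"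
    by (rule measurable_sets[of _ _ "count_space UNIV"]) auto
  then show ?thesis by (simp add: sets_chain_law space_PiM vimage_def)
qed

lemma cylinder_measurable: "{\<omega>. \<forall>t\<le>n. \<omega> t = x t} \<in> sets (chain_law \<nu> K)"
proof -
  have "{\<omega>. \<forall>t\<le>n. \<omega> t = x t} = (\<Inter>t\<in>{..n}. {\<omega>. \<omega> t \<in> {x t}})" by auto
  also have "\<dots> \<in> sets (chain_law \<nu> K)"
    by (intro sets.finite_INT coordinate_set_measurable) auto
  finally show ?thesis .
qed

lemma before_event_measurable: "before_event A B n \<in> sets (chain_law \<nu> K)"
proof -
  have "before_event A B n = (\<Inter>t\<in>{..n}. {\<omega>. \<omega> t \<in> (if t = 0 then UNIV else - (A \<union> B))}) \<inter> {\<omega>. \<omega> (Suc n) \<in> A}"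
    (is "_ = ?R")
  proof (intro equalityI subsetI)
    fix \<omega> assume "\<omega> \<in> ?R"
    then have "\<omega> t \<in> - (A \<union> B)" if "t \<in> {1..n}" for t using that by (auto dest!: bspec[of _ _ t] simp del: Compl_Un)
    with \<open>\<omega> \<in> ?R\<close> show "\<omega> \<in> before_event A B n" by (auto simp: before_event_def)
  qed (auto simp: before_event_def)
  also have "\<dots> \<in> sets (chain_law \<nu> K)"
    by (intro sets.Int sets.finite_INT coordinate_set_measurable) auto
  finally show ?thesis .
qed

lemma measure_cylinder:
  "measure (chain_law \<nu> K) {\<omega>. \<forall>t\<le>n. \<omega> t = x t} = pmf \<nu> (x 0) * (\<Prod>t<n. pmf (K (x t)) (x (Suc t)))"
  using chain_law_cylinder[of \<nu> K n x] by (simp add: measure_def prod_nonneg)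

lemma cylinders_disjoint:
  "disjoint_family_on (\<lambda>x. {\<omega>. \<forall>t\<le>n. \<omega> t = x t}) (PiE {..n} (\<lambda>_. S))"
  unfolding disjoint_family_on_def
proof (intro ballI impI)
  fix x y assume "x \<in> PiE {..n} (\<lambda>_. S)" "y \<in> PiE {..n} (\<lambda>_. S)" "x \<noteq> y"
  then obtain t where "t \<le> n" "x t \<noteq> y t"
    using PiE_ext[of x "{..n}" "\<lambda>_. S" y] by auto
  then show "{\<omega>. \<forall>t\<le>n. \<omega> t = x t} \<inter> {\<omega>. \<forall>t\<le>n. \<omega> t = y t} = {}" by force
qed

text \<open>The cylinders of paths inside the finite set \<open>S\<close> already have total mass \<open>1\<close>, so nothing is lost by
intersecting with them, although the type of states may be uncountable.\<close>

lemma measure_chain_law_eq_sum: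
  assumes \<nu>: "set_pmf \<nu> \<subseteq> S" and E: "E \<in> sets (chain_law \<nu> K)"
    and dep: "\<And>\<omega> \<omega>'. (\<forall>t\<le>n. \<omega> t = \<omega>' t) \<Longrightarrow> \<omega> \<in> E \<Longrightarrow> \<omega>' \<in> E"
  shows "measure (chain_law \<nu> K) E = (\<Sum>x\<in>PiE {..n} (\<lambda>_. S).
     pmf \<nu> (x 0) * (\<Prod>t<n. pmf (K (x t)) (x (Suc t))) * indicator E x)"
proof -
  interpret prob_space "chain_law \<nu> K" by (rule prob_space_chain_law)
  let ?I = "PiE {..n} (\<lambda>_. S)" and ?C = "\<lambda>x. {\<omega>. \<forall>t\<le>n. \<omega> t = x t}"
  have fI: "finite ?I" using fin by (intro finite_PiE) auto
  have U: "(\<Union>x\<in>?I. ?C x) \<in> sets (chain_law \<nu> K)"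
    using fI cylinder_measurable by (intro sets.finite_UN) auto
  have "prob (\<Union>x\<in>?I. ?C x) = (\<Sum>x\<in>?I. prob (?C x))"
    using fI cylinder_measurable cylinders_disjoint by (intro finite_measure_finite_Union) auto
  also have "\<dots> = 1"
    using path_sum_total[OF \<nu>, of n] by (simp add: path_sum_def measure_cylinder)
  finally have full: "prob (\<Union>x\<in>?I. ?C x) = 1" .
  have "prob E = prob (E \<inter> (\<Union>x\<in>?I. ?C x))"
    using E U full by (intro finite_measure_eq_AE) (auto simp: prob_eq_1[OF U])
  also have "E \<inter> (\<Union>x\<in>?I. ?C x) = (\<Union>x\<in>?I. E \<inter> ?C x)" by blast
  also have "prob \<dots> = (\<Sum>x\<in>?I. prob (E \<inter> ?C x))"
  proof (rule finite_measure_finite_Union[OF fI])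
    show "disjoint_family_on (\<lambda>x. E \<inter> ?C x) ?I"
      by (rule disjoint_family_on_bisimulation[OF cylinders_disjoint[of n]]) blast
  qed (use cylinder_measurable E in auto)
  also have "\<dots> = (\<Sum>x\<in>?I. prob (?C x) * indicator E x)"
  proof (intro sum.cong refl)
    fix x
    show "prob (E \<inter> ?C x) = prob (?C x) * indicator E x"
    proof (cases "x \<in> E")
      case True
      then have "E \<inter> ?C x = ?C x" using dep[of x] by auto
      then show ?thesis using True by simp
    next
      case False
      then have "E \<inter> ?C x = {}" using dep[of _ x] by auto
      then show ?thesis using False by simp
    qed
  qed
  finally show ?thesis by (simp add: measure_cylinder)
qed

text \<open>As a function of the starting point, the probability of \<open>before_event A B n\<close>.\<close>

definition hit_term :: "'s set \<Rightarrow> 's set \<Rightarrow> nat \<Rightarrow> 's \<Rightarrow> real" where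
  "hit_term A B n = (weighted_step S K (indicator (- (A \<union> B))) ^^ n) (weighted_step S K (\<lambda>_. 1) (indicator A))"

lemma measure_before_event:
  assumes \<nu>: "set_pmf \<nu> \<subseteq> S"
  shows "measure (chain_law \<nu> K) (before_event A B n) = (\<Sum>x\<in>S. pmf \<nu> x * hit_term A B n x)"
proof -
  have "measure (chain_law \<nu> K) (before_event A B n) = (\<Sum>x\<in>PiE {..Suc n} (\<lambda>_. S).
     pmf \<nu> (x 0) * (\<Prod>t<Suc n. pmf (K (x t)) (x (Suc t))) * indicator (before_event A B n) x)"
    by (rule measure_chain_law_eq_sum[OF \<nu> before_event_measurable])
      (auto simp: before_event_def)
  also have "\<dots> = (\<Sum>x\<in>PiE {..n} (\<lambda>_. S). \<Sum>y\<in>S.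
     pmf \<nu> (x 0) * (\<Prod>t<n. pmf (K (x t)) (x (Suc t)) * indicator (- (A \<union> B)) (x (Suc t))) * (pmf (K (x n)) y * indicator A y))"
    unfolding sum_PiE_atMost_Suc[OF fin]
  proof (intro sum.cong refl)
    fix x and y :: 's
    let ?z = "x(Suc n := y)"
    have ind: "indicator (before_event A B n) ?z = (\<Prod>t<n. indicator (- (A \<union> B)) (x (Suc t)) :: real) * indicator A y"
    proof (cases "\<forall>t<n. x (Suc t) \<notin> A \<union> B")
      case True
      then have "(\<forall>t\<in>{1..n}. x t \<notin> A \<union> B)"
      proof (intro ballI)
        fix t assume "t \<in> {1..n}"
        then have "t = Suc (t - 1)" "t - 1 < n" by auto
        with True show "x t \<notin> A \<union> B" by metis
      qed
      then show ?thesis using True by (auto simp: before_event_def indicator_def)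
    next
      case False
      then obtain t where t: "t < n" "x (Suc t) \<in> A \<union> B" by blast
      then have "?z \<notin> before_event A B n" by (auto simp: before_event_def dest: bspec[of _ _ "Suc t"])
      moreover have "(\<Prod>t<n. indicator (- (A \<union> B)) (x (Suc t)) :: real) = 0"
        using t by (intro prod_zero bexI[of _ t]) auto
      ultimately show ?thesis by simp
    qed
    have "(\<Prod>t<n. pmf (K (?z t)) (?z (Suc t))) = (\<Prod>t<n. pmf (K (x t)) (x (Suc t)))"
      by (intro prod.cong) auto
    then show "pmf \<nu> (?z 0) * (\<Prod>t<Suc n. pmf (K (?z t)) (?z (Suc t))) * indicator (before_event A B n) ?z
      = pmf \<nu> (x 0) * (\<Prod>t<n. pmf (K (x t)) (x (Suc t)) * indicator (- (A \<union> B)) (x (Suc t))) * (pmf (K (x n)) y * indicator A y)"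
      unfolding ind by (simp add: prod.distrib ac_simps)
  qed
  also have "\<dots> = path_sum S \<nu> K (indicator (- (A \<union> B))) n (weighted_step S K (\<lambda>_. 1) (indicator A))"
    unfolding path_sum_def weighted_step_def by (simp add: sum_distrib_left)
  finally show ?thesis by (simp add: path_sum_eq[OF fin] hit_term_def)
qed

definition hit_prob :: "'s set \<Rightarrow> 's set \<Rightarrow> 's \<Rightarrow> real" where
  "hit_prob A B x = (\<Sum>n. hit_term A B n x)"

lemma hit_term_sums:
  assumes "A \<inter> B = {}" "set_pmf \<nu> \<subseteq> S"
  shows "(\<lambda>n. \<Sum>x\<in>S. pmf \<nu> x * hit_term A B n x) sums prob_before \<nu> K A B"
proof -
  interpret prob_space "chain_law \<nu> K" by (rule prob_space_chain_law)
  have "{\<omega> \<in> space (chain_law \<nu> K). return_time A \<omega> < return_time B \<omega>} = (\<Union>n. before_event A B n)"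
    by (auto simp: space_chain_law return_time_less_iff[OF assms(1)])
  moreover have "(\<lambda>n. prob (before_event A B n)) sums prob (\<Union>n. before_event A B n)"
    using before_event_measurable before_event_disjoint by (intro finite_measure_UNION) auto
  ultimately show ?thesis
    unfolding prob_before_def measure_before_event[OF assms(2)] by simp
qed

lemma summable_hit_term:
  assumes "A \<inter> B = {}" "x \<in> S" shows "summable (\<lambda>n. hit_term A B n x)"
proof -
  have "(\<Sum>y\<in>S. pmf (return_pmf x) y * hit_term A B n y) = hit_term A B n x" for n
  proof -
    have "(\<Sum>y\<in>S. pmf (return_pmf x) y * hit_term A B n y) = (\<Sum>y\<in>S. if y = x then hit_term A B n y else 0)"
      by (intro sum.cong) auto
    then show ?thesis using assms(2) fin by simp
  qed
  then show ?thesis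
    using hit_term_sums[OF assms(1), of "return_pmf x"] assms(2) by (simp add: sums_iff)
qed

lemma prob_before_eq:
  assumes "A \<inter> B = {}" "set_pmf \<nu> \<subseteq> S"
  shows "prob_before \<nu> K A B = (\<Sum>x\<in>S. pmf \<nu> x * hit_prob A B x)"
proof -
  have "prob_before \<nu> K A B = (\<Sum>n. \<Sum>x\<in>S. pmf \<nu> x * hit_term A B n x)"
    using hit_term_sums[OF assms] by (simp add: sums_iff)
  also have "\<dots> = (\<Sum>x\<in>S. \<Sum>n. pmf \<nu> x * hit_term A B n x)"
    using summable_hit_term[OF assms(1)] by (intro suminf_sum summable_mult)
  finally show ?thesis
    using summable_hit_term[OF assms(1)] by (simp add: hit_prob_def suminf_mult)
qed

text \<open>The equilibrium potential: the probability that \<open>A\<close> is reached before \<open>B\<close> when time \<open>0\<close> counts as well,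
in contrast to \<open>hit_prob\<close>, which is about return times.\<close>

definition eq_potential :: "'s set \<Rightarrow> 's set \<Rightarrow> 's \<Rightarrow> real" where
  "eq_potential A B x = (if x \<in> A then 1 else if x \<in> B then 0 else hit_prob A B x)"

text \<open>Together with \<open>prob_before_eq\<close>, this is all that the capacity estimates use about the path measure.\<close>

lemma hit_prob_first_step:
  assumes "A \<inter> B = {}" "x \<in> S"
  shows "hit_prob A B x = (\<Sum>y\<in>S. pmf (K x) y * eq_potential A B y)"
proof -
  have T: "hit_term A B (Suc n) x = (\<Sum>y\<in>S. pmf (K x) y * indicator (- (A \<union> B)) y * hit_term A B n y)" for n
    by (simp add: hit_term_def weighted_step_def)
  have "hit_prob A B x = (\<Sum>n. hit_term A B (Suc n) x) + hit_term A B 0 x"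
    unfolding hit_prob_def using suminf_split_head[OF summable_hit_term[OF assms]] by simp
  also have "(\<Sum>n. hit_term A B (Suc n) x) = (\<Sum>y\<in>S. \<Sum>n. pmf (K x) y * indicator (- (A \<union> B)) y * hit_term A B n y)"
    unfolding T using summable_hit_term[OF assms(1)] by (intro suminf_sum summable_mult)
  also have "\<dots> = (\<Sum>y\<in>S. pmf (K x) y * indicator (- (A \<union> B)) y * hit_prob A B y)"
    unfolding hit_prob_def using summable_hit_term[OF assms(1)] by (intro sum.cong suminf_mult) auto
  also have "hit_term A B 0 x = (\<Sum>y\<in>S. pmf (K x) y * indicator A y)"
    by (simp add: hit_term_def weighted_step_def)
  finally show ?thesis
    unfolding sum.distrib[symmetric] eq_potential_def
    by (simp only:) (intro sum.cong refl, auto simp: indicator_def)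
qed

end

section \<open>Capacities and flows of a reversible chain\<close>

locale reversible_chain = finite_chain S K for S :: "'s set" and K +
  fixes \<mu> :: "'s pmf"
  assumes support: "set_pmf \<mu> = S"
    and balance: "\<And>x y. x \<in> S \<Longrightarrow> y \<in> S \<Longrightarrow> pmf \<mu> x * pmf (K x) y = pmf \<mu> y * pmf (K y) x"
begin

definition conduct :: "'s \<Rightarrow> 's \<Rightarrow> real" where "conduct x y = pmf \<mu> x * pmf (K x) y"

lemma conduct_sym: "x \<in> S \<Longrightarrow> y \<in> S \<Longrightarrow> conduct x y = conduct y x"
  unfolding conduct_def by (rule balance)

lemma conduct_nonneg: "conduct x y \<ge> 0"
  by (simp add: conduct_def)

definition dirichlet :: "('s \<Rightarrow> real) \<Rightarrow> ('s \<Rightarrow> real) \<Rightarrow> real" where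
  "dirichlet g h = 1/2 * (\<Sum>x\<in>S. \<Sum>y\<in>S. conduct x y * ((g x - g y) * (h x - h y)))"

lemma sum_K: "x \<in> S \<Longrightarrow> (\<Sum>y\<in>S. pmf (K x) y) = 1"
  using fin closed by (intro sum_pmf_eq_1) auto

text \<open>Summation by parts; reversibility enters as the symmetry of the conductances.\<close>

lemma dirichlet_eq:
  "dirichlet g h = (\<Sum>x\<in>S. pmf \<mu> x * g x * (h x - (\<Sum>y\<in>S. pmf (K x) y * h y)))"
proof -
  have "(\<Sum>x\<in>S. pmf \<mu> x * g x * (h x - (\<Sum>y\<in>S. pmf (K x) y * h y)))
      = (\<Sum>x\<in>S. \<Sum>y\<in>S. conduct x y * (g x * (h x - h y)))" (is "?L = ?A")
  proof (intro sum.cong refl)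
    fix x assume x: "x \<in> S"
    have "h x - (\<Sum>y\<in>S. pmf (K x) y * h y) = (\<Sum>y\<in>S. pmf (K x) y * (h x - h y))"
      using sum_K[OF x] by (simp add: right_diff_distrib sum_subtractf flip: sum_distrib_right)
    then show "pmf \<mu> x * g x * (h x - (\<Sum>y\<in>S. pmf (K x) y * h y)) = (\<Sum>y\<in>S. conduct x y * (g x * (h x - h y)))"
      by (simp add: conduct_def sum_distrib_left mult.assoc mult.left_commute)
  qed
  moreover have "?A = (\<Sum>x\<in>S. \<Sum>y\<in>S. conduct x y * (g y * (h y - h x)))"
    by (subst sum.swap) (intro sum.cong refl, simp add: conduct_sym)
  ultimately have "2 * ?L = (\<Sum>x\<in>S. \<Sum>y\<in>S. conduct x y * (g x * (h x - h y)))
     + (\<Sum>x\<in>S. \<Sum>y\<in>S. conduct x y * (g y * (h y - h x)))" by simp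
  also have "\<dots> = 2 * dirichlet g h"
    unfolding dirichlet_def sum.distrib[symmetric] by (simp add: algebra_simps)
  finally show ?thesis by simp
qed

lemma dirichlet_nonneg: "dirichlet g g \<ge> 0"
  unfolding dirichlet_def by (intro mult_nonneg_nonneg sum_nonneg conduct_nonneg zero_le_square) simp

text \<open>The mass that leaves \<open>B\<close> in stationarity and reaches \<open>A\<close> before it returns.\<close>

definition capac :: "'s set \<Rightarrow> 's set \<Rightarrow> real" where
  "capac A B = (\<Sum>x\<in>B. pmf \<mu> x * hit_prob A B x)"

text \<open>The potential is harmonic outside \<open>A \<union> B\<close>, so the energy pairing only sees the values of \<open>g\<close> on \<open>A\<close> and
\<open>B\<close>.  Taking \<open>g\<close> constant shows that the flux out of \<open>A\<close> equals the flux into \<open>B\<close>.\<close>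

lemma dirichlet_eq_potential:
  assumes AB: "A \<inter> B = {}" "A \<subseteq> S" "B \<subseteq> S"
    and g: "\<And>x. x \<in> A \<Longrightarrow> g x = 1" "\<And>x. x \<in> B \<Longrightarrow> g x = 0"
  shows "dirichlet g (eq_potential A B) = capac A B"
proof -
  let ?h = "eq_potential A B"
  let ?r = "\<lambda>x. ?h x - hit_prob A B x"
  have D: "dirichlet g ?h = (\<Sum>x\<in>S. pmf \<mu> x * g x * ?r x)" for g
    unfolding dirichlet_eq using hit_prob_first_step[OF AB(1)] by (intro sum.cong) auto
  have r: "?r x = 0" if "x \<notin> A \<union> B" for x using that by (simp add: eq_potential_def)
  have rB: "?r x = - hit_prob A B x" if "x \<in> B" for x using that AB by (auto simp: eq_potential_def)
  have "0 = dirichlet (\<lambda>_. 1) ?h" by (simp add: dirichlet_def)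
  also have "\<dots> = (\<Sum>x\<in>A \<union> B. pmf \<mu> x * ?r x)"
    unfolding D using AB r fin by (intro sum.mono_neutral_cong_right) auto
  also have "\<dots> = (\<Sum>x\<in>A. pmf \<mu> x * ?r x) + (\<Sum>x\<in>B. pmf \<mu> x * ?r x)"
    using AB fin by (intro sum.union_disjoint) (auto intro: finite_subset)
  also have "(\<Sum>x\<in>B. pmf \<mu> x * ?r x) = - capac A B"
    unfolding capac_def sum_negf[symmetric] by (intro sum.cong) (auto simp: rB)
  finally have "capac A B = (\<Sum>x\<in>A. pmf \<mu> x * ?r x)" by simp
  also have "\<dots> = dirichlet g ?h"
  proof -
    have "pmf \<mu> x * g x * ?r x = 0" if "x \<in> S - A" for x
      using that r[of x] g(2)[of x] by (cases "x \<in> B") auto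
    then show ?thesis unfolding D using AB g fin by (intro sum.mono_neutral_cong_left) auto
  qed
  finally show ?thesis by simp
qed

lemma capac_eq_dirichlet:
  assumes "A \<inter> B = {}" "A \<subseteq> S" "B \<subseteq> S"
  shows "capac A B = dirichlet (eq_potential A B) (eq_potential A B)"
  by (rule dirichlet_eq_potential[OF assms, symmetric]) (use assms in \<open>auto simp: eq_potential_def\<close>)

text \<open>The Dirichlet principle: the difference of \<open>g\<close> and the equilibrium potential has nonnegative energy and is orthogonal
to the equilibrium potential.\<close>

lemma capac_le_dirichlet:
  assumes "A \<inter> B = {}" "A \<subseteq> S" "B \<subseteq> S"
    and "\<And>x. x \<in> A \<Longrightarrow> g x = 1" "\<And>x. x \<in> B \<Longrightarrow> g x = 0"
  shows "capac A B \<le> dirichlet g g"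
proof -
  let ?h = "eq_potential A B"
  have "0 \<le> dirichlet (\<lambda>x. g x - ?h x) (\<lambda>x. g x - ?h x)" by (rule dirichlet_nonneg)
  also have "\<dots> = dirichlet g g - 2 * dirichlet g ?h + dirichlet ?h ?h"
  proof -
    have "(\<Sum>x\<in>S. \<Sum>y\<in>S. conduct x y * ((g x - ?h x - (g y - ?h y)) * (g x - ?h x - (g y - ?h y))))
      = (\<Sum>x\<in>S. \<Sum>y\<in>S. conduct x y * ((g x - g y) * (g x - g y)) - 2 * (conduct x y * ((g x - g y) * (?h x - ?h y)))
          + conduct x y * ((?h x - ?h y) * (?h x - ?h y)))"
      by (intro sum.cong refl) (simp add: algebra_simps)
    then show ?thesis
      unfolding dirichlet_def by (simp add: sum.distrib sum_subtractf flip: sum_distrib_left)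
  qed
  finally show ?thesis
    using dirichlet_eq_potential[OF assms] capac_eq_dirichlet[OF assms(1-3)] by simp
qed

lemma prob_before_cond:
  assumes "A \<inter> B = {}" "B \<subseteq> S" "B \<noteq> {}"
  shows "prob_before (cond_pmf \<mu> B) K A B = capac A B / measure \<mu> B"
proof -
  have ne: "set_pmf \<mu> \<inter> B \<noteq> {}" using assms support by auto
  have "prob_before (cond_pmf \<mu> B) K A B = (\<Sum>x\<in>S. pmf (cond_pmf \<mu> B) x * hit_prob A B x)"
    using assms by (intro prob_before_eq) (auto simp: set_cond_pmf[OF ne])
  also have "\<dots> = (\<Sum>x\<in>B. pmf \<mu> x / measure \<mu> B * hit_prob A B x)"
    using assms fin by (intro sum.mono_neutral_cong_right) (auto simp: pmf_cond[OF ne])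
  finally show ?thesis by (simp add: capac_def sum_divide_distrib)
qed

abbreviation total :: "('s \<Rightarrow> real) \<Rightarrow> real" where "total \<theta> \<equiv> \<Sum>x\<in>S. \<theta> x"

abbreviation pairing :: "('s \<Rightarrow> real) \<Rightarrow> ('s \<Rightarrow> real) \<Rightarrow> real" where
  "pairing \<theta> h \<equiv> \<Sum>x\<in>S. \<theta> x * h x"

abbreviation escape_prob :: "'s set \<Rightarrow> 's set \<Rightarrow> real" where
  "escape_prob A B \<equiv> prob_before (cond_pmf \<mu> B) K A B"

text \<open>If a density \<open>\<theta>\<close> is carried to \<open>\<theta>'\<close> by a flow \<open>\<phi>\<close> that is dominated by the conductances, then the mean
of \<open>h\<close> cannot grow much unless \<open>h\<close> has large energy: this is the Cauchy-Schwarz inequality with weight \<open>\<phi>\<close>.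
Applied to the equilibrium potential along a path from \<open>B\<close> to \<open>A\<close>, it gives lower bounds on capacities.\<close>

lemma flow_step_le:
  assumes \<phi>: "\<And>x y. x \<in> S \<Longrightarrow> y \<in> S \<Longrightarrow> 0 \<le> \<phi> x y \<and> \<phi> x y \<le> \<kappa> * conduct x y"
    and \<kappa>: "\<kappa> \<ge> 0"
    and rows: "\<And>x. x \<in> S \<Longrightarrow> (\<Sum>y\<in>S. \<phi> x y) = \<theta> x" and cols: "\<And>y. y \<in> S \<Longrightarrow> (\<Sum>x\<in>S. \<phi> x y) = \<theta>' y"
  shows "pairing \<theta>' h - pairing \<theta> h \<le> sqrt (2 * total \<theta> * \<kappa> * dirichlet h h)"
proof -
  let ?P = "S \<times> S"
  let ?d = "\<lambda>(x, y). h y - h x"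
  let ?f = "\<lambda>(x, y). \<phi> x y"
  have 1: "(\<Sum>p\<in>?P. (sqrt (?f p))\<^sup>2) = (\<Sum>x\<in>S. \<theta> x)"
  proof -
    have "(\<Sum>p\<in>?P. (sqrt (?f p))\<^sup>2) = (\<Sum>p\<in>?P. ?f p)"
      using \<phi> by (intro sum.cong) auto
    then show ?thesis by (simp add: sum.cartesian_product[symmetric] rows)
  qed
  have "(\<Sum>p\<in>?P. (sqrt (?f p) * ?d p)\<^sup>2)
      \<le> (\<Sum>(x, y)\<in>?P. \<kappa> * (conduct x y * ((h x - h y) * (h x - h y))))"
  proof (intro sum_mono)
    fix p assume "p \<in> ?P"
    then obtain x y where p: "p = (x, y)" "x \<in> S" "y \<in> S" by auto
    have "(sqrt (?f p) * ?d p)\<^sup>2 = \<phi> x y * (h x - h y)\<^sup>2"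
      using \<phi>[OF p(2,3)] by (simp add: p power_mult_distrib power2_commute)
    also have "\<dots> \<le> \<kappa> * conduct x y * (h x - h y)\<^sup>2"
      using \<phi>[OF p(2,3)] by (intro mult_right_mono) auto
    finally show "(sqrt (?f p) * ?d p)\<^sup>2 \<le> (case p of (x, y) \<Rightarrow> \<kappa> * (conduct x y * ((h x - h y) * (h x - h y))))"
      by (simp add: p mult.assoc power2_eq_square)
  qed
  also have "\<dots> = 2 * \<kappa> * dirichlet h h"
    by (simp add: dirichlet_def sum.cartesian_product[symmetric] flip: sum_distrib_left)
  finally have 2: "(\<Sum>p\<in>?P. (sqrt (?f p) * ?d p)\<^sup>2) \<le> 2 * \<kappa> * dirichlet h h" .
  have "pairing \<theta>' h - pairing \<theta> h
      = (\<Sum>y\<in>S. \<Sum>x\<in>S. \<phi> x y * h y) - (\<Sum>x\<in>S. \<Sum>y\<in>S. \<phi> x y * h x)"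
    by (simp add: rows cols flip: sum_distrib_right)
  also have "(\<Sum>y\<in>S. \<Sum>x\<in>S. \<phi> x y * h y) = (\<Sum>x\<in>S. \<Sum>y\<in>S. \<phi> x y * h y)" by (rule sum.swap)
  also have "\<dots> - (\<Sum>x\<in>S. \<Sum>y\<in>S. \<phi> x y * h x) = (\<Sum>x\<in>S. \<Sum>y\<in>S. \<phi> x y * (h y - h x))"
    by (simp add: right_diff_distrib sum_subtractf)
  also have "\<dots> = (\<Sum>p\<in>?P. ?f p * ?d p)"
    unfolding sum.cartesian_product by (intro sum.cong) auto
  also have "\<dots> = (\<Sum>p\<in>?P. sqrt (?f p) * (sqrt (?f p) * ?d p))"
    using \<phi> by (intro sum.cong refl) (auto simp flip: mult.assoc)
  also have "\<dots> \<le> sqrt ((\<Sum>p\<in>?P. (sqrt (?f p))\<^sup>2) * (\<Sum>p\<in>?P. (sqrt (?f p) * ?d p)\<^sup>2))"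
    by (intro real_le_rsqrt Cauchy_Schwarz_ineq_sum)
  also have "\<dots> \<le> sqrt ((\<Sum>p\<in>?P. (sqrt (?f p))\<^sup>2) * (2 * \<kappa> * dirichlet h h))"
    using 2 by (intro real_sqrt_le_mono mult_left_mono sum_nonneg) auto
  finally show ?thesis unfolding 1 by (simp add: mult_ac)
qed

end

section \<open>Vectors of spin counts and their cells\<close>

definition count_vec :: "nat \<Rightarrow> nat \<Rightarrow> (nat \<Rightarrow> nat) \<Rightarrow> nat \<Rightarrow> nat" where
  "count_vec q N \<sigma> = (\<lambda>k\<in>{1..q}. card {i\<in>{1..N}. \<sigma> i = k})"

definition types :: "nat \<Rightarrow> nat \<Rightarrow> (nat \<Rightarrow> nat) set" where
  "types q N = {c \<in> {1..q} \<rightarrow>\<^sub>E {0..N}. (\<Sum>k\<in>{1..q}. c k) = N}"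

definition freq :: "nat \<Rightarrow> nat \<Rightarrow> (nat \<Rightarrow> nat) \<Rightarrow> nat \<Rightarrow> real" where
  "freq q N c = (\<lambda>k\<in>{1..q}. real (c k) / real N)"

definition cell :: "nat \<Rightarrow> nat \<Rightarrow> (nat \<Rightarrow> nat) \<Rightarrow> (nat \<Rightarrow> nat) set" where
  "cell q N c = {\<sigma> \<in> configs q N. count_vec q N \<sigma> = c}"

definition move :: "nat \<Rightarrow> nat \<Rightarrow> (nat \<Rightarrow> nat) \<Rightarrow> nat \<Rightarrow> nat" where
  "move a b c = c(a := c a - 1, b := c b + 1)"

text \<open>The set \<open>V\<close> will consist of the count vectors below a given level of the free energy.\<close>

definition type_edges :: "nat \<Rightarrow> (nat \<Rightarrow> nat) set \<Rightarrow> ((nat \<Rightarrow> nat) \<times> (nat \<Rightarrow> nat)) set" where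
  "type_edges q V = {(c, c'). c \<in> V \<and> c' \<in> V \<and>
     (\<exists>a\<in>{1..q}. \<exists>b\<in>{1..q}. a \<noteq> b \<and> 0 < c a \<and> c' = move a b c)}"

lemma typesI:
  assumes "c \<in> extensional {1..q}" "(\<Sum>k\<in>{1..q}. c k) = N" shows "c \<in> types q N"
proof -
  have "c k \<le> N" if "k \<in> {1..q}" for k
    using member_le_sum[of k "{1..q}" c] assms that by simp
  with assms show ?thesis by (auto simp: types_def PiE_iff)
qed

lemma typesD:
  assumes "c \<in> types q N"
  shows "c \<in> extensional {1..q}" "(\<Sum>k\<in>{1..q}. c k) = N" "k \<in> {1..q} \<Longrightarrow> c k \<le> N"
  using assms by (auto simp: types_def PiE_iff)

lemma finite_types: "finite (types q N)" and card_types: "card (types q N) \<le> (N + 1) ^ q"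
proof -
  have fin: "finite ({1..q} \<rightarrow>\<^sub>E {0..N})" by (intro finite_PiE) auto
  have sub: "types q N \<subseteq> {1..q} \<rightarrow>\<^sub>E {0..N}" by (auto simp: types_def)
  show "finite (types q N)" using finite_subset[OF sub fin] .
  show "card (types q N) \<le> (N + 1) ^ q" using card_mono[OF fin sub] by (simp add: card_PiE)
qed

lemma count_vec_types:
  assumes "\<sigma> \<in> configs q N" shows "count_vec q N \<sigma> \<in> types q N"
proof (rule typesI)
  have "(\<Sum>k\<in>{1..q}. card {i\<in>{1..N}. \<sigma> i = k}) = card (\<Union>k\<in>{1..q}. {i\<in>{1..N}. \<sigma> i = k})"
    by (intro card_UN_disjoint[symmetric]) auto
  also have "(\<Union>k\<in>{1..q}. {i\<in>{1..N}. \<sigma> i = k}) = {1..N}"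
    using assms by (auto simp: configs_def PiE_iff)
  finally show "(\<Sum>k\<in>{1..q}. count_vec q N \<sigma> k) = N" by (simp add: count_vec_def)
qed (simp add: count_vec_def)

lemma empirical_freq: "empirical q N \<sigma> = freq q N (count_vec q N \<sigma>)"
proof
  fix k
  have "(\<Sum>i\<in>{1..N}. of_bool (\<sigma> i = k) :: real) = real (card {i\<in>{1..N}. \<sigma> i = k})"
    by (simp add: of_bool_def sum.If_cases Int_def)
  then show "empirical q N \<sigma> k = freq q N (count_vec q N \<sigma>) k"
    by (simp add: empirical_def freq_def count_vec_def)
qed

lemma freq_inj:
  assumes "N > 0" shows "inj_on (freq q N) (types q N)"
proof (rule inj_onI)
  fix c d assume c: "c \<in> types q N" and d: "d \<in> types q N" and e: "freq q N c = freq q N d"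
  show "c = d"
  proof (rule extensionalityI[OF typesD(1)[OF c] typesD(1)[OF d]])
    show "c k = d k" if "k \<in> {1..q}" for k
      using fun_cong[OF e, of k] that assms by (auto simp: freq_def)
  qed
qed

lemma freq_simplex:
  assumes "N > 0" "c \<in> types q N" shows "freq q N c \<in> prob_simplex q"
proof (rule simplexI)
  show "(\<Sum>k\<in>{1..q}. freq q N c k) = 1"
    using typesD(2)[OF assms(2)] assms(1)
    by (simp add: freq_def flip: sum_divide_distrib of_nat_sum)
qed (auto simp: freq_def)

lemma lattice_simplex_eq:
  assumes N: "N > 0" shows "lattice_simplex q N = freq q N ` types q N"
proof (intro equalityI subsetI)
  fix x assume x: "x \<in> lattice_simplex q N"
  then have P: "x \<in> prob_simplex q" and "\<forall>k\<in>{1..q}. \<exists>n::nat. x k = real n / real N"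
    by (auto simp: lattice_simplex_def)
  then obtain f :: "nat \<Rightarrow> nat" where f: "\<And>k. k \<in> {1..q} \<Longrightarrow> x k = real (f k) / real N" by metis
  let ?c = "restrict f {1..q}"
  have "real (\<Sum>k\<in>{1..q}. f k) / real N = (\<Sum>k\<in>{1..q}. x k)"
    by (simp add: f sum_divide_distrib)
  then have "real (\<Sum>k\<in>{1..q}. f k) = real N" using simplexD(3)[OF P] N by simp
  then have "(\<Sum>k\<in>{1..q}. f k) = N" by (simp only: of_nat_eq_iff)
  then have "?c \<in> types q N" by (intro typesI) auto
  moreover have "x = freq q N ?c"
    using f simplexD(4)[OF P] by (auto simp: freq_def fun_eq_iff)
  ultimately show "x \<in> freq q N ` types q N" by blast
next
  fix x assume "x \<in> freq q N ` types q N"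
  then show "x \<in> lattice_simplex q N"
    using freq_simplex[OF N] by (auto simp: lattice_simplex_def freq_def)
qed

lemma fibre_freq:
  assumes "N > 0" "c \<in> types q N" shows "fibre q N (freq q N c) = cell q N c"
  using inj_onD[OF freq_inj[OF assms(1)] _ count_vec_types assms(2)]
  by (auto simp: fibre_def cell_def empirical_freq)

lemma finite_cell: "finite (cell q N c)"
  by (rule finite_subset[OF _ finite_configs[of q N]]) (auto simp: cell_def)

lemma sum_move:
  assumes "a \<in> A" "b \<in> A" "a \<noteq> b" "0 < c a" "finite A"
  shows "(\<Sum>k\<in>A. move a b c k) = (\<Sum>k\<in>A. c k)"
proof -
  note split = sum_split_two[OF assms(5,1-3)]
  have "(\<Sum>k\<in>A - {a} - {b}. move a b c k) = (\<Sum>k\<in>A - {a} - {b}. c k)"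
    by (intro sum.cong) (auto simp: move_def)
  then show ?thesis
    unfolding split[of "move a b c"] split[of c] using assms by (simp add: move_def)
qed

lemma move_types:
  assumes "c \<in> types q N" "a \<in> {1..q}" "b \<in> {1..q}" "a \<noteq> b" "0 < c a"
  shows "move a b c \<in> types q N"
proof (rule typesI)
  show "move a b c \<in> extensional {1..q}"
    using typesD(1)[OF assms(1)] assms(2,3) by (auto simp: move_def extensional_def)
  show "(\<Sum>k\<in>{1..q}. move a b c k) = N"
    using sum_move[of a "{1..q}" b c] assms typesD(2)[OF assms(1)] by simp
qed

text \<open>Move one unit at a time from a coordinate that is too large to one that is too small.  Every coordinate
then changes monotonically, so the path leaves no neighbourhood of \<open>c\<close> that is defined coordinatewise and contains
\<open>d\<close>.\<close>

lemma type_path_between: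
  assumes "c \<in> types q N" "d \<in> types q N"
    and "\<And>e. e \<in> types q N \<Longrightarrow> (\<And>k. k \<in> {1..q} \<Longrightarrow> min (c k) (d k) \<le> e k \<and> e k \<le> max (c k) (d k)) \<Longrightarrow> e \<in> V"
  shows "(c, d) \<in> (type_edges q V)\<^sup>*"
  using assms
proof (induction "\<Sum>k\<in>{1..q}. c k - d k" arbitrary: c rule: less_induct)
  case less
  show ?case
  proof (cases "c = d")
    case False
    have sum: "(\<Sum>k\<in>{1..q}. c k) = (\<Sum>k\<in>{1..q}. d k)" using typesD(2) less.prems(1,2) by metis
    have "\<exists>a\<in>{1..q}. d a < c a"
    proof (rule ccontr)
      assume "\<not> ?thesis"
      then have le: "\<And>k. k \<in> {1..q} \<Longrightarrow> c k \<le> d k" by force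
      then have "c k = d k" if "k \<in> {1..q}" for k
        using sum_mono_inv[OF sum le that] by simp
      then show False using False extensionalityI[OF typesD(1)[OF less.prems(1)] typesD(1)[OF less.prems(2)]] by blast
    qed
    then obtain a where a: "a \<in> {1..q}" "d a < c a" by blast
    have "\<exists>b\<in>{1..q}. c b < d b"
    proof (rule ccontr)
      assume "\<not> ?thesis"
      then have le: "\<And>k. k \<in> {1..q} \<Longrightarrow> d k \<le> c k" by force
      then have "d a = c a" using sum_mono_inv[OF sum[symmetric] le a(1)] by simp
      then show False using a by simp
    qed
    then obtain b where b: "b \<in> {1..q}" "c b < d b" by blast
    have ab: "a \<noteq> b" using a b by auto
    let ?e = "move a b c"
    have e: "?e \<in> types q N" using less.prems(1) a b ab by (intro move_types) auto
    have btw: "min (c k) (d k) \<le> ?e k \<and> ?e k \<le> max (c k) (d k)" for k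
      using a b ab by (auto simp: move_def)
    have "(\<Sum>k\<in>{1..q}. ?e k - d k) < (\<Sum>k\<in>{1..q}. c k - d k)"
    proof (rule sum_strict_mono_ex1)
      show "\<forall>k\<in>{1..q}. ?e k - d k \<le> c k - d k" using a b ab by (auto simp: move_def)
      show "\<exists>k\<in>{1..q}. ?e k - d k < c k - d k" using a ab by (intro bexI[of _ a]) (auto simp: move_def)
    qed simp
    then have "(?e, d) \<in> (type_edges q V)\<^sup>*"
    proof (rule less.hyps[OF _ e less.prems(2)])
      fix f assume f: "f \<in> types q N" "\<And>k. k \<in> {1..q} \<Longrightarrow> min (?e k) (d k) \<le> f k \<and> f k \<le> max (?e k) (d k)"
      show "f \<in> V"
      proof (rule less.prems(3)[OF f(1)])
        fix k assume "k \<in> {1..q}"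
        from f(2)[OF this] btw[of k] show "min (c k) (d k) \<le> f k \<and> f k \<le> max (c k) (d k)" by linarith
      qed
    qed
    moreover have "(c, ?e) \<in> type_edges q V"
    proof -
      have "0 < c a" using a by simp
      moreover have "c \<in> V" using less.prems(3)[OF less.prems(1)] by simp
      moreover have "?e \<in> V" using less.prems(3)[OF e] btw by simp
      ultimately show ?thesis using a(1) b(1) ab unfolding type_edges_def by blast
    qed
    ultimately show ?thesis by (rule converse_rtrancl_into_rtrancl[rotated])
  qed simp
qed

lemma configs_upd:
  assumes "\<sigma> \<in> configs q N" "i \<in> {1..N}" "b \<in> {1..q}" shows "\<sigma>(i := b) \<in> configs q N"
  using assms by (auto simp: configs_def PiE_iff extensional_def)

lemma count_vec_upd:
  assumes "i \<in> {1..N}" "a \<in> {1..q}" "b \<in> {1..q}" "a \<noteq> b" "\<sigma> i = a"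
  shows "count_vec q N (\<sigma>(i := b)) = move a b (count_vec q N \<sigma>)"
proof
  fix k
  show "count_vec q N (\<sigma>(i := b)) k = move a b (count_vec q N \<sigma>) k"
  proof (cases "k \<in> {1..q}")
    case True
    consider "k = a" | "k = b" | "k \<noteq> a" "k \<noteq> b" by blast
    then show ?thesis
    proof cases
      case 1
      have "{j\<in>{1..N}. (\<sigma>(i := b)) j = a} = {j\<in>{1..N}. \<sigma> j = a} - {i}" using assms by auto
      then show ?thesis using 1 assms by (simp add: count_vec_def move_def)
    next
      case 2
      have "{j\<in>{1..N}. (\<sigma>(i := b)) j = b} = insert i {j\<in>{1..N}. \<sigma> j = b}" using assms by auto
      then show ?thesis using 2 assms by (simp add: count_vec_def move_def)
    next
      case 3
      have "{j\<in>{1..N}. (\<sigma>(i := b)) j = k} = {j\<in>{1..N}. \<sigma> j = k}" using assms 3 by auto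
      then show ?thesis using 3 True by (simp add: count_vec_def move_def)
    qed
  next
    case False
    then have "k \<noteq> a" "k \<noteq> b" using assms by auto
    then show ?thesis using False by (simp only: count_vec_def move_def restrict_apply fun_upd_apply if_False)
  qed
qed

lemma cell_upd:
  assumes "\<sigma> \<in> cell q N c" "i \<in> {1..N}" "\<sigma> i = a" "a \<in> {1..q}" "b \<in> {1..q}" "a \<noteq> b"
  shows "\<sigma>(i := b) \<in> cell q N (move a b c)"
  using assms configs_upd[of \<sigma> q N i b] count_vec_upd[of i N a q b \<sigma>] by (auto simp: cell_def)

lemma move_back: "a \<noteq> b \<Longrightarrow> 0 < c a \<Longrightarrow> move b a (move a b c) = c"
  by (auto simp: move_def fun_eq_iff)

lemma cell_count:
  assumes "\<sigma> \<in> cell q N c" "a \<in> {1..q}" shows "card {i\<in>{1..N}. \<sigma> i = a} = c a"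
  using assms by (auto simp: cell_def count_vec_def)

text \<open>Count the pairs of a configuration in one cell and a spin whose change leads to the other cell.\<close>

lemma card_cell_move:
  assumes ab: "a \<in> {1..q}" "b \<in> {1..q}" "a \<noteq> b" and ca: "0 < c a"
  shows "card (cell q N c) * c a = card (cell q N (move a b c)) * (c b + 1)"
proof -
  let ?c' = "move a b c"
  let ?P = "SIGMA \<sigma>:cell q N c. {i\<in>{1..N}. \<sigma> i = a}"
  let ?P' = "SIGMA \<sigma>:cell q N ?c'. {i\<in>{1..N}. \<sigma> i = b}"
  have "bij_betw (\<lambda>(\<sigma>, i). (\<sigma>(i := b), i)) ?P ?P'"
  proof (rule bij_betwI[where g = "\<lambda>(\<sigma>, i). (\<sigma>(i := a), i)"])
    show "(\<lambda>(\<sigma>, i). (\<sigma>(i := b), i)) \<in> ?P \<rightarrow> ?P'" using cell_upd[of _ q N c _ a b] ab by auto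
    show "(\<lambda>(\<sigma>, i). (\<sigma>(i := a), i)) \<in> ?P' \<rightarrow> ?P"
      using cell_upd[of _ q N ?c' _ b a] ab move_back[of a b c, OF ab(3) ca] by auto
  qed (auto simp: fun_upd_idem)
  then have "card ?P = card ?P'" by (rule bij_betw_same_card)
  moreover have "card ?P = card (cell q N c) * c a"
    using cell_count[of _ q N c a] ab by (simp add: card_SigmaI finite_cell)
  moreover have "card ?P' = card (cell q N ?c') * (c b + 1)"
    using cell_count[of _ q N ?c' b] ab by (simp add: card_SigmaI finite_cell move_def)
  ultimately show ?thesis by simp
qed

lemma prod_fact_move:
  assumes ab: "a \<in> {1..q}" "b \<in> {1..q}" "a \<noteq> b" and ca: "0 < c a"
  shows "c a * (\<Prod>k\<in>{1..q}. fact (move a b c k)) = (c b + 1) * (\<Prod>k\<in>{1..q}. fact (c k) :: nat)"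
proof -
  note split = prod_split_two[OF finite_atLeastAtMost ab]
  have "(\<Prod>k\<in>{1..q} - {a} - {b}. fact (move a b c k)) = (\<Prod>k\<in>{1..q} - {a} - {b}. fact (c k) :: nat)"
    by (intro prod.cong) (auto simp: move_def)
  moreover have "fact (c a) = c a * fact (c a - 1)" using ca by (simp add: fact_reduce)
  moreover have "move a b c a = c a - 1" "fact (move a b c b) = (c b + 1) * (fact (c b) :: nat)"
    using ab by (auto simp: move_def)
  ultimately show ?thesis
    unfolding split[of "\<lambda>k. fact (move a b c k)"] split[of "\<lambda>k. fact (c k)"]
    by (simp only: mult_ac)
qed

lemma multinomial_invariant_edge:
  assumes "(c, c') \<in> type_edges q V"
  shows "card (cell q N c') * (\<Prod>k\<in>{1..q}. fact (c' k)) = card (cell q N c) * (\<Prod>k\<in>{1..q}. fact (c k))"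
proof -
  obtain a b where ab: "a \<in> {1..q}" "b \<in> {1..q}" "a \<noteq> b" "0 < c a" and c': "c' = move a b c"
    using assms by (auto simp: type_edges_def)
  have "c a * (card (cell q N c') * (\<Prod>k\<in>{1..q}. fact (c' k)))
      = card (cell q N c') * (c a * (\<Prod>k\<in>{1..q}. fact (c' k)))" by simp
  also have "\<dots> = card (cell q N c') * (c b + 1) * (\<Prod>k\<in>{1..q}. fact (c k))"
    unfolding c' prod_fact_move[of a q b c, OF ab] by (simp only: ac_simps)
  also have "\<dots> = card (cell q N c) * c a * (\<Prod>k\<in>{1..q}. fact (c k))"
    unfolding c' card_cell_move[of a q b c, OF ab] by simp
  finally have "c a * (card (cell q N c') * (\<Prod>k\<in>{1..q}. fact (c' k))) = c a * (card (cell q N c) * (\<Prod>k\<in>{1..q}. fact (c k)))"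
    by (simp add: ac_simps)
  then show ?thesis using ab(4) by simp
qed

text \<open>The invariant is \<open>N!\<close>, as cells have multinomial size; only ratios of sizes matter below, so its value
is left open.\<close>

lemma multinomial_invariant:
  assumes c: "c \<in> types q N" and d: "d \<in> types q N"
  shows "card (cell q N d) * (\<Prod>k\<in>{1..q}. fact (d k)) = card (cell q N c) * (\<Prod>k\<in>{1..q}. fact (c k))"
proof -
  have "(c, d) \<in> (type_edges q UNIV)\<^sup>*" by (rule type_path_between[OF c d]) simp
  then show ?thesis
    by (induction rule: rtrancl_induct) (auto dest: multinomial_invariant_edge[where N = N])
qed

lemma cell_nonempty:
  assumes q: "q \<ge> 1" and c: "c \<in> types q N" shows "cell q N c \<noteq> {}"
proof
  assume e: "cell q N c = {}"
  let ?\<sigma> = "\<lambda>i\<in>{1..N}. 1::nat"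
  have s: "?\<sigma> \<in> configs q N" using q by (auto simp: configs_def)
  let ?d = "count_vec q N ?\<sigma>"
  have "?\<sigma> \<in> cell q N ?d" using s by (simp add: cell_def)
  then have "card (cell q N ?d) > 0" using finite_cell card_gt_0_iff by blast
  moreover have "(\<Prod>k\<in>{1..q}. fact (?d k)) > (0::nat)" by (intro prod_pos) auto
  ultimately show False
    using multinomial_invariant[OF c count_vec_types[OF s]] e by simp
qed

definition type_energy :: "nat \<Rightarrow> nat \<Rightarrow> (nat \<Rightarrow> nat) \<Rightarrow> real" where
  "type_energy q N c = - (1 / (2 * real N)) * ((\<Sum>k\<in>{1..q}. (real (c k))\<^sup>2) - real N)"

text \<open>The number of pairs of equal spins in terms of the counts: twice the sum over \<open>i < j\<close> plus the diagonal is
the sum over all pairs, which factorises colour by colour.\<close>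

lemma hamiltonian_eq:
  assumes s: "\<sigma> \<in> configs q N" shows "hamiltonian N \<sigma> = type_energy q N (count_vec q N \<sigma>)"
proof -
  let ?f = "\<lambda>i j. of_bool (\<sigma> i = \<sigma> j) :: real"
  let ?A = "\<Sum>i\<in>{1..N}. \<Sum>j\<in>{i<..N}. ?f i j"
  have A: "?A = (\<Sum>i\<in>{1..N}. \<Sum>j\<in>{1..N}. if i < j then ?f i j else 0)"
  proof (rule sum.cong[OF refl])
    fix i assume "i \<in> {1..N}"
    then have "{j \<in> {1..N}. i < j} = {i<..N}" by auto
    then show "(\<Sum>j\<in>{i<..N}. ?f i j) = (\<Sum>j\<in>{1..N}. if i < j then ?f i j else 0)"
      by (simp add: sum.inter_filter[symmetric])
  qed
  have sym: "?f i j = ?f j i" for i j by (simp add: eq_commute)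
  have A': "?A = (\<Sum>i\<in>{1..N}. \<Sum>j\<in>{1..N}. if j < i then ?f i j else 0)"
    unfolding A by (subst sum.swap, subst sym) (rule refl)
  have D: "real N = (\<Sum>i\<in>{1..N}. \<Sum>j\<in>{1..N}. if i = j then ?f i j else 0)" by simp
  have "2 * ?A + real N = (\<Sum>i\<in>{1..N}. \<Sum>j\<in>{1..N}. if i < j then ?f i j else 0)
      + (\<Sum>i\<in>{1..N}. \<Sum>j\<in>{1..N}. if j < i then ?f i j else 0)
      + (\<Sum>i\<in>{1..N}. \<Sum>j\<in>{1..N}. if i = j then ?f i j else 0)"
    unfolding A[symmetric] A'[symmetric] D[symmetric] by (rule arg_cong2[where f = "(+)"]) auto
  also have "\<dots> = (\<Sum>i\<in>{1..N}. \<Sum>j\<in>{1..N}. ?f i j)"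
    unfolding sum.distrib[symmetric] by (intro sum.cong refl) auto
  also have "\<dots> = (\<Sum>i\<in>{1..N}. \<Sum>j\<in>{1..N}. \<Sum>k\<in>{1..q}. of_bool (\<sigma> i = k) * of_bool (\<sigma> j = k))"
  proof (intro sum.cong refl)
    fix i j assume "i \<in> {1..N}" "j \<in> {1..N}"
    then have "\<sigma> i \<in> {1..q}" using s by (auto simp: configs_def)
    have "(\<Sum>k\<in>{1..q}. of_bool (\<sigma> i = k) * of_bool (\<sigma> j = k) :: real) = (\<Sum>k\<in>{1..q}. if k = \<sigma> i then ?f i j else 0)"
      by (intro sum.cong) auto
    then show "?f i j = (\<Sum>k\<in>{1..q}. of_bool (\<sigma> i = k) * of_bool (\<sigma> j = k))"
      using \<open>\<sigma> i \<in> {1..q}\<close> by simp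
  qed
  also have "\<dots> = (\<Sum>i\<in>{1..N}. \<Sum>k\<in>{1..q}. \<Sum>j\<in>{1..N}. of_bool (\<sigma> i = k) * of_bool (\<sigma> j = k))"
    by (intro sum.cong refl sum.swap)
  also have "\<dots> = (\<Sum>k\<in>{1..q}. \<Sum>i\<in>{1..N}. \<Sum>j\<in>{1..N}. of_bool (\<sigma> i = k) * of_bool (\<sigma> j = k))"
    by (rule sum.swap)
  also have "\<dots> = (\<Sum>k\<in>{1..q}. (\<Sum>i\<in>{1..N}. of_bool (\<sigma> i = k))\<^sup>2)"
    by (simp only: sum_product[symmetric] power2_eq_square)
  also have "\<dots> = (\<Sum>k\<in>{1..q}. (real (count_vec q N \<sigma> k))\<^sup>2)"
    by (intro sum.cong refl arg_cong[where f = "\<lambda>x. x\<^sup>2"]) (simp add: count_vec_def of_bool_def sum.If_cases Int_def)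
  finally have A2: "?A = ((\<Sum>k\<in>{1..q}. (real (count_vec q N \<sigma> k))\<^sup>2) - real N) / 2" by simp
  show ?thesis unfolding hamiltonian_def type_energy_def A2 by simp
qed

text \<open>The energy changes by \<open>(c a - 1 - c b) / N\<close>.  That this is bounded keeps the jump rates between neighbouring
cells bounded below.\<close>

lemma type_energy_move:
  assumes "N > 0" "c \<in> types q N" and ab: "a \<in> {1..q}" "b \<in> {1..q}" "a \<noteq> b" "0 < c a"
  shows "type_energy q N (move a b c) - type_energy q N c \<le> 1"
proof -
  note split = sum_split_two[OF finite_atLeastAtMost ab(1-3)]
  have "(\<Sum>k\<in>{1..q} - {a} - {b}. (real (move a b c k))\<^sup>2) = (\<Sum>k\<in>{1..q} - {a} - {b}. (real (c k))\<^sup>2)"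
    by (intro sum.cong) (auto simp: move_def)
  moreover have mab: "real (move a b c a) = real (c a) - 1" "real (move a b c b) = real (c b) + 1"
    using ab by (auto simp: move_def)
  ultimately have e: "(\<Sum>k\<in>{1..q}. (real (move a b c k))\<^sup>2)
      = (\<Sum>k\<in>{1..q}. (real (c k))\<^sup>2) - 2 * (real (c a) - 1 - real (c b))"
    unfolding split[of "\<lambda>k. (real (move a b c k))\<^sup>2"] split[of "\<lambda>k. (real (c k))\<^sup>2"] mab
    by (simp add: power2_eq_square algebra_simps)
  have "type_energy q N (move a b c) - type_energy q N c = (real (c a) - 1 - real (c b)) / real N"
    using assms(1) unfolding type_energy_def e by (simp add: field_simps)
  also have "\<dots> \<le> 1" using typesD(3)[OF assms(2) ab(1)] assms(1) by (simp add: field_simps)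
  finally show ?thesis .
qed

text \<open>Stirling's formula up to a logarithmic error, by comparing increments.\<close>

lemma ln_fact_bounds:
  "real n * ln (real n) - real n \<le> ln (fact n)"
  "ln (fact n) \<le> real n * ln (real n) - real n + 1 + ln (real n + 1)"
proof -
  have st: "1 / (real n + 1) \<le> ln (real n + 1) - ln (real n) \<and> ln (real n + 1) - ln (real n) \<le> 1 / real n" if "n \<ge> 1" for n
  proof -
    have "ln (real n / (real n + 1)) \<le> real n / (real n + 1) - 1"
      using that by (intro ln_le_minus_one) simp
    moreover have "ln ((real n + 1) / real n) \<le> (real n + 1) / real n - 1"
      using that by (intro ln_le_minus_one) simp
    ultimately show ?thesis using that by (simp add: ln_div field_simps)
  qed
  have fs: "ln (fact (Suc n)) = ln (real n + 1) + ln (fact n)" for n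
  proof -
    have "(fact (Suc n) :: real) = (real n + 1) * fact n" by (simp add: algebra_simps)
    then show ?thesis by (simp only: ln_mult_pos[of "real n + 1" "fact n"]) (simp add: ln_mult)
  qed
  have rs: "real (Suc n) = real n + 1" for n by simp
  have lower: "real n * ln (real n) - real n \<le> ln (fact n)" for n
  proof (induction n)
    case (Suc n)
    show ?case
    proof (cases "n = 0")
      case False
      then have "real n * (ln (real n + 1) - ln (real n)) \<le> 1"
        using st[of n] by (simp add: field_simps)
      then show ?thesis using Suc False unfolding fs rs by (simp add: algebra_simps)
    qed simp
  qed simp
  show "real n * ln (real n) - real n \<le> ln (fact n)" by (rule lower)
  have upper: "ln (fact n) \<le> real n * ln (real n) - real n + 1 + ln (real n)" if "n \<ge> 1" for n
    using that
  proof (induction n rule: dec_induct)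
    case (step n)
    have "1 \<le> (real n + 1) * (ln (real n + 1) - ln (real n))"
      using st[of n] step.hyps by (simp add: field_simps)
    then show ?case using step(3) unfolding fs rs by (simp add: algebra_simps)
  qed simp
  show "ln (fact n) \<le> real n * ln (real n) - real n + 1 + ln (real n + 1)"
  proof (cases "n = 0")
    case False
    then have "ln (real n) \<le> ln (real n + 1)" by simp
    moreover have "n \<ge> 1" using False by simp
    ultimately show ?thesis using upper[of n] by linarith
  qed simp
qed

section \<open>Gibbs weights of cells\<close>

lemma partition_fun_pos: "q \<ge> 1 \<Longrightarrow> partition_fun q \<beta> N > 0"
  unfolding partition_fun_def by (intro sum_pos finite_configs) (auto simp: configs_def PiE_eq_empty_iff)

lemma pmf_gibbs_cell:
  assumes "q \<ge> 1" "\<sigma> \<in> cell q N c"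
  shows "pmf (gibbs q \<beta> N) \<sigma> = exp (- \<beta> * type_energy q N c) / partition_fun q \<beta> N"
  using assms hamiltonian_eq[of \<sigma> q N] by (auto simp: pmf_gibbs cell_def)

lemma measure_gibbs_sub_cell:
  assumes "q \<ge> 1" "X \<subseteq> cell q N c"
  shows "measure (gibbs q \<beta> N) X = real (card X) * (exp (- \<beta> * type_energy q N c) / partition_fun q \<beta> N)"
proof -
  have "finite X" using finite_subset[OF assms(2) finite_cell] .
  then have "measure (gibbs q \<beta> N) X = (\<Sum>\<sigma>\<in>X. pmf (gibbs q \<beta> N) \<sigma>)"
    by (rule measure_measure_pmf_finite)
  also have "\<dots> = (\<Sum>\<sigma>\<in>X. exp (- \<beta> * type_energy q N c) / partition_fun q \<beta> N)"
    using assms pmf_gibbs_cell[OF assms(1)] by (intro sum.cong) auto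
  finally show ?thesis by simp
qed

definition mass :: "nat \<Rightarrow> real \<Rightarrow> nat \<Rightarrow> (nat \<Rightarrow> nat) \<Rightarrow> real" where
  "mass q \<beta> N c = measure (gibbs q \<beta> N) (cell q N c)"

lemma mass_eq:
  "q \<ge> 1 \<Longrightarrow> mass q \<beta> N c = real (card (cell q N c)) * (exp (- \<beta> * type_energy q N c) / partition_fun q \<beta> N)"
  unfolding mass_def by (rule measure_gibbs_sub_cell) auto

lemma card_cell_pos: "q \<ge> 1 \<Longrightarrow> c \<in> types q N \<Longrightarrow> card (cell q N c) > 0"
  using cell_nonempty finite_cell by (simp add: card_gt_0_iff)

lemma mass_pos: "q \<ge> 1 \<Longrightarrow> c \<in> types q N \<Longrightarrow> mass q \<beta> N c > 0"
  using card_cell_pos partition_fun_pos by (simp add: mass_eq)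

definition stirling_error :: "nat \<Rightarrow> (nat \<Rightarrow> nat) \<Rightarrow> real" where
  "stirling_error q c = (\<Sum>k\<in>{1..q}. ln (fact (c k)) - (real (c k) * ln (real (c k)) - real (c k)))"

lemma stirling_error_bounds:
  assumes "c \<in> types q N"
  shows "0 \<le> stirling_error q c" "stirling_error q c \<le> real q * (1 + ln (real N + 1))"
proof -
  show "0 \<le> stirling_error q c"
    unfolding stirling_error_def by (intro sum_nonneg) (simp add: ln_fact_bounds(1))
  have "stirling_error q c \<le> (\<Sum>k\<in>{1..q}. 1 + ln (real N + 1))"
    unfolding stirling_error_def
  proof (intro sum_mono)
    fix k assume "k \<in> {1..q}"
    then have "real (c k) + 1 \<le> real N + 1" using typesD(3)[OF assms] by simp
    then have "ln (real (c k) + 1) \<le> ln (real N + 1)" by (subst ln_le_cancel_iff) auto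
    with ln_fact_bounds(2)[of "c k"]
    show "ln (fact (c k)) - (real (c k) * ln (real (c k)) - real (c k)) \<le> 1 + ln (real N + 1)" by linarith
  qed
  then show "stirling_error q c \<le> real q * (1 + ln (real N + 1))" by simp
qed

text \<open>Energy and entropy of a cell in terms of its counts.  Empty colours cause no trouble since \<open>0 * ln 0 = 0\<close>.\<close>

lemma free_energy_freq:
  assumes N: "N > 0" and \<beta>: "\<beta> > 0" and c: "c \<in> types q N"
  shows "\<beta> * real N * free_energy q \<beta> (freq q N c)
    = \<beta> * (type_energy q N c - 1/2) + (\<Sum>k\<in>{1..q}. real (c k) * ln (real (c k))) - real N * ln (real N)"
proof -
  have t: "\<beta> * real N * psi \<beta> (freq q N c k)
      = - (\<beta> / (2 * real N)) * (real (c k))\<^sup>2 + (real (c k) * ln (real (c k)) - real (c k) * ln (real N))"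
    if "k \<in> {1..q}" for k
  proof -
    have "real N * (real (c k) / real N * ln (real (c k) / real N)) = real (c k) * ln (real (c k)) - real (c k) * ln (real N)"
      using N by (cases "c k = 0") (auto simp: ln_div right_diff_distrib)
    moreover have "\<beta> * real N * (- (1/2) * (real (c k) / real N)\<^sup>2) = - (\<beta> / (2 * real N)) * (real (c k))\<^sup>2"
      using N by (simp add: power2_eq_square field_simps)
    moreover have "\<beta> * real N * psi \<beta> (freq q N c k) = \<beta> * real N * (- (1/2) * (real (c k) / real N)\<^sup>2)
        + real N * (real (c k) / real N * ln (real (c k) / real N))"
      using that \<beta> unfolding psi_def freq_def by (simp add: distrib_left del: times_divide_eq_left times_divide_eq_right) (simp add: field_simps)
    ultimately show ?thesis by simp
  qed
  have "\<beta> * real N * free_energy q \<beta> (freq q N c)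
      = (\<Sum>k\<in>{1..q}. - (\<beta> / (2 * real N)) * (real (c k))\<^sup>2 + (real (c k) * ln (real (c k)) - real (c k) * ln (real N)))"
    unfolding free_energy_psi sum_distrib_left using t by (intro sum.cong) auto
  also have "\<dots> = - (\<beta> / (2 * real N)) * (\<Sum>k\<in>{1..q}. (real (c k))\<^sup>2)
      + ((\<Sum>k\<in>{1..q}. real (c k) * ln (real (c k))) - (\<Sum>k\<in>{1..q}. real (c k)) * ln (real N))"
    by (simp only: sum.distrib sum_subtractf sum_distrib_left sum_distrib_right)
  also have "(\<Sum>k\<in>{1..q}. real (c k)) = real N"
    using typesD(2)[OF c] by (simp flip: of_nat_sum)
  also have "- (\<beta> / (2 * real N)) * (\<Sum>k\<in>{1..q}. (real (c k))\<^sup>2) = \<beta> * (type_energy q N c - 1/2)"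
    using N unfolding type_energy_def by (simp add: field_simps)
  finally show ?thesis by simp
qed

text \<open>The weight of a cell is its energy factor times a multinomial coefficient; by Stirling's formula its logarithm is
\<open>- \<beta> N F\<close> plus a constant, up to the error terms.\<close>

lemma mass_le:
  assumes q: "q \<ge> 1" and N: "N > 0" and \<beta>: "\<beta> > 0" and c: "c \<in> types q N" and d: "d \<in> types q N"
  shows "mass q \<beta> N c \<le> mass q \<beta> N d *
    exp (\<beta> * real N * (free_energy q \<beta> (freq q N d) - free_energy q \<beta> (freq q N c)) + real q * (1 + ln (real N + 1)))"
proof -
  define L where "L c = ln (real (card (cell q N c))) + (\<Sum>k\<in>{1..q}. ln (fact (c k)))" for c
  have Z: "partition_fun q \<beta> N > 0" by (rule partition_fun_pos[OF q])
  have e: "ln (mass q \<beta> N c) + \<beta> * real N * free_energy q \<beta> (freq q N c)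
      = L c - stirling_error q c + real N - real N * ln (real N) - \<beta> / 2 - ln (partition_fun q \<beta> N)"
    if c: "c \<in> types q N" for c
  proof -
    have "ln (mass q \<beta> N c) = ln (real (card (cell q N c))) - \<beta> * type_energy q N c - ln (partition_fun q \<beta> N)"
      using card_cell_pos[OF q c] Z by (simp add: mass_eq[OF q] ln_mult ln_div)
    moreover have "stirling_error q c = (\<Sum>k\<in>{1..q}. ln (fact (c k))) - ((\<Sum>k\<in>{1..q}. real (c k) * ln (real (c k))) - real N)"
    proof -
      have "(\<Sum>k\<in>{1..q}. real (c k)) = real N" using typesD(2)[OF c] by (simp flip: of_nat_sum)
      then show ?thesis unfolding stirling_error_def by (simp add: sum_subtractf)
    qed
    ultimately show ?thesis unfolding free_energy_freq[OF N \<beta> c] L_def by (simp add: algebra_simps)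
  qed
  have "L c = L d"
  proof -
    have "ln (real (card (cell q N c) * (\<Prod>k\<in>{1..q}. fact (c k)))) = L c" if c: "c \<in> types q N" for c
    proof -
      have "ln (\<Prod>k\<in>{1..q}. (fact (c k) :: real)) = (\<Sum>k\<in>{1..q}. ln (fact (c k)))"
        by (rule ln_prod) auto
      moreover have "(\<Prod>k\<in>{1..q}. (fact (c k) :: real)) > 0" by (intro prod_pos) auto
      ultimately show ?thesis using card_cell_pos[OF q c] by (simp add: L_def ln_mult)
    qed
    from this[OF c] this[OF d] show ?thesis unfolding multinomial_invariant[OF c d] by simp
  qed
  then have "ln (mass q \<beta> N c) - ln (mass q \<beta> N d)
     = \<beta> * real N * (free_energy q \<beta> (freq q N d) - free_energy q \<beta> (freq q N c)) + (stirling_error q d - stirling_error q c)"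
    using e[OF c] e[OF d] by (simp add: right_diff_distrib)
  also have "\<dots> \<le> \<beta> * real N * (free_energy q \<beta> (freq q N d) - free_energy q \<beta> (freq q N c)) + real q * (1 + ln (real N + 1))"
    using stirling_error_bounds(1)[OF c] stirling_error_bounds(2)[OF d] by linarith
  finally have "ln (mass q \<beta> N c) \<le> ln (mass q \<beta> N d) + (\<beta> * real N * (free_energy q \<beta> (freq q N d) - free_energy q \<beta> (freq q N c)) + real q * (1 + ln (real N + 1)))"
    by linarith
  then have "exp (ln (mass q \<beta> N c)) \<le> exp (ln (mass q \<beta> N d)) * exp (\<beta> * real N * (free_energy q \<beta> (freq q N d) - free_energy q \<beta> (freq q N c)) + real q * (1 + ln (real N + 1)))"
    unfolding exp_add[symmetric] by simp
  then show ?thesis using mass_pos[OF q c] mass_pos[OF q d] by simp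
qed

section \<open>Transport between cells\<close>

lemma jump_prob_upd:
  assumes "\<sigma> \<in> configs q N" "i \<in> {1..N}" "b \<in> {1..q}" "\<sigma> i \<noteq> b"
  shows "jump_prob q \<beta> N \<sigma> (\<sigma>(i := b)) = 1 / (real N * real q) * exp (- \<beta> * max 0 (hamiltonian N (\<sigma>(i := b)) - hamiltonian N \<sigma>))"
proof -
  have "{j\<in>{1..N}. \<sigma> j \<noteq> (\<sigma>(i := b)) j} = {i}" using assms by auto
  then show ?thesis using assms configs_upd[of \<sigma> q N i b] by (simp add: jump_prob_def)
qed

text \<open>For neighbours both sides equal \<open>exp (- \<beta> max (H \<sigma>) (H \<eta>))\<close> times the same constant.\<close>

lemma jump_balance:
  assumes "\<beta> \<ge> 0"
  shows "exp (- \<beta> * hamiltonian N \<sigma>) * jump_prob q \<beta> N \<sigma> \<eta> = exp (- \<beta> * hamiltonian N \<eta>) * jump_prob q \<beta> N \<eta> \<sigma>"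
proof -
  have "exp (- \<beta> * x) * exp (- \<beta> * max 0 (y - x)) = exp (- \<beta> * y) * exp (- \<beta> * max 0 (x - y))" for x y :: real
    unfolding exp_add[symmetric] by (simp add: max_def algebra_simps)
  moreover have "{i\<in>{1..N}. \<sigma> i \<noteq> \<eta> i} = {i\<in>{1..N}. \<eta> i \<noteq> \<sigma> i}" by auto
  ultimately show ?thesis by (simp add: jump_prob_def)
qed

lemma cwp_reversible:
  assumes q: "q \<ge> 1" and \<beta>: "\<beta> \<ge> 0"
  shows "reversible_chain (configs q N) (cwp_kernel q \<beta> N) (gibbs q \<beta> N)"
proof
  show "finite (configs q N)" by (rule finite_configs)
  show "set_pmf (cwp_kernel q \<beta> N x) \<subseteq> configs q N" if "x \<in> configs q N" for x
    using that by (auto simp: set_pmf_iff pmf_cwp_kernel[OF \<beta>] transition_prob_def jump_prob_def split: if_splits)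
  show "set_pmf (gibbs q \<beta> N) = configs q N"
    using partition_fun_pos[OF q, of \<beta> N] by (auto simp: set_pmf_iff pmf_gibbs[OF q] split: if_splits)
  fix x y assume xy: "x \<in> configs q N" "y \<in> configs q N"
  show "pmf (gibbs q \<beta> N) x * pmf (cwp_kernel q \<beta> N x) y = pmf (gibbs q \<beta> N) y * pmf (cwp_kernel q \<beta> N y) x"
  proof (cases "x = y")
    case False
    then show ?thesis
      using jump_balance[OF \<beta>, of N x q y] xy
      by (simp add: pmf_cwp_kernel[OF \<beta>] transition_prob_def pmf_gibbs[OF q])
  qed simp
qed

lemma (in reversible_chain) invariant: "bind_pmf \<mu> K = \<mu>"
proof (rule pmf_eqI)
  fix y
  have "pmf (bind_pmf \<mu> K) y = (\<Sum>x\<in>S. pmf \<mu> x * pmf (K x) y)"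
    unfolding pmf_bind using integral_measure_pmf_real[OF fin, of \<mu> "\<lambda>x. pmf (K x) y"] support
    by (simp add: mult.commute)
  also have "\<dots> = pmf \<mu> y"
  proof (cases "y \<in> S")
    case True
    have "(\<Sum>x\<in>S. pmf \<mu> x * pmf (K x) y) = (\<Sum>x\<in>S. pmf \<mu> y * pmf (K y) x)"
      using balance True by (intro sum.cong) auto
    then show ?thesis using sum_K[OF True] by (simp flip: sum_distrib_left)
  next
    case False
    then have "pmf (K x) y = 0" if "x \<in> S" for x using closed[OF that] by (auto simp: set_pmf_iff)
    moreover have "pmf \<mu> y = 0" using False support by (auto simp: set_pmf_iff)
    ultimately show ?thesis by simp
  qed
  finally show "pmf (bind_pmf \<mu> K) y = pmf \<mu> y" .
qed

locale cwp =
  fixes q N :: nat and \<beta> :: real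
  assumes q: "q \<ge> 1" and N: "N > 0" and \<beta>: "\<beta> > 0"
begin

sublocale reversible_chain "configs q N" "cwp_kernel q \<beta> N" "gibbs q \<beta> N"
  using cwp_reversible[OF q] \<beta> by simp

abbreviation "Q \<equiv> mass q \<beta> N"

abbreviation "P \<equiv> measure (gibbs q \<beta> N)"

abbreviation "FN c \<equiv> free_energy q \<beta> (freq q N c)"

text \<open>The transport of a density bounded by the uniform one on its cell is dominated by this multiple of the
conductances, if the cell has weight at least \<open>Q0\<close>.\<close>

definition flow_bound :: "real \<Rightarrow> real" where
  "flow_bound Q0 = real N * real q * exp \<beta> / Q0"

lemma flow_bound_nonneg: "Q0 > 0 \<Longrightarrow> flow_bound Q0 \<ge> 0"
  by (simp add: flow_bound_def)

text \<open>The form in which the cell weights are compared: free energies up to \<open>x\<close>, and a factor polynomial in \<open>N\<close>.\<close>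

lemma mass_ratio_le:
  assumes c: "c \<in> types q N" and d: "d \<in> types q N" and le: "FN d - FN c \<le> x"
  shows "Q c \<le> Q d * (exp (\<beta> * x * real N) * (exp (real q) * (real N + 1) ^ q))"
proof -
  have "\<beta> * real N * (FN d - FN c) \<le> \<beta> * real N * x"
    using le \<beta> by (intro mult_left_mono) auto
  then have "exp (\<beta> * real N * (FN d - FN c) + real q * (1 + ln (real N + 1)))
      \<le> exp (\<beta> * x * real N + real q * (1 + ln (real N + 1)))"
    by (simp add: ac_simps)
  also have "\<dots> = exp (\<beta> * x * real N) * (exp (real q) * (real N + 1) ^ q)"
  proof -
    have "exp (real q * ln (real N + 1)) = (real N + 1) ^ q" by (simp add: exp_of_nat_mult)
    then show ?thesis unfolding exp_add distrib_left by simp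
  qed
  finally have "Q d * exp (\<beta> * real N * (FN d - FN c) + real q * (1 + ln (real N + 1)))
      \<le> Q d * (exp (\<beta> * x * real N) * (exp (real q) * (real N + 1) ^ q))"
    using mass_pos[OF q d] by (intro mult_left_mono) (auto intro: less_imp_le)
  with mass_le[OF q N \<beta> c d] show ?thesis by linarith
qed

lemma conduct_upd_ge:
  assumes s: "\<sigma> \<in> cell q N c" and c: "c \<in> types q N" and i: "i \<in> {1..N}" "\<sigma> i = a"
    and ab: "a \<in> {1..q}" "b \<in> {1..q}" "a \<noteq> b"
  shows "Q c / real (card (cell q N c)) * (exp (- \<beta>) / (real N * real q)) \<le> conduct \<sigma> (\<sigma>(i := b))"
proof -
  have sc: "\<sigma> \<in> configs q N" and cs: "count_vec q N \<sigma> = c" using s by (auto simp: cell_def)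
  have "card {j\<in>{1..N}. \<sigma> j = a} > 0" using i by (subst card_gt_0_iff) auto
  then have ca: "0 < c a" using cell_count[OF s ab(1)] by simp
  have "hamiltonian N (\<sigma>(i := b)) - hamiltonian N \<sigma> = type_energy q N (move a b c) - type_energy q N c"
    using hamiltonian_eq[OF sc] hamiltonian_eq[OF configs_upd[OF sc i(1) ab(2)]] count_vec_upd[of i N a q b \<sigma>, OF i(1) ab i(2)] cs by simp
  also have "\<dots> \<le> 1" using type_energy_move[of N c q a b, OF N c ab ca] .
  finally have "max 0 (hamiltonian N (\<sigma>(i := b)) - hamiltonian N \<sigma>) \<le> 1" by simp
  then have "\<beta> * max 0 (hamiltonian N (\<sigma>(i := b)) - hamiltonian N \<sigma>) \<le> \<beta> * 1"
    using \<beta> by (intro mult_left_mono) auto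
  then have "exp (- \<beta>) \<le> exp (- \<beta> * max 0 (hamiltonian N (\<sigma>(i := b)) - hamiltonian N \<sigma>))" by simp
  then have k: "exp (- \<beta>) / (real N * real q) \<le> pmf (cwp_kernel q \<beta> N \<sigma>) (\<sigma>(i := b))"
  proof -
    have "\<sigma>(i := b) \<noteq> \<sigma>" using i ab by (metis fun_upd_same)
    then have "pmf (cwp_kernel q \<beta> N \<sigma>) (\<sigma>(i := b)) = 1 / (real N * real q) * exp (- \<beta> * max 0 (hamiltonian N (\<sigma>(i := b)) - hamiltonian N \<sigma>))"
      using jump_prob_upd[OF sc i(1) ab(2)] i ab \<beta> by (simp add: pmf_cwp_kernel transition_prob_def)
    moreover have "1 / (real N * real q) * exp (- \<beta>) \<le> 1 / (real N * real q) * exp (- \<beta> * max 0 (hamiltonian N (\<sigma>(i := b)) - hamiltonian N \<sigma>))"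
      using \<open>exp (- \<beta>) \<le> _\<close> by (intro mult_left_mono) auto
    ultimately show ?thesis by simp
  qed
  have "Q c / real (card (cell q N c)) = pmf (gibbs q \<beta> N) \<sigma>"
    using card_cell_pos[OF q c] by (simp add: mass_eq[OF q] pmf_gibbs_cell[OF q s])
  then show ?thesis unfolding conduct_def using mult_left_mono[OF k, of "pmf (gibbs q \<beta> N) \<sigma>"] by simp
qed

text \<open>A density on a cell that is dominated by the uniform distribution.  The bound is inherited along moves,
whereas a lower bound would not be available since \<open>X\<close> may be a small part of its cell.\<close>

definition cell_density :: "(nat \<Rightarrow> nat) \<Rightarrow> ((nat \<Rightarrow> nat) \<Rightarrow> real) \<Rightarrow> bool" where
  "cell_density c \<theta> \<longleftrightarrow> (\<forall>\<sigma>. 0 \<le> \<theta> \<sigma>) \<and> (\<forall>\<sigma>. \<sigma> \<notin> cell q N c \<longrightarrow> \<theta> \<sigma> = 0) \<and>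
     (\<forall>\<sigma>\<in>cell q N c. \<theta> \<sigma> \<le> 1 / real (card (cell q N c)))"

text \<open>Each configuration distributes its mass equally over the \<open>c a\<close> configurations in which one spin of colour
\<open>a\<close> has been changed to \<open>b\<close>.  A configuration of the new cell receives from at most \<open>c b + 1\<close> others,
and \<open>card_cell_move\<close> says that this keeps the density below the uniform one.\<close>

lemma cell_flow_step:
  assumes e: "(c, c') \<in> type_edges q V" and V: "V \<subseteq> types q N"
    and Q0: "0 < Q0" "Q0 \<le> Q c" and \<theta>: "cell_density c \<theta>"
  shows "\<exists>\<theta>'. cell_density c' \<theta>' \<and> total \<theta>' = total \<theta> \<and>
    pairing \<theta>' h - pairing \<theta> h
      \<le> sqrt (2 * total \<theta> * flow_bound Q0 * dirichlet h h)"
proof -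
  obtain a b where ab: "a \<in> {1..q}" "b \<in> {1..q}" "a \<noteq> b" and ca: "0 < c a" and c': "c' = move a b c"
    and c: "c \<in> types q N" using e V by (auto simp: type_edges_def)
  let ?S = "configs q N" and ?C = "cell q N c" and ?C' = "cell q N c'"
  have sub: "?C \<subseteq> ?S" "?C' \<subseteq> ?S" by (auto simp: cell_def)
  define flips where "flips \<sigma> = (\<lambda>i. \<sigma>(i := b)) ` {i\<in>{1..N}. \<sigma> i = a}" for \<sigma> :: "nat \<Rightarrow> nat"
  define \<phi> where "\<phi> \<sigma> \<eta> = (if \<eta> \<in> flips \<sigma> then \<theta> \<sigma> / real (c a) else 0)" for \<sigma> \<eta>
  define \<theta>' where "\<theta>' \<eta> = (\<Sum>\<sigma>\<in>?S. \<phi> \<sigma> \<eta>)" for \<eta>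
  note \<theta>D = \<theta>[unfolded cell_density_def]
  have \<phi>0: "\<phi> \<sigma> \<eta> = 0" if "\<sigma> \<notin> ?C" for \<sigma> \<eta> using \<theta>D that by (simp add: \<phi>_def)
  have flips_sub: "flips \<sigma> \<subseteq> ?C'" if "\<sigma> \<in> ?C" for \<sigma>
    using cell_upd[OF that _ _ ab] by (auto simp: flips_def c')
  have flips_card: "card (flips \<sigma>) = c a" if "\<sigma> \<in> ?C" for \<sigma>
  proof -
    have "inj_on (\<lambda>i. \<sigma>(i := b)) {i\<in>{1..N}. \<sigma> i = a}"
    proof (rule inj_onI)
      fix i j assume i: "i \<in> {i\<in>{1..N}. \<sigma> i = a}" and e: "\<sigma>(i := b) = \<sigma>(j := b)"
      show "i = j"
      proof (rule ccontr)
        assume "i \<noteq> j"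
        then show False using fun_cong[OF e, of i] i ab(3) by simp
      qed
    qed
    then show ?thesis using cell_count[OF that ab(1)] by (simp add: flips_def card_image)
  qed
  have cc: "real (card ?C) > 0" using card_cell_pos[OF q c] by simp
  have rows: "(\<Sum>\<eta>\<in>?S. \<phi> \<sigma> \<eta>) = \<theta> \<sigma>" for \<sigma>
  proof (cases "\<sigma> \<in> ?C")
    case True
    have "(\<Sum>\<eta>\<in>?S. \<phi> \<sigma> \<eta>) = (\<Sum>\<eta>\<in>flips \<sigma>. \<theta> \<sigma> / real (c a))"
      using flips_sub[OF True] sub fin unfolding \<phi>_def by (intro sum.mono_neutral_cong_right) auto
    then show ?thesis using flips_card[OF True] ca by simp
  qed (use \<phi>0 \<theta>D in simp)
  have "0 \<le> \<phi> \<sigma> \<eta> \<and> \<phi> \<sigma> \<eta> \<le> flow_bound Q0 * conduct \<sigma> \<eta>" for \<sigma> \<eta>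
  proof (cases "\<sigma> \<in> ?C \<and> \<eta> \<in> flips \<sigma>")
    case True
    then obtain i where i: "i \<in> {1..N}" "\<sigma> i = a" "\<eta> = \<sigma>(i := b)" by (auto simp: flips_def)
    have "\<phi> \<sigma> \<eta> \<le> \<theta> \<sigma> / 1"
      unfolding \<phi>_def using True \<theta>D ca divide_left_mono[of 1 "real (c a)" "\<theta> \<sigma>"] by auto
    also have "\<dots> \<le> 1 / real (card ?C)" using \<theta>D True by simp
    also have "\<dots> \<le> Q c / Q0 * (1 / real (card ?C))"
      using Q0 cc by (simp add: field_simps)
    also have "\<dots> = flow_bound Q0 * (Q c / real (card ?C) * (exp (- \<beta>) / (real N * real q)))"
      using N q by (simp add: flow_bound_def exp_minus field_simps)
    also have "\<dots> \<le> flow_bound Q0 * conduct \<sigma> \<eta>"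
      using conduct_upd_ge[of \<sigma> c i a b, OF _ c i(1,2) ab] True flow_bound_nonneg[OF Q0(1)] unfolding i(3)
      by (intro mult_left_mono) (auto simp del: times_divide_eq_right times_divide_eq_left)
    finally show ?thesis using \<theta>D by (simp add: \<phi>_def)
  next
    case False
    then have "\<phi> \<sigma> \<eta> = 0" using \<phi>0[of \<sigma> \<eta>] by (cases "\<sigma> \<in> ?C") (auto simp: \<phi>_def)
    then show ?thesis using flow_bound_nonneg[OF Q0(1)] conduct_nonneg[of \<sigma> \<eta>] by simp
  qed
  then have step: "pairing \<theta>' h - pairing \<theta> h
      \<le> sqrt (2 * total \<theta> * flow_bound Q0 * dirichlet h h)"
    using flow_bound_nonneg[OF Q0(1)] rows by (intro flow_step_le[where \<phi> = \<phi>]) (auto simp: \<theta>'_def)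
  have total: "total \<theta>' = total \<theta>"
    unfolding \<theta>'_def by (subst sum.swap) (simp add: rows)
  have dens: "cell_density c' \<theta>'"
    unfolding cell_density_def
  proof (intro conjI allI impI ballI)
    show "0 \<le> \<theta>' \<eta>" for \<eta>
      unfolding \<theta>'_def \<phi>_def using \<theta>D by (intro sum_nonneg) auto
    show "\<theta>' \<eta> = 0" if "\<eta> \<notin> ?C'" for \<eta>
      unfolding \<theta>'_def
    proof (intro sum.neutral ballI)
      fix \<sigma> show "\<phi> \<sigma> \<eta> = 0" using that flips_sub[of \<sigma>] \<phi>0[of \<sigma> \<eta>] by (cases "\<sigma> \<in> ?C") (auto simp: \<phi>_def)
    qed
    show "\<theta>' \<eta> \<le> 1 / real (card ?C')" if \<eta>: "\<eta> \<in> ?C'" for \<eta>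
    proof -
      let ?B = "(\<lambda>i. \<eta>(i := a)) ` {i\<in>{1..N}. \<eta> i = b}"
      have B: "\<sigma> \<in> ?B" if "\<eta> \<in> flips \<sigma>" for \<sigma>
      proof -
        obtain i where i: "i \<in> {1..N}" "\<sigma> i = a" "\<eta> = \<sigma>(i := b)" using \<open>\<eta> \<in> flips \<sigma>\<close> by (auto simp: flips_def)
        then have "\<sigma> = \<eta>(i := a)" "\<eta> i = b" by auto
        then show ?thesis using i(1) by blast
      qed
      have "card ?B \<le> card {i\<in>{1..N}. \<eta> i = b}" by (rule card_image_le) simp
      also have "\<dots> = c b + 1" using cell_count[OF \<eta> ab(2)] ab by (simp add: c' move_def)
      finally have cB: "card ?B \<le> c b + 1" .
      have "\<theta>' \<eta> \<le> (\<Sum>\<sigma>\<in>?S. if \<sigma> \<in> ?B then 1 / (real (card ?C) * real (c a)) else 0)"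
        unfolding \<theta>'_def
      proof (intro sum_mono)
        fix \<sigma>
        have "\<theta> \<sigma> \<le> 1 / real (card ?C)" using \<theta>D cc by (cases "\<sigma> \<in> ?C") auto
        then have "\<theta> \<sigma> / real (c a) \<le> 1 / real (card ?C) / real (c a)" using ca by (intro divide_right_mono) auto
        then show "\<phi> \<sigma> \<eta> \<le> (if \<sigma> \<in> ?B then 1 / (real (card ?C) * real (c a)) else 0)"
          using B[of \<sigma>] by (auto simp: \<phi>_def)
      qed
      also have "\<dots> = real (card (?S \<inter> ?B)) * (1 / (real (card ?C) * real (c a)))"
        using fin by (simp add: sum.If_cases)
      also have "\<dots> \<le> real (c b + 1) * (1 / (real (card ?C) * real (c a)))"
      proof (intro mult_right_mono)
        have "card (?S \<inter> ?B) \<le> card ?B" by (intro card_mono) auto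
        then show "real (card (?S \<inter> ?B)) \<le> real (c b + 1)" using cB by linarith
      qed simp
      also have "\<dots> = 1 / real (card ?C')"
      proof -
        have "real (card ?C) * real (c a) = real (card ?C') * real (c b + 1)"
          using card_cell_move[of a q b c N, OF ab ca] unfolding c' of_nat_mult[symmetric] by simp
        then show ?thesis by simp
      qed
      finally show ?thesis .
    qed
  qed
  show ?thesis using dens total step by blast
qed

text \<open>The error terms of the single steps add up along the path.\<close>

lemma cell_flow_path:
  assumes e: "(c, d) \<in> type_edges q V ^^ n" and V: "V \<subseteq> types q N"
    and Q0: "0 < Q0" "\<And>e. e \<in> V \<Longrightarrow> Q0 \<le> Q e" and \<theta>: "cell_density c \<theta>"
  shows "\<exists>\<theta>'. cell_density d \<theta>' \<and> total \<theta>' = total \<theta> \<and>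
    pairing \<theta>' h - pairing \<theta> h
      \<le> real n * sqrt (2 * total \<theta> * flow_bound Q0 * dirichlet h h)"
  using e
proof (induction n arbitrary: d)
  case 0
  then show ?case using \<theta> by auto
next
  case (Suc n)
  then obtain e where e: "(c, e) \<in> type_edges q V ^^ n" "(e, d) \<in> type_edges q V" by auto
  from Suc.IH[OF e(1)] obtain \<theta>1 where 1: "cell_density e \<theta>1" "total \<theta>1 = total \<theta>"
    "pairing \<theta>1 h - pairing \<theta> h
      \<le> real n * sqrt (2 * total \<theta> * flow_bound Q0 * dirichlet h h)"
    by blast
  have "Q0 \<le> Q e" using e(2) Q0(2) by (auto simp: type_edges_def)
  from cell_flow_step[OF e(2) V Q0(1) this 1(1), of h] obtain \<theta>2 where 2: "cell_density d \<theta>2"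
    "total \<theta>2 = total \<theta>"
    "pairing \<theta>2 h - pairing \<theta>1 h
      \<le> sqrt (2 * total \<theta> * flow_bound Q0 * dirichlet h h)"
    unfolding 1(2) by blast
  have "real (Suc n) * r = real n * r + r" for r by (simp add: algebra_simps)
  then show ?case using 1 2 by (intro exI[of _ \<theta>2]) auto
qed

lemma card_type_edges_le: "V \<subseteq> types q N \<Longrightarrow> card (type_edges q V) \<le> (N + 1) ^ (2 * q)"
proof -
  assume V: "V \<subseteq> types q N"
  have "type_edges q V \<subseteq> types q N \<times> types q N" using V by (auto simp: type_edges_def)
  then have "card (type_edges q V) \<le> card (types q N \<times> types q N)"
    by (intro card_mono) (auto simp: finite_types)
  also have "\<dots> \<le> (N + 1) ^ q * (N + 1) ^ q"
    unfolding card_cartesian_product by (intro mult_mono card_types) auto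
  also have "\<dots> = (N + 1) ^ (2 * q)" by (simp add: mult_2 power_add)
  finally show ?thesis .
qed

text \<open>Start with the uniform density of the cell, restricted to \<open>X\<close>, where the potential vanishes.  It is
carried into \<open>M\<close>, where the potential is \<open>1\<close>, so its total \<open>m\<close> is at most the number of steps times the
square root of a multiple of \<open>m\<close> times the capacity.\<close>

lemma capac_ge:
  assumes M: "M \<subseteq> configs q N" "cell q N d \<subseteq> M" and X: "X \<subseteq> configs q N - M"
    and V: "V \<subseteq> types q N" "c \<in> V" "(c, d) \<in> (type_edges q V)\<^sup>*"
    and Q0: "0 < Q0" "\<And>e. e \<in> V \<Longrightarrow> Q0 \<le> Q e"
  shows "P (X \<inter> cell q N c) * Q0
    \<le> capac M X * (2 * real ((N + 1) ^ (4 * q)) * (real N * real q * exp \<beta>) * Q c)"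
proof -
  let ?S = "configs q N" and ?C = "cell q N c"
  let ?X = "X \<inter> ?C"
  have c: "c \<in> types q N" using V by auto
  have cc: "real (card ?C) > 0" using card_cell_pos[OF q c] by simp
  have "finite (type_edges q V)"
    by (rule finite_subset[of _ "types q N \<times> types q N"]) (use V in \<open>auto simp: type_edges_def finite_types\<close>)
  \<comment> \<open>The length of the path is polynomial in \<open>N\<close>, as cycles can be removed.\<close>
  then obtain n where n: "n \<le> card (type_edges q V)" "(c, d) \<in> type_edges q V ^^ n"
    using V(3) by (auto simp: rtrancl_finite_eq_relpow)
  have n': "real n \<le> real ((N + 1) ^ (2 * q))"
    using n(1) card_type_edges_le[OF V(1)] by linarith
  define \<theta> where "\<theta> \<sigma> = (if \<sigma> \<in> ?X then 1 / real (card ?C) else 0)" for \<sigma>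
  have \<theta>: "cell_density c \<theta>" by (auto simp: cell_density_def \<theta>_def)
  define h where "h = eq_potential M X"
  define m where "m = total \<theta>"
  define B where "B = real N * real q * exp \<beta>"
  have B: "B > 0" using N q by (simp add: B_def)
  obtain \<theta>' where \<theta>': "cell_density d \<theta>'" "total \<theta>' = m"
    and le: "pairing \<theta>' h - pairing \<theta> h \<le> real n * sqrt (2 * m * (B / Q0) * dirichlet h h)"
    using cell_flow_path[OF n(2) V(1) Q0 \<theta>, of h] unfolding m_def B_def flow_bound_def by blast
  have dis: "M \<inter> X = {}" using X by auto
  have "pairing \<theta>' h = total \<theta>'"
  proof (intro sum.cong refl)
    fix \<sigma> show "\<theta>' \<sigma> * h \<sigma> = \<theta>' \<sigma>"
      using \<theta>'(1) M(2) by (cases "\<sigma> \<in> cell q N d") (auto simp: cell_density_def h_def eq_potential_def)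
  qed
  moreover have "pairing \<theta> h = 0"
    using dis by (intro sum.neutral) (auto simp: \<theta>_def h_def eq_potential_def)
  moreover have cap: "dirichlet h h = capac M X"
    unfolding h_def using X by (intro capac_eq_dirichlet[OF dis M(1), symmetric]) auto
  ultimately have m_le: "m \<le> real n * sqrt (2 * m * (B / Q0) * capac M X)" using le \<theta>'(2) by simp
  have cap0: "capac M X \<ge> 0" using dirichlet_nonneg[of h] cap by simp
  have m0: "m \<ge> 0" unfolding m_def by (intro sum_nonneg) (auto simp: \<theta>_def)
  have "m * m \<le> (real n * sqrt (2 * m * (B / Q0) * capac M X)) * (real n * sqrt (2 * m * (B / Q0) * capac M X))"
    using m_le m0 by (intro mult_mono) auto
  also have "\<dots> = (real n)\<^sup>2 * (2 * m * (B / Q0) * capac M X)"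
    using m0 cap0 Q0(1) B by (simp add: power2_eq_square mult.assoc mult.left_commute)
  finally have mm: "m * m \<le> m * ((real n)\<^sup>2 * (2 * (B / Q0) * capac M X))" by (simp add: ac_simps)
  then have "m \<le> (real n)\<^sup>2 * (2 * (B / Q0) * capac M X)"
  proof (cases "m = 0")
    case False
    then have "m > 0" using m0 by simp
    then show ?thesis using mm by (simp only: mult_le_cancel_left_pos)
  qed (use cap0 Q0(1) B in auto)
  also have "\<dots> \<le> real ((N + 1) ^ (4 * q)) * (2 * (B / Q0) * capac M X)"
  proof (intro mult_right_mono)
    have "(real n)\<^sup>2 \<le> (real ((N + 1) ^ (2 * q)))\<^sup>2" using n' by (intro power_mono) auto
    also have "\<dots> = real ((N + 1) ^ (4 * q))" by (simp flip: power_mult)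
    finally show "(real n)\<^sup>2 \<le> real ((N + 1) ^ (4 * q))" .
  qed (use cap0 B Q0 in simp)
  finally have "m * Q0 \<le> real ((N + 1) ^ (4 * q)) * (2 * (B / Q0) * capac M X) * Q0"
    using Q0 by (intro mult_right_mono) auto
  then have fin_le: "m * Q0 \<le> capac M X * (2 * real ((N + 1) ^ (4 * q)) * B)"
    using Q0 by (simp add: ac_simps)
  have "m = real (card ?X) / real (card ?C)"
  proof -
    have "m = (\<Sum>\<sigma>\<in>?X. 1 / real (card ?C))"
      unfolding m_def \<theta>_def using fin by (intro sum.mono_neutral_cong_right) (auto simp: cell_def)
    then show ?thesis by simp
  qed
  then have "m * Q c = P ?X"
    using cc measure_gibbs_sub_cell[OF q, of ?X N c \<beta>] by (simp add: mass_eq[OF q])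
  then have "P ?X * Q0 = (m * Q0) * Q c" by (simp add: ac_simps)
  also have "\<dots> \<le> (capac M X * (2 * real ((N + 1) ^ (4 * q)) * B)) * Q c"
    using fin_le mass_pos[OF q c] by (intro mult_right_mono) (auto intro: less_imp_le)
  finally show ?thesis by (simp add: B_def mult.assoc)
qed

end

section \<open>Escape and return probabilities\<close>

definition almost_downhill ::
  "nat \<Rightarrow> real \<Rightarrow> nat \<Rightarrow> real \<Rightarrow> (nat \<Rightarrow> nat) \<Rightarrow> (nat \<Rightarrow> nat) \<Rightarrow> bool" where
  "almost_downhill q \<beta> N \<epsilon> c d \<longleftrightarrow> (c, d) \<in> (type_edges q
     {e \<in> types q N. free_energy q \<beta> (freq q N e) \<le> free_energy q \<beta> (freq q N c) + \<epsilon>})\<^sup>*"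

context cwp
begin

lemma empirical_close:
  assumes xy: "x \<in> configs q N" "y \<in> configs q N" and pos: "conduct x y \<noteq> 0" and k: "k \<in> {1..q}"
  shows "\<bar>empirical q N x k - empirical q N y k\<bar> \<le> 1 / real N"
proof (cases "x = y")
  case False
  then have "jump_prob q \<beta> N x y \<noteq> 0"
    using pos \<beta> by (simp add: conduct_def pmf_cwp_kernel transition_prob_def)
  then have one: "card {i\<in>{1..N}. x i \<noteq> y i} = 1" by (simp add: jump_prob_def split: if_splits)
  have le: "card {i\<in>{1..N}. x i = k} \<le> card {i\<in>{1..N}. y i = k} + card {i\<in>{1..N}. x i \<noteq> y i}" for x y :: "nat \<Rightarrow> nat"
  proof -
    have "card {i\<in>{1..N}. x i = k} \<le> card ({i\<in>{1..N}. y i = k} \<union> {i\<in>{1..N}. x i \<noteq> y i})"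
      by (intro card_mono) auto
    also have "\<dots> \<le> card {i\<in>{1..N}. y i = k} + card {i\<in>{1..N}. x i \<noteq> y i}" by (rule card_Un_le)
    finally show ?thesis .
  qed
  have "{i\<in>{1..N}. y i \<noteq> x i} = {i\<in>{1..N}. x i \<noteq> y i}" by auto
  then have "\<bar>real (card {i\<in>{1..N}. x i = k}) - real (card {i\<in>{1..N}. y i = k})\<bar> \<le> 1"
    using le[of x y] le[of y x] one by simp
  then have "\<bar>real (card {i\<in>{1..N}. x i = k}) - real (card {i\<in>{1..N}. y i = k})\<bar> / real N \<le> 1 / real N"
    by (rule divide_right_mono) simp
  moreover have "empirical q N x k - empirical q N y k
      = (real (card {i\<in>{1..N}. x i = k}) - real (card {i\<in>{1..N}. y i = k})) / real N"
    using k by (simp add: empirical_freq freq_def count_vec_def diff_divide_distrib)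
  ultimately show ?thesis by (simp add: abs_divide)
qed simp

lemma sum_conduct: "x \<in> configs q N \<Longrightarrow> (\<Sum>y\<in>configs q N. conduct x y) = pmf (gibbs q \<beta> N) x"
  using sum_K[of x] by (simp add: conduct_def flip: sum_distrib_left)

text \<open>Only edges across the boundary of \<open>{x. g x = 0}\<close> contribute, and their inner end points lie in \<open>A\<close>.\<close>

lemma dirichlet_indicator_le:
  assumes A: "A \<subseteq> configs q N"
    and bd: "\<And>x y. x \<in> configs q N \<Longrightarrow> y \<in> configs q N \<Longrightarrow> conduct x y \<noteq> 0 \<Longrightarrow> g x = 0 \<Longrightarrow> g y = 1 \<Longrightarrow> x \<in> A"
    and g: "\<And>x. g x = 0 \<or> g x = (1::real)"
  shows "dirichlet g g \<le> P A"
proof -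
  let ?S = "configs q N" and ?i = "indicator A :: _ \<Rightarrow> real"
  have le: "conduct x y * ((g x - g y) * (g x - g y)) \<le> conduct x y * ?i x + conduct x y * ?i y"
    if xy: "x \<in> ?S" "y \<in> ?S" for x y
  proof (cases "conduct x y = 0 \<or> g x = g y")
    case True
    then show ?thesis using conduct_nonneg[of x y] by auto
  next
    case False
    then have "conduct x y \<noteq> 0" "conduct y x \<noteq> 0" using conduct_sym[OF xy] by auto
    then have "x \<in> A \<or> y \<in> A"
      using bd[OF xy] bd[OF xy(2,1)] g[of x] g[of y] False by auto
    moreover have "(g x - g y) * (g x - g y) = 1" using False g[of x] g[of y] by auto
    ultimately show ?thesis using conduct_nonneg[of x y] by (auto simp: indicator_def)
  qed
  have "(\<Sum>x\<in>?S. \<Sum>y\<in>?S. conduct x y * ((g x - g y) * (g x - g y)))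
      \<le> (\<Sum>x\<in>?S. \<Sum>y\<in>?S. conduct x y * ?i x + conduct x y * ?i y)"
    by (intro sum_mono le)
  also have "\<dots> = (\<Sum>x\<in>?S. \<Sum>y\<in>?S. conduct x y * ?i x) + (\<Sum>x\<in>?S. \<Sum>y\<in>?S. conduct x y * ?i y)"
    by (simp add: sum.distrib)
  also have "(\<Sum>x\<in>?S. \<Sum>y\<in>?S. conduct x y * ?i y) = (\<Sum>x\<in>?S. \<Sum>y\<in>?S. conduct x y * ?i x)"
    by (subst sum.swap) (intro sum.cong refl, simp add: conduct_sym)
  also have "(\<Sum>x\<in>?S. \<Sum>y\<in>?S. conduct x y * ?i x) = (\<Sum>x\<in>?S. pmf (gibbs q \<beta> N) x * ?i x)"
    by (simp add: sum_conduct flip: sum_distrib_right)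
  also have "\<dots> = (\<Sum>x\<in>A. pmf (gibbs q \<beta> N) x)"
    using A fin by (intro sum.mono_neutral_cong_right) (auto simp: indicator_def)
  also have "\<dots> = P A"
    using A fin by (intro measure_measure_pmf_finite[symmetric]) (rule finite_subset)
  finally show ?thesis by (simp add: dirichlet_def)
qed

lemma measure_by_types:
  assumes X: "X \<subseteq> configs q N"
  shows "P X = (\<Sum>c\<in>types q N. P (X \<inter> cell q N c))"
proof -
  have "X = (\<Union>c\<in>types q N. X \<inter> cell q N c)" using X count_vec_types by (auto simp: cell_def)
  then have "P X = P (\<Union>c\<in>types q N. X \<inter> cell q N c)" by simp
  also have "\<dots> = (\<Sum>c\<in>types q N. P (X \<inter> cell q N c))"
    by (intro measure_pmf.finite_measure_finite_Union) (auto simp: finite_types disjoint_family_on_def cell_def)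
  finally show ?thesis .
qed

lemma measure_le_types:
  assumes X: "X \<subseteq> configs q N" and W: "\<And>c. c \<in> types q N \<Longrightarrow> P (X \<inter> cell q N c) \<le> W" and W0: "0 \<le> W"
  shows "P X \<le> real ((N + 1) ^ q) * W"
proof -
  have "P X \<le> (\<Sum>c\<in>types q N. W)"
    unfolding measure_by_types[OF X] by (intro sum_mono W)
  also have "\<dots> = real (card (types q N)) * W" by simp
  also have "\<dots> \<le> real ((N + 1) ^ q) * W"
    using W0 card_types[of q N] by (intro mult_right_mono) (simp_all only: of_nat_le_iff)
  finally show ?thesis .
qed

text \<open>The test function is the indicator of the complement of the \<open>r\<close>-neighbourhood of \<open>m\<close>.  Frequencies change by at
most \<open>1 / N < r / 2\<close> in one step, so the boundary of the neighbourhood lies in the shell between \<open>r / 2\<close> and \<open>r\<close>.\<close>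

lemma escape_le:
  assumes d: "d \<in> types q N" and T: "T \<subseteq> configs q N" and r: "1 / real N < r / 2"
    and dn: "near q (r / 2) m (freq q N d)"
    and far: "\<And>\<sigma>. \<sigma> \<in> T \<Longrightarrow> \<not> near q r m (empirical q N \<sigma>)"
    and W: "\<And>c. c \<in> types q N \<Longrightarrow> near q r m (freq q N c) \<Longrightarrow> \<not> near q (r / 2) m (freq q N c) \<Longrightarrow> Q c \<le> W" and W0: "0 \<le> W"
  shows "escape_prob T (cell q N d) \<le> real ((N + 1) ^ q) * W / Q d"
proof -
  let ?S = "configs q N"
  have "0 < 1 / real N" using N by simp
  then have r0: "r > 0" using r by linarith
  define g where "g \<sigma> = (if near q r m (empirical q N \<sigma>) then 0 else 1 :: real)" for \<sigma>
  define A where "A = {\<sigma>\<in>?S. near q r m (empirical q N \<sigma>) \<and> \<not> near q (r / 2) m (empirical q N \<sigma>)}"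
  have emp: "empirical q N \<sigma> = freq q N c" if "\<sigma> \<in> cell q N c" for \<sigma> c
    using that by (simp add: empirical_freq cell_def)
  have "r / 2 < r" using r0 by simp
  then have dn': "near q r m (freq q N d)" using dn less_trans unfolding near_def by blast
  have cS: "cell q N d \<subseteq> ?S" by (auto simp: cell_def)
  have dis: "T \<inter> cell q N d = {}" using far dn' emp by (metis disjoint_iff)
  have "capac T (cell q N d) \<le> dirichlet g g"
    using far emp dn' by (intro capac_le_dirichlet[OF dis T cS]) (auto simp: g_def)
  also have "\<dots> \<le> P A"
  proof (rule dirichlet_indicator_le)
    fix x y assume xy: "x \<in> ?S" "y \<in> ?S" "conduct x y \<noteq> 0" "g x = 0" "g y = 1"
    have nx: "near q r m (empirical q N x)" and ny: "\<not> near q r m (empirical q N y)"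
      using xy by (auto simp: g_def split: if_splits)
    have "\<not> near q (r / 2) m (empirical q N x)"
    proof
      assume n: "near q (r / 2) m (empirical q N x)"
      have "\<bar>m k - empirical q N y k\<bar> < r" if k: "k \<in> {1..q}" for k
      proof -
        have 1: "\<bar>m k - empirical q N x k\<bar> < r / 2" using n k by (simp add: near_def)
        have "\<bar>m k - empirical q N y k\<bar> \<le> \<bar>m k - empirical q N x k\<bar> + \<bar>empirical q N x k - empirical q N y k\<bar>"
          by linarith
        also have "\<dots> < r / 2 + r / 2"
          using 1 empirical_close[OF xy(1-3) k] r by linarith
        finally show ?thesis by simp
      qed
      then show False using ny by (simp add: near_def)
    qed
    then show "x \<in> A" using nx xy by (simp add: A_def)
  qed (auto simp: A_def g_def)
  also have "\<dots> \<le> real ((N + 1) ^ q) * W"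
  proof (rule measure_le_types[OF _ _ W0])
    show "A \<subseteq> ?S" by (auto simp: A_def)
    fix c assume c: "c \<in> types q N"
    show "P (A \<inter> cell q N c) \<le> W"
    proof (cases "A \<inter> cell q N c = {}")
      case False
      then have "near q r m (freq q N c)" "\<not> near q (r / 2) m (freq q N c)"
        using emp by (auto simp: A_def)
      then have "Q c \<le> W" by (rule W[OF c])
      moreover have "P (A \<inter> cell q N c) \<le> Q c"
        unfolding mass_def by (intro measure_pmf.finite_measure_mono) auto
      ultimately show ?thesis by simp
    qed (use W0 in simp)
  qed
  finally have "capac T (cell q N d) \<le> real ((N + 1) ^ q) * W" .
  then have "capac T (cell q N d) / Q d \<le> real ((N + 1) ^ q) * W / Q d"
    using mass_pos[OF q d] by (intro divide_right_mono) (auto intro: less_imp_le)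
  then show ?thesis
    using prob_before_cond[OF dis cS] cell_nonempty[OF q d] by (simp add: mass_def)
qed

text \<open>The set \<open>X\<close> may meet exponentially many configurations but only polynomially many cells.  So the part of
\<open>X\<close> in its heaviest cell carries a share of at least \<open>1 / (N + 1) ^ q\<close>, and transporting this part suffices.\<close>

lemma return_ge:
  assumes M: "M \<subseteq> configs q N" and X: "X \<subseteq> configs q N - M" "X \<noteq> {}"
    and path: "\<And>c. c \<in> types q N \<Longrightarrow> \<exists>d. cell q N d \<subseteq> M \<and> almost_downhill q \<beta> N \<epsilon> c d"
    and \<epsilon>: "\<epsilon> \<ge> 0"
  shows "exp (- (\<beta> * \<epsilon> * real N)) / (2 * real q * exp (\<beta> + real q) * (real N + 1) ^ (6 * q + 1))
    \<le> escape_prob M X"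
proof -
  let ?S = "configs q N" and P = "measure (gibbs q \<beta> N)"
  have XS: "X \<subseteq> ?S" and dis: "M \<inter> X = {}" using X by auto
  have \<mu>X: "P X > 0"
  proof -
    obtain x where "x \<in> X" "x \<in> ?S" using X by auto
    then have "x \<in> set_pmf (gibbs q \<beta> N)" using support by simp
    then show ?thesis using \<open>x \<in> X\<close> by (simp add: measure_pmf_posI)
  qed
  obtain c where c: "c \<in> types q N" and big: "P X \<le> real ((N + 1) ^ q) * P (X \<inter> cell q N c)"
  proof -
    let ?f = "\<lambda>c. P (X \<inter> cell q N c)"
    have ne: "types q N \<noteq> {}" using X XS count_vec_types by blast
    have "Max (?f ` types q N) \<in> ?f ` types q N" using ne by (intro Max_in) (auto simp: finite_types)
    then obtain c where c0: "c \<in> types q N" "Max (?f ` types q N) = ?f c" by blast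
    have "?f e \<le> ?f c" if "e \<in> types q N" for e
      unfolding c0(2)[symmetric] using that by (intro Max_ge) (auto simp: finite_types)
    note c = c0(1) this
    show thesis by (rule that[OF c(1) measure_le_types[OF XS c(2)]]) auto
  qed
  define V where "V = {e \<in> types q N. FN e \<le> FN c + \<epsilon>}"
  obtain d where d: "cell q N d \<subseteq> M" "(c, d) \<in> (type_edges q V)\<^sup>*"
    using path[OF c] unfolding V_def almost_downhill_def by blast
  define E where "E = exp (\<beta> * \<epsilon> * real N) * (exp (real q) * (real N + 1) ^ q)"
  have E0: "E > 0" by (simp add: E_def)
  have Qc: "Q c > 0" by (rule mass_pos[OF q c])
  have "Q c / E \<le> Q e" if "e \<in> V" for e
  proof -
    have e: "e \<in> types q N" "FN e - FN c \<le> \<epsilon>" using that by (auto simp: V_def)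
    have "Q c \<le> Q e * E" unfolding E_def by (rule mass_ratio_le[OF c e])
    then show ?thesis using E0 by (simp add: field_simps)
  qed
  moreover have "c \<in> V" using c \<epsilon> by (simp add: V_def)
  moreover have "V \<subseteq> types q N" by (auto simp: V_def)
  ultimately have "P (X \<inter> cell q N c) * (Q c / E) \<le> capac M X * (2 * real ((N + 1) ^ (4 * q)) * (real N * real q * exp \<beta>) * Q c)"
    using capac_ge[OF M d(1) X(1), of V c "Q c / E"] d(2) Qc E0 by simp
  then have "Q c * (P (X \<inter> cell q N c) / E) \<le> Q c * (capac M X * (2 * real ((N + 1) ^ (4 * q)) * (real N * real q * exp \<beta>)))"
    by (simp add: ac_simps)
  then have 1: "P (X \<inter> cell q N c) \<le> E * (capac M X * (2 * real ((N + 1) ^ (4 * q)) * (real N * real q * exp \<beta>)))"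
    using Qc E0 by (simp add: pos_divide_le_eq mult.commute)
  have cap0: "capac M X \<ge> 0"
    using capac_eq_dirichlet[OF dis M XS] dirichlet_nonneg by simp
  have "P X \<le> real ((N + 1) ^ q) * (E * (capac M X * (2 * real ((N + 1) ^ (4 * q)) * (real N * real q * exp \<beta>))))"
    by (rule order_trans[OF big], rule mult_left_mono[OF 1]) simp
  also have "\<dots> \<le> real ((N + 1) ^ q) * (E * (capac M X * (2 * real ((N + 1) ^ (4 * q)) * ((real N + 1) * real q * exp \<beta>))))"
    using cap0 E0 by (intro mult_left_mono mult_right_mono) auto
  also have "\<dots> = capac M X * (2 * real q * exp (\<beta> + real q) * (real N + 1) ^ (6 * q + 1)) * exp (\<beta> * \<epsilon> * real N)"
  proof -
    have p: "(real N + 1) ^ q * (real N + 1) ^ q * (real N + 1) ^ (4 * q) * (real N + 1) = (real N + 1) ^ (6 * q + 1)"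
      by (simp flip: power_add)
    show ?thesis
      unfolding p[symmetric] E_def exp_add[of \<beta>] of_nat_power of_nat_add of_nat_1 by (simp only: ac_simps)
  qed
  finally have fin: "P X \<le> capac M X * (2 * real q * exp (\<beta> + real q) * (real N + 1) ^ (6 * q + 1)) * exp (\<beta> * \<epsilon> * real N)" .
  define D where "D = 2 * real q * exp (\<beta> + real q) * (real N + 1) ^ (6 * q + 1)"
  have D: "D > 0" using q by (simp add: D_def)
  have "exp (- (\<beta> * \<epsilon> * real N)) / D \<le> capac M X / P X"
    using fin \<mu>X D unfolding D_def[symmetric] by (simp add: exp_minus field_simps)
  then show ?thesis
    using prob_before_cond[OF dis XS X(2)] by (simp add: D_def)
qed

end

section \<open>Compactness and energy barriers\<close>

lemma convergent_subseq_coords: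
  fixes y :: "nat \<Rightarrow> nat \<Rightarrow> real"
  assumes "finite A" "\<And>n k. k \<in> A \<Longrightarrow> 0 \<le> y n k \<and> y n k \<le> 1"
  shows "\<exists>r. strict_mono (r :: nat \<Rightarrow> nat) \<and> (\<forall>k\<in>A. convergent (\<lambda>n. y (r n) k))"
  using assms
proof (induction A rule: finite_induct)
  case empty
  show ?case by (intro exI[of _ id]) (auto simp: strict_mono_def)
next
  case (insert a A)
  have "\<exists>r. strict_mono (r :: nat \<Rightarrow> nat) \<and> (\<forall>k\<in>A. convergent (\<lambda>n. y (r n) k))"
    using insert.prems by (intro insert.IH) simp
  then obtain r :: "nat \<Rightarrow> nat" where r: "strict_mono r" "\<And>k. k \<in> A \<Longrightarrow> convergent (\<lambda>n. y (r n) k)" by blast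
  have "bounded (range (\<lambda>n. y (r n) a))"
    using insert.prems[of a] by (intro boundedI[of _ 1]) auto
  then obtain l s where s: "strict_mono (s :: nat \<Rightarrow> nat)" "((\<lambda>n. y (r n) a) \<circ> s) \<longlonglongrightarrow> l"
    using bounded_imp_convergent_subsequence by blast
  have "convergent (\<lambda>n. y ((r \<circ> s) n) k)" if k: "k \<in> insert a A" for k
  proof (cases "k = a")
    case True
    then show ?thesis using s(2) by (auto simp: convergent_def o_def)
  next
    case False
    then obtain l' where "(\<lambda>n. y (r n) k) \<longlonglongrightarrow> l'" using r(2)[of k] k by (auto simp: convergent_def)
    from LIMSEQ_subseq_LIMSEQ[OF this s(1)] show ?thesis by (auto simp: convergent_def o_def)
  qed
  moreover have "strict_mono (r \<circ> s)" using r(1) s(1) by (rule strict_mono_o)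
  ultimately show ?case by blast
qed

lemma simplex_seq_compact:
  assumes y: "\<And>n. y n \<in> prob_simplex q"
  shows "\<exists>l r. l \<in> prob_simplex q \<and> strict_mono (r :: nat \<Rightarrow> nat) \<and>
    (\<forall>k\<in>{1..q}. (\<lambda>n. y (r n) k) \<longlonglongrightarrow> l k)"
proof -
  have "0 \<le> y n k \<and> y n k \<le> 1" if "k \<in> {1..q}" for n k using simplexD(1,2)[OF y that] by simp
  then obtain r :: "nat \<Rightarrow> nat" where r: "strict_mono r" "\<And>k. k \<in> {1..q} \<Longrightarrow> convergent (\<lambda>n. y (r n) k)"
    using convergent_subseq_coords[of "{1..q}" y] by auto
  define l where "l = (\<lambda>k\<in>{1..q}. lim (\<lambda>n. y (r n) k))"
  have lim: "(\<lambda>n. y (r n) k) \<longlonglongrightarrow> l k" if "k \<in> {1..q}" for k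
    using r(2)[OF that, unfolded convergent_LIMSEQ_iff] that by (simp add: l_def)
  have "l \<in> prob_simplex q"
  proof (rule simplexI)
    show "0 \<le> l k" if "k \<in> {1..q}" for k
      by (rule LIMSEQ_le_const[OF lim[OF that]]) (use simplexD(1)[OF y that] in auto)
    have "(\<lambda>n. \<Sum>k\<in>{1..q}. y (r n) k) \<longlonglongrightarrow> (\<Sum>k\<in>{1..q}. l k)"
      by (intro tendsto_sum lim)
    then have "(\<lambda>n. 1 :: real) \<longlonglongrightarrow> (\<Sum>k\<in>{1..q}. l k)" by (simp only: simplexD(3)[OF y])
    then show "(\<Sum>k\<in>{1..q}. l k) = 1" by (rule LIMSEQ_unique[OF _ tendsto_const])
  qed (simp add: l_def)
  then show ?thesis using r(1) lim by blast
qed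

text \<open>Needed for the continuity of the entropy at the boundary of the simplex.\<close>

lemma abs_x_ln_x_le:
  assumes "0 \<le> x" "x \<le> (1::real)" shows "\<bar>x * ln x\<bar> \<le> 2 * sqrt x"
proof (cases "x = 0")
  case False
  then have x: "x > 0" using assms by simp
  have "ln (1 / sqrt x) \<le> 1 / sqrt x - 1" using x by (intro ln_le_minus_one) simp
  then have "- ln x \<le> 2 / sqrt x" using x by (simp add: ln_div ln_sqrt)
  then have "x * (- ln x) \<le> x * (2 / sqrt x)" using x by (intro mult_left_mono) auto
  also have "\<dots> = 2 * sqrt x" using x by (simp add: field_simps)
  finally show ?thesis using x assms by (simp add: abs_mult)
qed simp

lemma continuous_psi: "continuous_on {0..1} (psi \<beta>)"
proof -
  have "continuous_on {0..1} (\<lambda>x::real. x * ln x)"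
    unfolding continuous_on_eq_continuous_within
  proof
    fix x :: real assume x: "x \<in> {0..1}"
    show "continuous (at x within {0..1}) (\<lambda>x. x * ln x)"
    proof (cases "x = 0")
      case True
      have "((\<lambda>x. 2 * sqrt x) \<longlongrightarrow> 2 * sqrt 0) (at 0 within {0..1})"
        by (intro tendsto_intros)
      then have s: "((\<lambda>x. 2 * sqrt x) \<longlongrightarrow> 0) (at 0 within {0..1})" by simp
      have "\<forall>\<^sub>F x in at 0 within {0..1}. norm (x * ln x) \<le> 2 * sqrt x"
        unfolding eventually_at_filter real_norm_def
        by (rule always_eventually) (use abs_x_ln_x_le in simp)
      then have "((\<lambda>x::real. x * ln x) \<longlongrightarrow> 0) (at 0 within {0..1})"
        by (rule Lim_null_comparison) (rule s)
      then show ?thesis using True by (simp add: continuous_within)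
    next
      case False
      then show ?thesis using x by (auto intro!: continuous_intros)
    qed
  qed
  then have "continuous_on {0..1} (\<lambda>u. 1 / \<beta> * (u * ln u))" by (rule continuous_on_mult_left)
  moreover have "continuous_on {0..1} (\<lambda>u::real. - (1/2) * u\<^sup>2)" by (intro continuous_intros)
  ultimately show ?thesis unfolding psi_def[abs_def] by (rule continuous_on_add[rotated])
qed

lemma free_energy_uniform:
  assumes q: "q \<ge> 1" and e: "\<epsilon> > 0"
  obtains \<delta> where "\<delta> > 0" "\<And>x y. x \<in> prob_simplex q \<Longrightarrow> y \<in> prob_simplex q \<Longrightarrow> near q \<delta> x y \<Longrightarrow>
    \<bar>free_energy q \<beta> x - free_energy q \<beta> y\<bar> < \<epsilon>"
proof -
  have "uniformly_continuous_on {0..1} (psi \<beta>)"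
    by (intro compact_uniformly_continuous continuous_psi) simp
  moreover have "\<epsilon> / real q > 0" using q e by simp
  ultimately obtain \<delta> where d: "\<delta> > 0" "\<And>u v. u \<in> {0..1} \<Longrightarrow> v \<in> {0..1} \<Longrightarrow> dist v u < \<delta> \<Longrightarrow> dist (psi \<beta> v) (psi \<beta> u) < \<epsilon> / real q"
    unfolding uniformly_continuous_on_def by metis
  have "\<bar>free_energy q \<beta> x - free_energy q \<beta> y\<bar> < \<epsilon>"
    if x: "x \<in> prob_simplex q" and y: "y \<in> prob_simplex q" and n: "near q \<delta> x y" for x y
  proof -
    have "\<bar>free_energy q \<beta> x - free_energy q \<beta> y\<bar> \<le> (\<Sum>k\<in>{1..q}. \<bar>psi \<beta> (x k) - psi \<beta> (y k)\<bar>)"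
      unfolding free_energy_psi sum_subtractf[symmetric] by (rule sum_abs)
    also have "\<dots> < (\<Sum>k\<in>{1..q}. \<epsilon> / real q)"
    proof (rule sum_strict_mono)
      fix k assume k: "k \<in> {1..q}"
      have "dist (x k) (y k) < \<delta>" using n k by (simp add: near_def dist_real_def)
      then show "\<bar>psi \<beta> (x k) - psi \<beta> (y k)\<bar> < \<epsilon> / real q"
        using d(2)[of "y k" "x k"] simplexD(1,2)[OF x k] simplexD(1,2)[OF y k] by (simp add: dist_real_def)
    qed (use q in auto)
    also have "\<dots> = \<epsilon>" using q by simp
    finally show ?thesis .
  qed
  with d(1) show thesis by (rule that)
qed

lemma free_energy_tendsto:
  assumes y: "\<And>n. y n \<in> prob_simplex q" and l: "l \<in> prob_simplex q"
    and lim: "\<And>k. k \<in> {1..q} \<Longrightarrow> (\<lambda>n. y n k) \<longlonglongrightarrow> l k"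
  shows "(\<lambda>n. free_energy q \<beta> (y n)) \<longlonglongrightarrow> free_energy q \<beta> l"
  unfolding free_energy_psi
proof (rule tendsto_sum)
  fix k assume k: "k \<in> {1..q}"
  show "(\<lambda>n. psi \<beta> (y n k)) \<longlonglongrightarrow> psi \<beta> (l k)"
    by (rule continuous_on_tendsto_compose[OF continuous_psi lim[OF k]])
      (use simplexD(1,2)[OF l k] simplexD(1,2)[OF y k] in auto)
qed

lemma near_sym: "near q \<epsilon> x y \<longleftrightarrow> near q \<epsilon> y x"
  by (simp add: near_def abs_minus_commute)

lemma near_mono: "near q \<epsilon> x y \<Longrightarrow> \<epsilon> \<le> \<delta> \<Longrightarrow> near q \<delta> x y"
  unfolding near_def by force

lemma near_trans: "near q \<epsilon> x y \<Longrightarrow> near q \<delta> y z \<Longrightarrow> near q (\<epsilon> + \<delta>) x z"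
  unfolding near_def
proof
  fix k assume a: "\<forall>k\<in>{1..q}. \<bar>x k - y k\<bar> < \<epsilon>" "\<forall>k\<in>{1..q}. \<bar>y k - z k\<bar> < \<delta>" and k: "k \<in> {1..q}"
  have "\<bar>x k - y k\<bar> < \<epsilon>" "\<bar>y k - z k\<bar> < \<delta>" using a k by auto
  then show "\<bar>x k - z k\<bar> < \<epsilon> + \<delta>" by linarith
qed

lemma near_eventually:
  assumes "\<And>k. k \<in> {1..q} \<Longrightarrow> (\<lambda>n. y n k) \<longlonglongrightarrow> l k" "\<epsilon> > 0"
  shows "\<forall>\<^sub>F n in sequentially. near q \<epsilon> l (y n)"
  unfolding near_def
proof (rule eventually_ball_finite)
  show "\<forall>k\<in>{1..q}. \<forall>\<^sub>F n in sequentially. \<bar>l k - y n k\<bar> < \<epsilon>"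
    using tendstoD[OF assms(1) assms(2)] by (auto simp: dist_real_def abs_minus_commute)
qed simp

lemma simplex_separated:
  assumes x: "x \<in> prob_simplex q" and y: "y \<in> prob_simplex q" and ne: "x \<noteq> y"
  obtains \<epsilon> where "\<epsilon> > 0" "\<not> near q \<epsilon> x y"
proof -
  have "\<exists>k\<in>{1..q}. x k \<noteq> y k"
  proof (rule ccontr)
    assume "\<not> ?thesis"
    then have "x k = y k" for k using simplexD(4)[OF x, of k] simplexD(4)[OF y, of k] by (cases "k \<in> {1..q}") auto
    then show False using ne by auto
  qed
  then obtain k where k: "k \<in> {1..q}" "x k \<noteq> y k" by blast
  show thesis
  proof
    show "\<bar>x k - y k\<bar> > 0" using k by simp
    show "\<not> near q \<bar>x k - y k\<bar> x y" using k by (auto simp: near_def)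
  qed
qed

text \<open>By compactness: a limit of points that are minimal up to \<open>1 / n\<close> in their \<open>r\<close>-neighbourhoods is a local
minimizer, with radius \<open>r / 2\<close>.\<close>

lemma near_minimizers_of_almost_minimizers:
  assumes q: "q \<ge> 1" and rad: "r > 0" and \<eta>: "\<eta> > 0"
  shows "\<exists>\<rho>>0. \<forall>y\<in>prob_simplex q. (\<forall>w\<in>prob_simplex q. near q r y w \<longrightarrow> free_energy q \<beta> y - \<rho> \<le> free_energy q \<beta> w) \<longrightarrow>
    (\<exists>x. local_minimizer q (free_energy q \<beta>) x \<and> near q \<eta> x y)"
proof (rule ccontr)
  assume neg: "\<not> ?thesis"
  have "\<exists>y. y \<in> prob_simplex q \<and> (\<forall>w\<in>prob_simplex q. near q r y w \<longrightarrow> free_energy q \<beta> y - 1 / real (Suc n) \<le> free_energy q \<beta> w) \<and>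
     (\<forall>x. local_minimizer q (free_energy q \<beta>) x \<longrightarrow> \<not> near q \<eta> x y)" for n
  proof -
    have "1 / real (Suc n) > 0" by simp
    with neg have "\<not> (\<forall>y\<in>prob_simplex q. (\<forall>w\<in>prob_simplex q. near q r y w \<longrightarrow> free_energy q \<beta> y - 1 / real (Suc n) \<le> free_energy q \<beta> w) \<longrightarrow>
      (\<exists>x. local_minimizer q (free_energy q \<beta>) x \<and> near q \<eta> x y))" by blast
    then show ?thesis by blast
  qed
  then obtain y where y: "\<And>n. y n \<in> prob_simplex q"
    "\<And>n w. w \<in> prob_simplex q \<Longrightarrow> near q r (y n) w \<Longrightarrow> free_energy q \<beta> (y n) - 1 / real (Suc n) \<le> free_energy q \<beta> w"
    "\<And>n x. local_minimizer q (free_energy q \<beta>) x \<Longrightarrow> \<not> near q \<eta> x (y n)" by metis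
  obtain l and s :: "nat \<Rightarrow> nat" where l: "l \<in> prob_simplex q" and s: "strict_mono s"
    and lim: "\<And>k. k \<in> {1..q} \<Longrightarrow> (\<lambda>n. y (s n) k) \<longlonglongrightarrow> l k"
    using simplex_seq_compact[of y q, OF y(1)] by (elim exE conjE) (rule that, auto)
  have F: "(\<lambda>n. free_energy q \<beta> (y (s n)) - 1 / real (Suc (s n))) \<longlonglongrightarrow> free_energy q \<beta> l - 0"
  proof (intro tendsto_diff free_energy_tendsto y(1) l lim)
    show "(\<lambda>n. 1 / real (Suc (s n))) \<longlonglongrightarrow> 0"
      using LIMSEQ_subseq_LIMSEQ[OF LIMSEQ_inverse_real_of_nat s] unfolding o_def inverse_eq_divide .
  qed
  have "local_minimizer q (free_energy q \<beta>) l"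
    unfolding local_minimizer_iff_near[OF q]
  proof (intro conjI exI ballI impI)
    show "r / 2 > 0" using rad by simp
    fix w assume w: "w \<in> prob_simplex q" and n: "near q (r / 2) l w"
    have "\<forall>\<^sub>F n in sequentially. free_energy q \<beta> (y (s n)) - 1 / real (Suc (s n)) \<le> free_energy q \<beta> w"
    proof (rule eventually_mono[OF near_eventually[OF lim, where \<epsilon> = "r / 2"]])
      fix j assume "near q (r / 2) l (y (s j))"
      then have "near q (r / 2) (y (s j)) l" by (simp only: near_sym[of q "r / 2" l])
      from near_trans[OF this n] have "near q (r / 2 + r / 2) (y (s j)) w" .
      then show "free_energy q \<beta> (y (s j)) - 1 / real (Suc (s j)) \<le> free_energy q \<beta> w"
        using y(2)[OF w] by simp
    qed (use rad in auto)
    then show "free_energy q \<beta> l \<le> free_energy q \<beta> w"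
      using tendsto_upperbound[OF F] by simp
  qed (rule l)
  moreover have "\<forall>\<^sub>F n in sequentially. near q \<eta> l (y (s n))" using near_eventually[OF lim \<eta>] .
  then obtain n where "near q \<eta> l (y (s n))" using eventually_happens'[OF sequentially_bot] by blast
  ultimately show False using y(3) by blast
qed

text \<open>The shell between the radii \<open>r / 2\<close> and \<open>r\<close> separates \<open>m\<close> from the outside by the height \<open>\<delta>\<close>.\<close>

definition barrier :: "nat \<Rightarrow> real \<Rightarrow> (nat \<Rightarrow> real) \<Rightarrow> real \<Rightarrow> real \<Rightarrow> bool" where
  "barrier q \<beta> m r \<delta> \<longleftrightarrow> (\<forall>y\<in>prob_simplex q. near q r m y \<and> \<not> near q (r / 2) m y \<longrightarrow>
     free_energy q \<beta> m + \<delta> \<le> free_energy q \<beta> y)"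

text \<open>If the free energy took its minimal value at another point near \<open>m\<close>, that point would be a local minimizer
too.  As local minimizers are isolated, the minimum at \<open>m\<close> is strict, and by compactness it is so
uniformly on shells.\<close>

lemma minimizer_barrier:
  assumes q: "q \<ge> 1" and loc: "local_minimizer q (free_energy q \<beta>) m"
    and fin: "finite {x. local_minimizer q (free_energy q \<beta>) x}"
  shows "\<exists>R>0. \<forall>r. 0 < r \<and> r \<le> R \<longrightarrow> (\<exists>\<delta>>0. barrier q \<beta> m r \<delta>)"
proof -
  obtain \<epsilon> where m: "m \<in> prob_simplex q" and e: "\<epsilon> > 0"
    and min: "\<And>y. y \<in> prob_simplex q \<Longrightarrow> near q \<epsilon> m y \<Longrightarrow> free_energy q \<beta> m \<le> free_energy q \<beta> y"
    using loc unfolding local_minimizer_iff_near[OF q] by blast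
  have "\<exists>R0>0. \<forall>x\<in>{x. local_minimizer q (free_energy q \<beta>) x} - {m}. \<not> near q R0 m x"
  proof -
    have "\<forall>x\<in>{x. local_minimizer q (free_energy q \<beta>) x} - {m}. \<exists>\<epsilon>>0. \<not> near q \<epsilon> m x"
    proof
      fix x assume x: "x \<in> {x. local_minimizer q (free_energy q \<beta>) x} - {m}"
      then have "x \<in> prob_simplex q" "m \<noteq> x" by (auto simp: local_minimizer_def)
      then obtain \<epsilon> where "\<epsilon> > 0" "\<not> near q \<epsilon> m x" by (rule simplex_separated[OF m])
      then show "\<exists>\<epsilon>>0. \<not> near q \<epsilon> m x" by blast
    qed
    then obtain f where f: "\<And>x. x \<in> {x. local_minimizer q (free_energy q \<beta>) x} - {m} \<Longrightarrow> f x > 0 \<and> \<not> near q (f x) m x"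
      by metis
    let ?A = "insert 1 (f ` ({x. local_minimizer q (free_energy q \<beta>) x} - {m}))"
    have "Min ?A > 0" using fin f by (subst Min_gr_iff) auto
    moreover have "\<not> near q (Min ?A) m x" if "x \<in> {x. local_minimizer q (free_energy q \<beta>) x} - {m}" for x
    proof
      assume "near q (Min ?A) m x"
      moreover have "Min ?A \<le> f x" using fin that by (intro Min_le) auto
      ultimately have "near q (f x) m x" by (rule near_mono)
      then show False using f[OF that] by simp
    qed
    ultimately show ?thesis by blast
  qed
  then obtain R0 where R0: "R0 > 0" "\<And>x. local_minimizer q (free_energy q \<beta>) x \<Longrightarrow> x \<noteq> m \<Longrightarrow> \<not> near q R0 m x" by blast
  \<comment> \<open>Halved, because the limit of points of the shell is only known to lie within \<open>3 r / 2\<close> of \<open>m\<close>.\<close>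
  define R where "R = min \<epsilon> R0 / 2"
  have R: "R > 0" "R < \<epsilon>" "R < R0" using e R0(1) by (auto simp: R_def min_def)
  have strict: "free_energy q \<beta> m < free_energy q \<beta> y"
    if y: "y \<in> prob_simplex q" and n: "near q (2 * R) m y" and ne: "y \<noteq> m" for y
  proof -
    have n': "near q \<epsilon> m y" "near q R0 m y" using n by (auto elim!: near_mono simp: R_def)
    have "free_energy q \<beta> m \<noteq> free_energy q \<beta> y"
    proof
      assume eq: "free_energy q \<beta> m = free_energy q \<beta> y"
      define g where "g = Min (insert 1 ((\<lambda>k. \<epsilon> - \<bar>m k - y k\<bar>) ` {1..q}))"
      have g: "g > 0" unfolding g_def using n'(1) by (subst Min_gr_iff) (auto simp: near_def)
      have "local_minimizer q (free_energy q \<beta>) y"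
        unfolding local_minimizer_iff_near[OF q]
      proof (intro conjI exI ballI impI)
        fix w assume w: "w \<in> prob_simplex q" "near q g y w"
        have "near q \<epsilon> m w"
          unfolding near_def
        proof
          fix k assume k: "k \<in> {1..q}"
          have "g \<le> \<epsilon> - \<bar>m k - y k\<bar>" unfolding g_def using k by (intro Min_le) auto
          moreover have "\<bar>y k - w k\<bar> < g" using w k by (simp add: near_def)
          ultimately show "\<bar>m k - w k\<bar> < \<epsilon>" by linarith
        qed
        then show "free_energy q \<beta> y \<le> free_energy q \<beta> w" using min[OF w(1)] eq by simp
      qed (use y g in auto)
      then show False using R0(2)[OF _ ne] n'(2) by blast
    qed
    with min[OF y n'(1)] show ?thesis by simp
  qed
  have "\<exists>\<delta>>0. barrier q \<beta> m r \<delta>"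
    if r: "0 < r" "r \<le> R" for r
  proof (rule ccontr)
    assume neg: "\<not> ?thesis"
    have "\<exists>y. y \<in> prob_simplex q \<and> near q r m y \<and> \<not> near q (r / 2) m y \<and> free_energy q \<beta> y < free_energy q \<beta> m + 1 / real (Suc n)" for n
    proof -
      have "1 / real (Suc n) > 0" by simp
      with neg have "\<not> (\<forall>y\<in>prob_simplex q. near q r m y \<and> \<not> near q (r / 2) m y \<longrightarrow>
        free_energy q \<beta> m + 1 / real (Suc n) \<le> free_energy q \<beta> y)" unfolding barrier_def by blast
      then show ?thesis unfolding not_le[symmetric] by blast
    qed
    then obtain y where y: "\<And>n. y n \<in> prob_simplex q" "\<And>n. near q r m (y n)" "\<And>n. \<not> near q (r / 2) m (y n)"
      "\<And>n. free_energy q \<beta> (y n) < free_energy q \<beta> m + 1 / real (Suc n)" by metis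
    obtain l and s :: "nat \<Rightarrow> nat" where l: "l \<in> prob_simplex q" and s: "strict_mono s"
      and lim: "\<And>k. k \<in> {1..q} \<Longrightarrow> (\<lambda>n. y (s n) k) \<longlonglongrightarrow> l k"
      using simplex_seq_compact[of y q, OF y(1)] by (elim exE conjE) (rule that, auto)
    have F: "(\<lambda>n. free_energy q \<beta> (y (s n))) \<longlonglongrightarrow> free_energy q \<beta> l"
      by (intro free_energy_tendsto y(1) l lim)
    have G: "(\<lambda>n. free_energy q \<beta> m + 1 / real (Suc (s n))) \<longlonglongrightarrow> free_energy q \<beta> m + 0"
    proof (intro tendsto_add tendsto_const)
      show "(\<lambda>n. 1 / real (Suc (s n))) \<longlonglongrightarrow> 0"
        using LIMSEQ_subseq_LIMSEQ[OF LIMSEQ_inverse_real_of_nat s] unfolding o_def inverse_eq_divide .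
    qed
    have le: "free_energy q \<beta> l \<le> free_energy q \<beta> m + 0"
      by (rule LIMSEQ_le[OF F G]) (use y(4) less_imp_le in blast)
    obtain n where n: "near q (r / 2) l (y (s n))"
    proof -
      have "\<forall>\<^sub>F n in sequentially. near q (r / 2) l (y (s n))"
        using r by (intro near_eventually lim) simp_all
      then show thesis using eventually_happens'[OF sequentially_bot] that by blast
    qed
    have "near q (r / 2) (y (s n)) l" using n by (simp only: near_sym[of q "r / 2" l])
    from near_trans[OF y(2) this] have "near q (r + r / 2) m l" .
    then have "near q (2 * R) m l" using r by (elim near_mono) simp
    moreover have "l \<noteq> m" using n y(3)[of "s n"] by auto
    ultimately show False using strict[OF l] le by simp
  qed
  then show ?thesis using R(1) by blast
qed

section \<open>Lattice paths to the minimizers\<close>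

text \<open>Round down all coordinates but the last one, which takes up the accumulated error.\<close>

lemma lattice_approx:
  assumes q: "q \<ge> 1" and N: "N > 0" and x: "x \<in> prob_simplex q"
  obtains c where "c \<in> types q N" "\<And>k. k \<in> {1..q} \<Longrightarrow> \<bar>x k - freq q N c k\<bar> \<le> real q / real N"
proof -
  let ?f = "\<lambda>k. nat \<lfloor>real N * x k\<rfloor>"
  have f: "real (?f k) \<le> real N * x k" "real N * x k < real (?f k) + 1" if "k \<in> {1..q}" for k
  proof -
    have "real (?f k) = of_int \<lfloor>real N * x k\<rfloor>" using simplexD(1)[OF x that] by (simp add: of_nat_nat)
    then show "real (?f k) \<le> real N * x k" "real N * x k < real (?f k) + 1" by linarith+
  qed
  define R where "R = N - (\<Sum>k\<in>{1..<q}. ?f k)"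
  define c where "c = (\<lambda>k\<in>{1..q}. if k = q then R else ?f k)"
  have split: "{1..q} = insert q {1..<q}" using q by auto
  have sx: "x q + (\<Sum>k\<in>{1..<q}. x k) = 1" using simplexD(3)[OF x] unfolding split by simp
  have eqN: "real N - (\<Sum>k\<in>{1..<q}. real N * x k) = real N * x q"
  proof -
    have "(\<Sum>k\<in>{1..<q}. real N * x k) = real N * (1 - x q)"
      using sx unfolding sum_distrib_left[symmetric] by (intro arg_cong2[where f = "(*)"]) linarith+
    then show ?thesis by (simp add: right_diff_distrib)
  qed
  have le: "(\<Sum>k\<in>{1..<q}. real (?f k)) \<le> (\<Sum>k\<in>{1..<q}. real N * x k)"
    using f by (intro sum_mono) auto
  have ge: "(\<Sum>k\<in>{1..<q}. real N * x k) \<le> (\<Sum>k\<in>{1..<q}. real (?f k) + 1)"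
    using f(2) by (intro sum_mono less_imp_le) auto
  have xq: "0 \<le> real N * x q" using simplexD(1)[OF x, of q] q by simp
  have "(\<Sum>k\<in>{1..<q}. ?f k) \<le> N" 
  proof -
    have "real (\<Sum>k\<in>{1..<q}. ?f k) \<le> real N" using le eqN xq unfolding of_nat_sum by linarith
    then show ?thesis by (simp only: of_nat_le_iff)
  qed
  then have R: "real R = real N - (\<Sum>k\<in>{1..<q}. real (?f k))" and sumN: "R + (\<Sum>k\<in>{1..<q}. ?f k) = N"
    unfolding R_def by (auto simp: of_nat_diff)
  have "c \<in> types q N"
  proof (rule typesI)
    have "(\<Sum>k\<in>{1..q}. c k) = c q + (\<Sum>k\<in>{1..<q}. c k)" unfolding split by simp
    also have "(\<Sum>k\<in>{1..<q}. c k) = (\<Sum>k\<in>{1..<q}. ?f k)" by (intro sum.cong) (auto simp: c_def)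
    finally show "(\<Sum>k\<in>{1..q}. c k) = N" using sumN q by (simp add: c_def)
  qed (simp add: c_def)
  moreover have "\<bar>x k - freq q N c k\<bar> \<le> real q / real N" if k: "k \<in> {1..q}" for k
  proof -
    have "\<bar>real N * x k - real (c k)\<bar> \<le> real q"
    proof (cases "k = q")
      case True
      have "(\<Sum>k\<in>{1..<q}. real (?f k) + 1) = (\<Sum>k\<in>{1..<q}. real (?f k)) + (real q - 1)"
        using q by (simp add: sum.distrib of_nat_diff)
      moreover have "real (c k) = real R" using True q by (simp add: c_def)
      ultimately show ?thesis using le ge eqN R True by simp
    next
      case False
      have "real (c k) = real (?f k)" using False k by (simp add: c_def)
      moreover have "real q \<ge> 1" using q by simp
      ultimately show ?thesis using f[OF k] by linarith
    qed
    then have "\<bar>real N * x k - real (c k)\<bar> / real N \<le> real q / real N" by (intro divide_right_mono) auto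
    moreover have "x k - freq q N c k = (real N * x k - real (c k)) / real N"
      using N k by (simp add: freq_def field_simps)
    ultimately show ?thesis by (simp add: abs_divide)
  qed
  ultimately show thesis by (rule that)
qed

lemma closest_lattice_point_near:
  assumes q: "q \<ge> 1" and N: "N > 0" and x: "x \<in> prob_simplex q" and y: "closest_lattice_point q N x y"
  obtains d where "d \<in> types q N" "y = freq q N d" "\<And>k. k \<in> {1..q} \<Longrightarrow> \<bar>x k - freq q N d k\<bar> \<le> (real q)\<^sup>2 / real N"
proof -
  have "y \<in> lattice_simplex q N" using y by (simp add: closest_lattice_point_def is_arg_min_def)
  then obtain d where d: "d \<in> types q N" "y = freq q N d" unfolding lattice_simplex_eq[OF N] by blast
  obtain c where c: "c \<in> types q N" "\<And>k. k \<in> {1..q} \<Longrightarrow> \<bar>x k - freq q N c k\<bar> \<le> real q / real N"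
    using lattice_approx[OF q N x] by blast
  have "freq q N c \<in> lattice_simplex q N" using c(1) unfolding lattice_simplex_eq[OF N] by blast
  then have "euclid_dist q x y \<le> euclid_dist q x (freq q N c)"
    using y by (auto simp: closest_lattice_point_def is_arg_min_def not_less)
  also have "\<dots> \<le> (\<Sum>k\<in>{1..q}. \<bar>x k - freq q N c k\<bar>)"
    unfolding euclid_dist_def by (rule L2_set_le_sum_abs)
  also have "\<dots> \<le> (\<Sum>k\<in>{1..q}. real q / real N)" by (intro sum_mono c(2))
  also have "\<dots> = (real q)\<^sup>2 / real N" by (simp add: power2_eq_square)
  finally have e: "euclid_dist q x y \<le> (real q)\<^sup>2 / real N" .
  have "\<bar>x k - freq q N d k\<bar> \<le> (real q)\<^sup>2 / real N" if "k \<in> {1..q}" for k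
  proof (rule ccontr)
    assume "\<not> ?thesis"
    then have "euclid_dist q x y < \<bar>x k - freq q N d k\<bar>" using e by simp
    then show False using near_of_euclid_dist_less that d(2) by (fastforce simp: near_def)
  qed
  with d show thesis by (rule that)
qed

lemma eventually_poly_le_exp:
  assumes e: "\<epsilon> > 0" and A: "A \<ge> (0::real)"
  shows "\<exists>N0::nat. \<forall>N>N0. A * (real N + 1) ^ B \<le> exp (\<epsilon> * real N)"
proof -
  have "filterlim (\<lambda>N. real N + 1) at_top sequentially"
    by (rule filterlim_at_top_mono[OF filterlim_real_sequentially]) simp
  then have f: "filterlim (\<lambda>N. \<epsilon> * (real N + 1)) at_top sequentially"
    by (rule filterlim_tendsto_pos_mult_at_top[OF tendsto_const e])
  have "((\<lambda>N. (\<epsilon> * (real N + 1)) ^ B / exp (\<epsilon> * (real N + 1))) \<longlongrightarrow> 0) sequentially"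
    by (rule filterlim_compose[OF tendsto_power_div_exp_0 f])
  moreover have c: "\<epsilon> ^ B / ((A + 1) * exp \<epsilon>) > 0" using e A by simp
  ultimately have "\<forall>\<^sub>F N in sequentially. (\<epsilon> * (real N + 1)) ^ B / exp (\<epsilon> * (real N + 1)) < \<epsilon> ^ B / ((A + 1) * exp \<epsilon>)"
    by (rule order_tendstoD(2))
  then obtain N0 where N0: "\<And>N. N \<ge> N0 \<Longrightarrow> (\<epsilon> * (real N + 1)) ^ B / exp (\<epsilon> * (real N + 1)) < \<epsilon> ^ B / ((A + 1) * exp \<epsilon>)"
    unfolding eventually_sequentially by blast
  have "A * (real N + 1) ^ B \<le> exp (\<epsilon> * real N)" if "N > N0" for N
  proof -
    define X where "X = (real N + 1) ^ B"
    have ex: "exp (\<epsilon> * (real N + 1)) = exp (\<epsilon> * real N) * exp \<epsilon>"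
      by (simp add: distrib_left exp_add)
    have "\<epsilon> ^ B * X / (exp (\<epsilon> * real N) * exp \<epsilon>) < \<epsilon> ^ B / ((A + 1) * exp \<epsilon>)"
      using N0[of N] that unfolding power_mult_distrib ex X_def by simp
    then have "\<epsilon> ^ B / exp \<epsilon> * (X / exp (\<epsilon> * real N)) < \<epsilon> ^ B / exp \<epsilon> * (1 / (A + 1))"
      by (simp only: times_divide_times_eq ac_simps mult_1_right)
    then have "X / exp (\<epsilon> * real N) < 1 / (A + 1)"
      using e by (simp only: mult_less_cancel_left_pos zero_less_power exp_gt_zero divide_pos_pos)
    then have "(A + 1) * X < exp (\<epsilon> * real N)" using A by (simp add: field_simps)
    moreover have "X \<ge> 0" by (simp add: X_def)
    ultimately have "A * X \<le> exp (\<epsilon> * real N)" by (simp add: distrib_right)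
    then show ?thesis by (simp add: X_def)
  qed
  then show ?thesis by blast
qed

lemma eventually_divide_less:
  assumes "e > (0::real)" shows "\<exists>N0::nat. \<forall>N>N0. a / real N < e"
proof -
  obtain N0 :: nat where N0: "a / e < real N0" using reals_Archimedean2 by blast
  have "a / real N < e" if "N > N0" for N
  proof -
    have "a / e < real N" using N0 that by (meson less_trans of_nat_less_iff)
    moreover have "real N > 0" using that by simp
    ultimately show ?thesis using assms by (simp add: field_simps)
  qed
  then show ?thesis by blast
qed

lemma finite_uniform_pos:
  assumes "finite I" and "\<And>i. i \<in> I \<Longrightarrow> \<exists>e>0. P i (e::real)"
    and mono: "\<And>i e e'. i \<in> I \<Longrightarrow> P i e \<Longrightarrow> 0 < e' \<Longrightarrow> e' \<le> e \<Longrightarrow> P i e'"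
  shows "\<exists>e>0. \<forall>i\<in>I. P i e"
proof -
  obtain f where f: "\<And>i. i \<in> I \<Longrightarrow> f i > 0 \<and> P i (f i)" using assms(2) by metis
  define e where "e = Min (insert 1 (f ` I))"
  have "e > 0" unfolding e_def using assms(1) f by (subst Min_gr_iff) auto
  moreover have "P i e" if "i \<in> I" for i
  proof (rule mono[OF that])
    show "P i (f i)" using f[OF that] by simp
    show "e \<le> f i" unfolding e_def using assms(1) that by (intro Min_le) auto
  qed fact
  ultimately show ?thesis by blast
qed

text \<open>Among the lattice points that can be reached from \<open>c\<close> let \<open>e\<close> have the least free energy.  The free
energy varies by less than \<open>\<epsilon>\<close> on the \<open>\<delta>\<close>-neighbourhood of \<open>e\<close>, so all lattice points there can be reached as well,
and \<open>e\<close> is minimal among them.  Hence \<open>e\<close> is close to a local minimizer, and the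
lattice points near the latter can be reached.\<close>

lemma lattice_descent:
  assumes q: "q \<ge> 1" and e: "\<epsilon> > 0"
  shows "\<exists>r>0. \<exists>N0. \<forall>N>N0. \<forall>c\<in>types q N. \<exists>x. local_minimizer q (free_energy q \<beta>) x \<and>
    (\<forall>d\<in>types q N. near q r x (freq q N d) \<longrightarrow> almost_downhill q \<beta> N \<epsilon> c d)"
proof -
  obtain \<delta> where d: "\<delta> > 0" and du: "\<And>x y. x \<in> prob_simplex q \<Longrightarrow> y \<in> prob_simplex q \<Longrightarrow> near q \<delta> x y \<Longrightarrow>
    \<bar>free_energy q \<beta> x - free_energy q \<beta> y\<bar> < \<epsilon>" by (rule free_energy_uniform[OF q e, where \<beta> = \<beta>]) (rule that; blast)
  have d2: "\<delta> / 2 > 0" using d by simp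
  obtain \<rho> where rho: "\<rho> > 0" and almost: "\<And>y. y \<in> prob_simplex q \<Longrightarrow>
    (\<And>w. w \<in> prob_simplex q \<Longrightarrow> near q (\<delta> / 2) y w \<Longrightarrow> free_energy q \<beta> y - \<rho> \<le> free_energy q \<beta> w) \<Longrightarrow>
    \<exists>x. local_minimizer q (free_energy q \<beta>) x \<and> near q (\<delta> / 2) x y"
    using near_minimizers_of_almost_minimizers[OF q d2 d2, of \<beta>] by blast
  obtain \<gamma> where g: "\<gamma> > 0" and gu: "\<And>x y. x \<in> prob_simplex q \<Longrightarrow> y \<in> prob_simplex q \<Longrightarrow> near q \<gamma> x y \<Longrightarrow>
    \<bar>free_energy q \<beta> x - free_energy q \<beta> y\<bar> < \<rho>" by (rule free_energy_uniform[OF q rho, where \<beta> = \<beta>]) (rule that; blast)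
  have "min (\<delta> / 2) \<gamma> > 0" using d g by simp
  then obtain N0 :: nat where N0: "\<And>N. N > N0 \<Longrightarrow> real q / real N < min (\<delta> / 2) \<gamma>"
    using eventually_divide_less by blast
  have "\<exists>x. local_minimizer q (free_energy q \<beta>) x \<and>
    (\<forall>d\<in>types q N. near q (\<delta> / 2) x (freq q N d) \<longrightarrow> almost_downhill q \<beta> N \<epsilon> c d)"
    if N: "N > N0" and c: "c \<in> types q N" for N c
  proof -
    have Npos: "N > 0" using N by simp
    let ?F = "\<lambda>e. free_energy q \<beta> (freq q N e)"
    define V where "V = {e \<in> types q N. ?F e \<le> ?F c + \<epsilon>}"
    define C where "C = {e. (c, e) \<in> (type_edges q V)\<^sup>*}"
    have cC: "c \<in> C" by (simp add: C_def)
    have Ct: "C \<subseteq> types q N"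
    proof
      fix e assume "e \<in> C"
      then have "(c, e) \<in> (type_edges q V)\<^sup>*" by (simp add: C_def)
      then show "e \<in> types q N"
        by (cases rule: rtranclE) (use c in \<open>auto simp: type_edges_def V_def\<close>)
    qed
    have finC: "finite C" using Ct finite_types by (rule finite_subset)
    have "Min (?F ` C) \<in> ?F ` C" using cC finC by (intro Min_in) auto
    then obtain e where eC: "e \<in> C" and eq: "Min (?F ` C) = ?F e" by blast
    have emin: "?F e \<le> ?F f" if "f \<in> C" for f
      unfolding eq[symmetric] using that finC by (intro Min_le) auto
    have et: "e \<in> types q N" using eC Ct by blast
    note simplex = freq_simplex[OF Npos]
    have reach: "d \<in> C" if d: "d \<in> types q N" and n: "near q \<delta> (freq q N e) (freq q N d)" for d
    proof -
      have "(e, d) \<in> (type_edges q V)\<^sup>*"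
      proof (rule type_path_between[OF et d])
        fix f assume f: "f \<in> types q N" and btw: "\<And>k. k \<in> {1..q} \<Longrightarrow> min (e k) (d k) \<le> f k \<and> f k \<le> max (e k) (d k)"
        have "near q \<delta> (freq q N e) (freq q N f)"
          unfolding near_def
        proof
          fix k assume k: "k \<in> {1..q}"
          have "\<bar>real (e k) - real (f k)\<bar> \<le> \<bar>real (e k) - real (d k)\<bar>" using btw[OF k] by auto
          then have "\<bar>real (e k) - real (f k)\<bar> / real N \<le> \<bar>real (e k) - real (d k)\<bar> / real N"
            by (rule divide_right_mono) simp
          moreover have "\<bar>freq q N e k - freq q N d k\<bar> < \<delta>" using n k by (simp add: near_def)
          ultimately show "\<bar>freq q N e k - freq q N f k\<bar> < \<delta>"
            using k by (simp add: freq_def abs_divide flip: diff_divide_distrib)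
        qed
        then have "\<bar>?F e - ?F f\<bar> < \<epsilon>" by (rule du[OF simplex[OF et] simplex[OF f]])
        then have "?F f \<le> ?F c + \<epsilon>" using emin[OF cC] by linarith
        then show "f \<in> V" using f by (simp add: V_def)
      qed
      then show ?thesis using eC unfolding C_def by (auto intro: rtrancl_trans)
    qed
    have "\<exists>x. local_minimizer q (free_energy q \<beta>) x \<and> near q (\<delta> / 2) x (freq q N e)"
    proof (rule almost[OF simplex[OF et]])
      fix w assume w: "w \<in> prob_simplex q" and n: "near q (\<delta> / 2) (freq q N e) w"
      obtain d where d: "d \<in> types q N" "\<And>k. k \<in> {1..q} \<Longrightarrow> \<bar>w k - freq q N d k\<bar> \<le> real q / real N"
        by (rule lattice_approx[OF q Npos w]) (rule that; blast)
      have wd: "near q (min (\<delta> / 2) \<gamma>) w (freq q N d)"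
        unfolding near_def using d(2) N0[OF N] by (blast intro: le_less_trans)
      have "near q (\<delta> / 2 + \<delta> / 2) (freq q N e) (freq q N d)"
        by (rule near_trans[OF n near_mono[OF wd]]) simp
      then have "?F e \<le> ?F d" using emin reach[OF d(1)] by simp
      moreover have "\<bar>free_energy q \<beta> w - ?F d\<bar> < \<rho>"
        by (rule gu[OF w simplex[OF d(1)] near_mono[OF wd]]) simp
      ultimately show "?F e - \<rho> \<le> free_energy q \<beta> w" by linarith
    qed
    then obtain x where x: "local_minimizer q (free_energy q \<beta>) x" "near q (\<delta> / 2) x (freq q N e)" by blast
    have "(c, d) \<in> (type_edges q V)\<^sup>*" if d: "d \<in> types q N" "near q (\<delta> / 2) x (freq q N d)" for d
    proof -
      have "near q (\<delta> / 2) (freq q N e) x" using x(2) by (simp only: near_sym[of q "\<delta> / 2" x])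
      from near_trans[OF this d(2)] have "near q \<delta> (freq q N e) (freq q N d)" by simp
      then show ?thesis using reach[OF d(1)] by (simp add: C_def)
    qed
    then show ?thesis using x(1) unfolding V_def almost_downhill_def by blast
  qed
  then show ?thesis using d2 by blast
qed

lemma finite_index_set: "finite (index_set q \<beta>)" and card_index_set: "card (index_set q \<beta>) \<le> q + 1"
  by (auto simp: index_set_def)

lemma index_set_nonempty: "q \<ge> 1 \<Longrightarrow> index_set q \<beta> \<noteq> {}"
  by (auto simp: index_set_def)

section \<open>Metastability\<close>

text \<open>Finitely many metastable points admit a common radius and a common barrier height.\<close>

lemma uniform_landscape:
  assumes q: "q \<ge> 2" and \<beta>: "\<beta> > beta1 q"
  obtains r \<delta> where "r > 0" "\<delta> > 0"
    "\<And>i j. i \<in> index_set q \<beta> \<Longrightarrow> j \<in> index_set q \<beta> \<Longrightarrow> i \<noteq> j \<Longrightarrow> \<not> near q (r + r) (m_point q \<beta> i) (m_point q \<beta> j)"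
    "\<And>i. i \<in> index_set q \<beta> \<Longrightarrow> barrier q \<beta> (m_point q \<beta> i) r \<delta>"
proof -
  let ?I = "index_set q \<beta>" and ?m = "m_point q \<beta>" and ?F = "free_energy q \<beta>"
  have q1: "q \<ge> 1" using q by simp
  note mins = local_minimizers_eq[OF q \<beta>] and props = m_point_props[OF q \<beta>]
  define P where "P i R \<longleftrightarrow> (\<forall>r. 0 < r \<and> r \<le> R \<longrightarrow> (\<exists>\<delta>>0. barrier q \<beta> (?m i) r \<delta>))
      \<and> (\<forall>j\<in>?I. i \<noteq> j \<longrightarrow> \<not> near q (R + R) (?m i) (?m j))" for i R
  have "\<exists>R>0. \<forall>i\<in>?I. P i R"
  proof (rule finite_uniform_pos[OF finite_index_set])
    fix i assume i: "i \<in> ?I"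
    have loc: "local_minimizer q ?F (?m i)" using mins i by blast
    have fin: "finite {x. local_minimizer q ?F x}" unfolding mins by (simp add: finite_index_set)
    obtain R1 where R1: "R1 > 0" "\<And>r. 0 < r \<Longrightarrow> r \<le> R1 \<Longrightarrow> \<exists>\<delta>>0. barrier q \<beta> (?m i) r \<delta>"
      using minimizer_barrier[OF q1 loc fin] by blast
    have "\<exists>R>0. \<forall>j\<in>?I - {i}. \<not> near q R (?m i) (?m j)"
    proof (rule finite_uniform_pos)
      fix j assume j: "j \<in> ?I - {i}"
      then have "?m i \<noteq> ?m j" using props(1) i by (auto dest: inj_onD)
      then show "\<exists>e>0. \<not> near q e (?m i) (?m j)"
        using simplex_separated[OF props(2)[OF i] props(2)[of j]] j by blast
    qed (use near_mono in \<open>auto simp: finite_index_set\<close>)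
    then obtain R2 where R2: "R2 > 0" "\<And>j. j \<in> ?I \<Longrightarrow> i \<noteq> j \<Longrightarrow> \<not> near q R2 (?m i) (?m j)" by blast
    have "P i (min R1 (R2 / 2))"
      unfolding P_def
    proof (intro conjI allI impI ballI)
      fix j assume "j \<in> ?I" "i \<noteq> j"
      then show "\<not> near q (min R1 (R2 / 2) + min R1 (R2 / 2)) (?m i) (?m j)"
        using R2(2)[of j] near_mono[of q "min R1 (R2 / 2) + min R1 (R2 / 2)" "?m i" "?m j" R2] by (auto simp: min_def)
    qed (use R1(2) in auto)
    then show "\<exists>e>0. P i e" using R1(1) R2(1) by (intro exI[of _ "min R1 (R2 / 2)"]) auto
  next
    fix i e e' assume a: "P i e" "0 < e'" "e' \<le> e"
    have n: "near q (e' + e') (?m i) (?m j) \<Longrightarrow> near q (e + e) (?m i) (?m j)" for j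
      using a(3) by (elim near_mono) simp
    show "P i e'" using a n unfolding P_def by (meson order_trans)
  qed
  then obtain r where r: "r > 0" "\<And>i. i \<in> ?I \<Longrightarrow> P i r" by blast
  have "\<exists>\<delta>>0. \<forall>i\<in>?I. barrier q \<beta> (?m i) r \<delta>"
  proof (rule finite_uniform_pos[OF finite_index_set])
    show "\<exists>\<delta>>0. barrier q \<beta> (?m i) r \<delta>" if "i \<in> ?I" for i
      using r(1) r(2)[OF that] unfolding P_def by blast
  qed (force simp: barrier_def)
  then obtain \<delta> where d: "\<delta> > 0" "\<And>i. i \<in> ?I \<Longrightarrow> barrier q \<beta> (?m i) r \<delta>"
    by blast
  show thesis
    by (rule that[OF r(1) d(1) _ d(2)]) (use r(2) in \<open>auto simp: P_def\<close>)
qed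

lemma (in cwp) escape_exponential:
  assumes d: "d \<in> types q N" and T: "T \<subseteq> configs q N" and r: "1 / real N < r / 2"
    and dn: "near q (r / 2) m (freq q N d)" and far: "\<And>\<sigma>. \<sigma> \<in> T \<Longrightarrow> \<not> near q r m (empirical q N \<sigma>)"
    and barrier: "\<And>y. y \<in> prob_simplex q \<Longrightarrow> near q r m y \<Longrightarrow> \<not> near q (r / 2) m y \<Longrightarrow>
      free_energy q \<beta> (freq q N d) + \<delta> \<le> free_energy q \<beta> y"
  shows "escape_prob T (cell q N d)
    \<le> exp (real q) * (real N + 1) ^ (2 * q) * exp (- (\<beta> * \<delta> * real N))"
proof -
  define E where "E = exp (\<beta> * (- \<delta>) * real N) * (exp (real q) * (real N + 1) ^ q)"
  have Qd: "Q d > 0" by (rule mass_pos[OF q d])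
  have "escape_prob T (cell q N d)
      \<le> real ((N + 1) ^ q) * (Q d * E) / Q d"
  proof (rule escape_le[OF d T r dn far])
    show "0 \<le> Q d * E" using Qd by (simp add: E_def)
    fix c assume c: "c \<in> types q N" and n: "near q r m (freq q N c)" "\<not> near q (r / 2) m (freq q N c)"
    have "FN d - FN c \<le> - \<delta>" using barrier[OF freq_simplex[OF N c] n] by simp
    then show "Q c \<le> Q d * E" unfolding E_def by (rule mass_ratio_le[OF c d])
  qed
  also have "\<dots> = (real N + 1) ^ q * E" using Qd by (simp add: add.commute)
  also have "\<dots> = exp (real q) * (real N + 1) ^ (2 * q) * exp (- (\<beta> * \<delta> * real N))"
    by (simp add: E_def mult_2 power_add)
  finally show ?thesis .
qed

theorem theorem1p7:
  fixes q :: nat and \<beta> :: real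
  assumes "q \<ge> 2" and "\<beta> > beta1 q"
  shows "\<exists>k1>0. \<forall>k. 0 < k \<and> k < k1 \<longrightarrow>
    (\<exists>N0::nat. \<forall>N>N0. \<forall>m :: nat \<Rightarrow> nat \<Rightarrow> real.
       (\<forall>i\<in>index_set q \<beta>. closest_lattice_point q N (m_point q \<beta> i) (m i)) \<longrightarrow>
       metastable (\<lambda>n. exp (- k * real n)) N (configs q N) (gibbs q \<beta> N) (cwp_kernel q \<beta> N)
         (index_set q \<beta>) (\<lambda>i. fibre q N (m i)))"
proof -
  note q = assms(1) and \<beta>1 = assms(2)
  let ?I = "index_set q \<beta>" and ?p = "m_point q \<beta>" and ?F = "free_energy q \<beta>"
  have q1: "q \<ge> 1" using q by simp
  have \<beta>: "\<beta> > 0" using beta1_gtD(1)[OF q \<beta>1] .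
  note mins = local_minimizers_eq[OF q \<beta>1] and props = m_point_props[OF q \<beta>1]
  obtain r \<delta> where r: "r > 0" and \<delta>: "\<delta> > 0"
    and sep: "\<And>i j. i \<in> ?I \<Longrightarrow> j \<in> ?I \<Longrightarrow> i \<noteq> j \<Longrightarrow> \<not> near q (r + r) (?p i) (?p j)"
    and barrier: "\<And>i. i \<in> ?I \<Longrightarrow> barrier q \<beta> (?p i) r \<delta>"
    by (rule uniform_landscape[OF q \<beta>1]) (rule that; blast)
  have "\<delta> / 4 > 0" "\<delta> / 2 > 0" using \<delta> by auto
  obtain r' N1 where r': "r' > 0" and descent: "\<And>N c. N > N1 \<Longrightarrow> c \<in> types q N \<Longrightarrow> \<exists>x. local_minimizer q ?F x \<and>
    (\<forall>d\<in>types q N. near q r' x (freq q N d) \<longrightarrow> almost_downhill q \<beta> N (\<delta> / 4) c d)"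
    using lattice_descent[OF q1 \<open>\<delta> / 4 > 0\<close>, of \<beta>] by blast
  obtain \<gamma> where \<gamma>: "\<gamma> > 0" and cont: "\<And>x y. x \<in> prob_simplex q \<Longrightarrow> y \<in> prob_simplex q \<Longrightarrow> near q \<gamma> x y \<Longrightarrow> \<bar>?F x - ?F y\<bar> < \<delta> / 2"
    by (rule free_energy_uniform[OF q1 \<open>\<delta> / 2 > 0\<close>, where \<beta> = \<beta>]) (rule that; blast)
  have "\<exists>a>0. \<forall>i\<in>?I. a < ?p i 2"
  proof (rule finite_uniform_pos[OF finite_index_set])
    show "\<exists>a>0. a < ?p i 2" if "i \<in> ?I" for i
      using props(3)[OF that, of 2] q by (intro dense) auto
  qed auto
  then obtain a where a: "a > 0" "\<And>i. i \<in> ?I \<Longrightarrow> a < ?p i 2" by blast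
  \<comment> \<open>The metastable lattice points must be closer than this to the minimizers.  The bound \<open>a\<close> keeps them away from
the boundary, so that the constant configuration lies in no metastable set.\<close>
  define s where "s = min (min r' (r / 2)) (min \<gamma> a)"
  have s: "s > 0" "s \<le> r'" "s \<le> r / 2" "s \<le> \<gamma>" "s \<le> a" using r' r \<gamma> a by (auto simp: s_def)
  obtain N2 :: nat where N2: "\<And>N. N > N2 \<Longrightarrow> (real q)\<^sup>2 / real N < s"
    using eventually_divide_less[OF s(1)] by blast
  \<comment> \<open>Up to polynomial factors the numerator is at most \<open>exp (- 2 k1 N)\<close> and the denominator at least \<open>exp (- k1 N)\<close>.\<close>
  define k1 where "k1 = \<beta> * \<delta> / 4"
  define A where "A = (real q + 1) * (2 * real q * exp (\<beta> + real q) * exp (real q))"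
  have k1: "k1 > 0" using \<beta> \<delta> by (simp add: k1_def)
  show ?thesis
  proof (rule exI[of _ k1], intro conjI allI impI)
    show "k1 > 0" by fact
    fix k assume k: "0 < k \<and> k < k1"
    have "A \<ge> 0" by (simp add: A_def)
    \<comment> \<open>The gap between \<open>k\<close> and \<open>k1\<close> absorbs the polynomial factors and the number of metastable sets.\<close>
    with k obtain N3 :: nat where N3: "\<And>N. N > N3 \<Longrightarrow> A * (real N + 1) ^ (8 * q + 1) \<le> exp ((k1 - k) * real N)"
      using eventually_poly_le_exp[of "k1 - k" A "8 * q + 1"] by auto
    show "\<exists>N0::nat. \<forall>N>N0. \<forall>m :: nat \<Rightarrow> nat \<Rightarrow> real.
       (\<forall>i\<in>?I. closest_lattice_point q N (?p i) (m i)) \<longrightarrow>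
       metastable (\<lambda>n. exp (- k * real n)) N (configs q N) (gibbs q \<beta> N) (cwp_kernel q \<beta> N) ?I (\<lambda>i. fibre q N (m i))"
    proof (rule exI[of _ "max N1 (max N2 N3)"], intro allI impI)
      fix N and m :: "nat \<Rightarrow> nat \<Rightarrow> real"
      assume NN: "N > max N1 (max N2 N3)" and m: "\<forall>i\<in>?I. closest_lattice_point q N (?p i) (m i)"
      have N: "N > 0" and N1: "N > N1" and N2': "(real q)\<^sup>2 / real N < s"
        and N3': "A * (real N + 1) ^ (8 * q + 1) \<le> exp ((k1 - k) * real N)"
        using NN N2 N3 by auto
      interpret cwp q N \<beta> by unfold_locales (use q1 N \<beta> in auto)
      have "\<exists>d. d \<in> types q N \<and> m i = freq q N d \<and> near q s (?p i) (freq q N d)" if i: "i \<in> ?I" for i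
      proof -
        obtain d where d: "d \<in> types q N" "m i = freq q N d" "\<And>k. k \<in> {1..q} \<Longrightarrow> \<bar>?p i k - freq q N d k\<bar> \<le> (real q)\<^sup>2 / real N"
          by (rule closest_lattice_point_near[OF q1 N props(2)[OF i] m[rule_format, OF i]]) (rule that; blast)
        then have "near q s (?p i) (freq q N d)"
          unfolding near_def using N2' by (blast intro: le_less_trans)
        then show ?thesis using d by blast
      qed
      then obtain d where d: "\<And>i. i \<in> ?I \<Longrightarrow> d i \<in> types q N" "\<And>i. i \<in> ?I \<Longrightarrow> m i = freq q N (d i)"
        "\<And>i. i \<in> ?I \<Longrightarrow> near q s (?p i) (freq q N (d i))" by metis
      have fib: "fibre q N (m i) = cell q N (d i)" if "i \<in> ?I" for i
        using d(2)[OF that] fibre_freq[OF N d(1)[OF that]] by simp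
      let ?S = "configs q N" and ?\<mu> = "gibbs q \<beta> N" and ?K = "cwp_kernel q \<beta> N"
      let ?M = "\<lambda>i. fibre q N (m i)"
      define U where "U = (\<Union>i\<in>?I. ?M i)"
      have MS: "?M i \<subseteq> ?S" for i by (auto simp: fibre_def)
      have US: "U \<subseteq> ?S" using MS by (auto simp: U_def)
      have emp: "empirical q N \<sigma> = m i" if "\<sigma> \<in> ?M i" for \<sigma> i using that by (simp add: fibre_def)
      have Mne: "?M i \<noteq> {}" if "i \<in> ?I" for i
        using cell_nonempty[OF q1 d(1)[OF that]] fib[OF that] by simp
      have dr: "near q (r / 2) (?p i) (m i)" if "i \<in> ?I" for i
        using near_mono[OF d(3)[OF that] s(3)] d(2)[OF that] by simp
      have far: "\<not> near q r (?p j) (m i)" if ij: "i \<in> ?I" "j \<in> ?I" "i \<noteq> j" for i j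
      proof
        assume n: "near q r (?p j) (m i)"
        have "near q r (m i) (?p i)"
          using near_mono[OF dr[OF ij(1)], of r] r near_sym[of q r "m i"] by simp
        from near_trans[OF n this] show False using sep[of j i] ij by simp
      qed
      have m_inj: "m i \<noteq> m j" if "i \<in> ?I" "j \<in> ?I" "i \<noteq> j" for i j
        using far[OF that] near_mono[OF dr[OF that(2)], of r] r by auto
      have disj: "disjoint_family_on ?M ?I"
        unfolding disjoint_family_on_def using emp m_inj by (metis disjoint_iff)
      have U_ne: "U \<noteq> ?S"
      proof
        let ?\<sigma> = "\<lambda>i\<in>{1..N}. 1::nat"
        assume "U = ?S"
        moreover have "?\<sigma> \<in> ?S" using q1 by (auto simp: configs_def)
        ultimately obtain i where i: "i \<in> ?I" "?\<sigma> \<in> ?M i" unfolding U_def by blast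
        have "empirical q N ?\<sigma> 2 = 0" using assms(1) by (simp add: empirical_def)
        then have "m i 2 = 0" unfolding emp[OF i(2)] .
        moreover have "\<bar>?p i 2 - m i 2\<bar> < s" using d(2,3)[OF i(1)] assms(1) by (simp add: near_def)
        ultimately show False using a(2)[OF i(1)] s(5) by simp
      qed
      define num where "num = (MAX j\<in>?I. prob_before (cond_pmf ?\<mu> (?M j)) ?K (U - ?M j) (?M j))"
      define den where "den = (MIN X\<in>{X. X \<noteq> {} \<and> X \<subseteq> ?S - U}. prob_before (cond_pmf ?\<mu> X) ?K U X)"
      define C where "C = 2 * real q * exp (\<beta> + real q) * (real N + 1) ^ (6 * q + 1)"
      have C: "C > 0" using q1 by (simp add: C_def)
      have num_le: "num \<le> exp (real q) * (real N + 1) ^ (2 * q) * exp (- (2 * k1 * real N))"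
        unfolding num_def
      proof (rule Max.boundedI)
        fix x assume "x \<in> (\<lambda>j. prob_before (cond_pmf ?\<mu> (?M j)) ?K (U - ?M j) (?M j)) ` ?I"
        then obtain j where j: "j \<in> ?I" and x: "x = prob_before (cond_pmf ?\<mu> (?M j)) ?K (U - ?M j) (?M j)" by blast
        have "prob_before (cond_pmf ?\<mu> (cell q N (d j))) ?K (U - ?M j) (cell q N (d j))
          \<le> exp (real q) * (real N + 1) ^ (2 * q) * exp (- (\<beta> * (\<delta> / 2) * real N))"
        proof (rule escape_exponential[OF d(1)[OF j], where r = r and m = "?p j"])
          show "U - ?M j \<subseteq> ?S" using US by blast
          have "1 / real N \<le> (real q)\<^sup>2 / real N" using q1 by (intro divide_right_mono) auto
          then show "1 / real N < r / 2" using N2' s(3) by linarith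
          show "near q (r / 2) (?p j) (freq q N (d j))" using dr[OF j] d(2)[OF j] by simp
          show "\<not> near q r (?p j) (empirical q N \<sigma>)" if \<sigma>: "\<sigma> \<in> U - ?M j" for \<sigma>
          proof -
            obtain i where i: "i \<in> ?I" "\<sigma> \<in> ?M i" using \<sigma> by (auto simp: U_def)
            then have "i \<noteq> j" using \<sigma> by auto
            then show ?thesis using far[OF i(1) j] emp[OF i(2)] by simp
          qed
          fix y assume y: "y \<in> prob_simplex q" "near q r (?p j) y" "\<not> near q (r / 2) (?p j) y"
          have "\<bar>?F (?p j) - ?F (freq q N (d j))\<bar> < \<delta> / 2"
            using near_mono[OF d(3)[OF j] s(4)] by (rule cont[OF props(2)[OF j] freq_simplex[OF N d(1)[OF j]]])
          moreover have "?F (?p j) + \<delta> \<le> ?F y" using barrier[OF j] y by (simp add: barrier_def)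
          ultimately show "?F (freq q N (d j)) + \<delta> / 2 \<le> ?F y" by linarith
        qed
        then show "x \<le> exp (real q) * (real N + 1) ^ (2 * q) * exp (- (2 * k1 * real N))"
          unfolding x fib[OF j] by (simp add: k1_def)
      qed (use finite_index_set index_set_nonempty[OF q1] in auto)
      have den_ge: "exp (- (k1 * real N)) / C \<le> den"
        unfolding den_def
      proof (rule Min.boundedI)
        have "{X. X \<noteq> {} \<and> X \<subseteq> ?S - U} \<subseteq> Pow ?S" by auto
        then have "finite {X. X \<noteq> {} \<and> X \<subseteq> ?S - U}" by (rule finite_subset) (simp add: finite_configs)
        then show "finite ((\<lambda>X. prob_before (cond_pmf ?\<mu> X) ?K U X) ` {X. X \<noteq> {} \<and> X \<subseteq> ?S - U})" by simp
        have "?S - U \<noteq> {}" using US U_ne by blast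
        then show "(\<lambda>X. prob_before (cond_pmf ?\<mu> X) ?K U X) ` {X. X \<noteq> {} \<and> X \<subseteq> ?S - U} \<noteq> {}" by blast
        fix x assume "x \<in> (\<lambda>X. prob_before (cond_pmf ?\<mu> X) ?K U X) ` {X. X \<noteq> {} \<and> X \<subseteq> ?S - U}"
        then obtain X where X: "X \<subseteq> ?S - U" "X \<noteq> {}" and x: "x = prob_before (cond_pmf ?\<mu> X) ?K U X" by blast
        have "exp (- (\<beta> * (\<delta> / 4) * real N)) / (2 * real q * exp (\<beta> + real q) * (real N + 1) ^ (6 * q + 1))
          \<le> prob_before (cond_pmf ?\<mu> X) ?K U X"
        proof (rule return_ge[OF US X])
          fix c assume c: "c \<in> types q N"
          obtain y where y: "local_minimizer q ?F y" "\<And>e. e \<in> types q N \<Longrightarrow> near q r' y (freq q N e) \<Longrightarrow>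
              almost_downhill q \<beta> N (\<delta> / 4) c e"
            using descent[OF N1 c] by blast
          then obtain i where i: "i \<in> ?I" "y = ?p i" using mins by blast
          have "near q r' y (freq q N (d i))" unfolding i(2) by (rule near_mono[OF d(3)[OF i(1)] s(2)])
          moreover have "cell q N (d i) \<subseteq> U" using fib[OF i(1)] i(1) by (auto simp: U_def)
          ultimately show "\<exists>e. cell q N e \<subseteq> U \<and>
              almost_downhill q \<beta> N (\<delta> / 4) c e"
            using y(2)[OF d(1)[OF i(1)]] by blast
        qed (use \<delta> in simp)
        then show "exp (- (k1 * real N)) / C \<le> x" by (simp add: x k1_def C_def)
      qed
      then have den_pos: "den > 0" using C by (smt (verit) divide_pos_pos exp_gt_zero)
      have "real (card ?I) * (num / den) \<le> exp (- k * real N)"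
      proof -
        have "num / den \<le> (exp (real q) * (real N + 1) ^ (2 * q) * exp (- (2 * k1 * real N))) / (exp (- (k1 * real N)) / C)"
          using num_le den_ge C by (intro frac_le) auto
        also have "\<dots> = (exp (real q) * (real N + 1) ^ (2 * q) * C) * exp (- (k1 * real N))"
        proof -
          have "exp (- (2 * k1 * real N)) = exp (- (k1 * real N)) * exp (- (k1 * real N))"
            by (simp flip: exp_add)
          then show ?thesis using C by (simp add: field_simps)
        qed
        finally have nd: "num / den \<le> (exp (real q) * (real N + 1) ^ (2 * q) * C) * exp (- (k1 * real N))" .
        have "real (card ?I) \<le> real q + 1" using card_index_set[of q \<beta>] by linarith
        then have "real (card ?I) * (num / den) \<le> real (card ?I) * ((exp (real q) * (real N + 1) ^ (2 * q) * C) * exp (- (k1 * real N)))"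
          using nd by (intro mult_left_mono) auto
        also have "\<dots> \<le> (real q + 1) * ((exp (real q) * (real N + 1) ^ (2 * q) * C) * exp (- (k1 * real N)))"
          using \<open>real (card ?I) \<le> real q + 1\<close> C by (intro mult_right_mono) auto
        also have "\<dots> = A * (real N + 1) ^ (8 * q + 1) * exp (- (k1 * real N))"
        proof -
          have "(real N + 1) ^ (8 * q + 1) = (real N + 1) ^ (2 * q) * (real N + 1) ^ (6 * q + 1)"
            by (simp flip: power_add)
          then show ?thesis unfolding A_def C_def by (simp only: ac_simps)
        qed
        also have "\<dots> \<le> exp ((k1 - k) * real N) * exp (- (k1 * real N))"
          using N3' by (intro mult_right_mono) auto
        also have "\<dots> = exp (- k * real N)" by (simp add: algebra_simps flip: exp_add)
        finally show ?thesis .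
      qed
      moreover have "(\<lambda>n. exp (- k * real n)) \<longlonglongrightarrow> 0"
      proof -
        have "(\<lambda>n. exp (- k) ^ n) \<longlonglongrightarrow> 0" using k by (intro LIMSEQ_realpow_zero) auto
        then show ?thesis by (simp add: mult.commute flip: exp_of_nat_mult)
      qed
      ultimately show "metastable (\<lambda>n. exp (- k * real n)) N ?S ?\<mu> ?K ?I ?M"
        unfolding metastable_def Let_def U_def[symmetric] num_def[symmetric] den_def[symmetric]
        using fin support closed invariant finite_index_set index_set_nonempty[OF q1] Mne MS disj U_ne den_pos by auto
    qed
  qed
qed

end
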